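(* Let $K$ be a discrete group acting on itself by conjugation. The graded homomorphism (shuffle homomorphism) $$\tau:\mathrm{Tot}_*\big(C_*(EK,\mathbb Z)\otimes_{\mathbb Z}C_*(EK,\mathbb Z)\big)\to C_*(EK,\mathbb Z)$$ is a chain map that satisfies the equations $$\tau\big((a^{-1},h^{-1})\cdot(g_1,\dots,g_p,g||k_1,\dots,k_q,k)\big)=(ha)^{-1}\cdot\tau(g_1,\dots,g_p,g||k_1,\dots,k_q,k),$$ $$(\epsilon\otimes\epsilon)(k||g)=\epsilon(kg)$$ for all elements $a,h,g_i,g,k_j,k$ of $K$. Hence it induces a graded homomorphism in homology $\tau_*:H_*(K\rtimes K,\mathbb Z)\to H_*(K,\mathbb Z)$, which is equal to the pushforward $\mu_*$ induced by the group homomorphism $\mu:K\rtimes K\to K$, $(a,g)\mapsto ag$.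
   Context: $K\rtimes K$ is the set $K\times K$ with product $(a,g)(b,h)=(a\,gbg^{-1},gh)$. For a group $H$, $C_n(EH,\mathbb Z)=\mathbb Z H^{\otimes n+1}$ with differential $\partial_H(h_1,\dots,h_{n+1})=(h_2,\dots,h_{n+1})+\sum_{i=1}^n(-1)^i(h_1,\dots,h_ih_{i+1},\dots,h_{n+1})$, left $\mathbb ZH$-action $h\cdot(h_1,\dots,h_{n+1})=(h_1,\dots,h_n,h_{n+1}h^{-1})$, augmentation $\epsilon:C_0(EH,\mathbb Z)\to\mathbb Z$, $\epsilon(h)=1$, and $\mathbb ZH$-basis $[h_1|\dots|h_n]=(h_1,\dots,h_n,1)$. It is a free resolution of $\mathbb Z$. Generators of $C_p(EK,\mathbb Z)\otimes C_q(EK,\mathbb Z)$ are written $(g_1,\dots,g_{p+1}||k_1,\dots,k_{q+1})$. The group $K\rtimes K$ acts by $(k,g)\cdot(g_1,\dots,g_{p+1}||k_1,\dots,k_{q+1})=(g_1,\dots,g_p,g_{p+1}g^{-1}||gk_1g^{-1},\dots,gk_qg^{-1},gk_{q+1}g^{-1}k^{-1})$. The total complex has differential $\partial_K\otimes1+(-1)^p\,1\otimes\partial_K$ and, with augmentation $\epsilon\otimes\epsilon$, is a free $\mathbb Z(K\rtimes K)$-resolution of $\mathbb Z$; homology of a group is computed by tensoring the resolution with $\mathbb Z$ over the group ring. A $(p,q)$-shuffle is $\lambda\in\mathfrak S_{p+q}$ with $\lambda(i)<\lambda(j)$ whenever $1\le i<j\le p$ or $p+1\le i<j\le p+q$. Define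 $\lambda[g_1|\dots|g_p|k_1|\dots|k_q]=[s_1|\dots|s_{p+q}]\in C_{p+q}(EK,\mathbb Z)$ with $s_{\lambda(i)}=g_i$ for $i\le p$ and $s_{\lambda(i)}=u\,k_{i-p}\,u^{-1}$, $u=g_{p+\lambda(i)-i+1}\cdots g_{p-1}g_p$ (empty product $=1$), for $i>p$. The shuffle homomorphism is $$\tau(g_1,\dots,g_p,g||k_1,\dots,k_q,k)=\sum_{\lambda\in\mathrm{Shuff}(p,q)}(gk)^{-1}\cdot(-1)^{|\lambda|}\lambda[g_1|\dots|g_p|gk_1g^{-1}|\dots|gk_qg^{-1}],$$ $(-1)^{|\lambda|}$ being the sign of $\lambda$. *)

theory Defs
  imports "HOL-Algebra.Algebra" "HOL-Combinatorics.Permutations"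
begin

text \<open>Chain groups are free abelian groups on explicit sets of generators. An element of the free
  abelian group on \<open>S\<close> is a finitely supported function \<open>'x \<Rightarrow>\<^sub>0 int\<close> with keys in \<open>S\<close>, and
  \<open>frag_of x\<close> is the generator \<open>x\<close>.

  Group elements act on chains by \<open>res_act\<close>. The augmentation \<open>res_aug\<close> is meaningful on chains of
  degree \<open>0\<close> only, and \<open>res_bdry\<close> vanishes on them.\<close>

record ('g, 'x) based_resolution =
  res_basis :: "nat \<Rightarrow> 'x set"
  res_bdry :: "('x \<Rightarrow>\<^sub>0 int) \<Rightarrow> ('x \<Rightarrow>\<^sub>0 int)"
  res_act :: "'g \<Rightarrow> ('x \<Rightarrow>\<^sub>0 int) \<Rightarrow> ('x \<Rightarrow>\<^sub>0 int)"
  res_aug :: "('x \<Rightarrow>\<^sub>0 int) \<Rightarrow> int"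

definition chain_group :: "('g, 'x) based_resolution \<Rightarrow> nat \<Rightarrow> ('x \<Rightarrow>\<^sub>0 int) monoid" where
  "chain_group R n = free_Abelian_group (res_basis R n)"

abbreviation chains :: "('g, 'x) based_resolution \<Rightarrow> nat \<Rightarrow> ('x \<Rightarrow>\<^sub>0 int) set" where
  "chains R n \<equiv> carrier (chain_group R n)"


section \<open>The resolution \<open>C\<^sub>*(EH, \<int>)\<close>\<close>

text \<open>A generator of degree \<open>n\<close> is a list of length \<open>n + 1\<close>; \<open>bar_face G xs i\<close> is
  \<open>(h\<^sub>2, \<dots>)\<close> for \<open>i = 0\<close> and \<open>(\<dots>, h\<^sub>i h\<^sub>i\<^sub>+\<^sub>1, \<dots>)\<close> for \<open>i \<ge> 1\<close>.\<close>

definition bar_face :: "('g, 'm) monoid_scheme \<Rightarrow> 'g list \<Rightarrow> nat \<Rightarrow> 'g list" where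
  "bar_face G xs i =
     (if i = 0 then tl xs
      else take (i - 1) xs @ [xs ! (i - 1) \<otimes>\<^bsub>G\<^esub> xs ! i] @ drop (i + 1) xs)"

definition bar_bdry_gen :: "('g, 'm) monoid_scheme \<Rightarrow> 'g list \<Rightarrow> ('g list \<Rightarrow>\<^sub>0 int)" where
  "bar_bdry_gen G xs =
     (let n = length xs - 1 in
      if n = 0 then 0
      else frag_of (bar_face G xs 0)
        + (\<Sum>i = 1..n. frag_cmul ((-1) ^ i) (frag_of (bar_face G xs i))))"

definition bar_act_gen :: "('g, 'm) monoid_scheme \<Rightarrow> 'g \<Rightarrow> 'g list \<Rightarrow> 'g list" where
  "bar_act_gen G h xs = butlast xs @ [last xs \<otimes>\<^bsub>G\<^esub> inv\<^bsub>G\<^esub> h]"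

definition bar_resolution :: "('g, 'm) monoid_scheme \<Rightarrow> ('g, 'g list) based_resolution" where
  "bar_resolution G =
     \<lparr>res_basis = (\<lambda>n. {xs. length xs = n + 1 \<and> set xs \<subseteq> carrier G}),
      res_bdry = frag_extend (bar_bdry_gen G),
      res_act = (\<lambda>h. frag_extend (frag_of \<circ> bar_act_gen G h)),
      res_aug = (\<lambda>c. \<Sum>x\<in>Poly_Mapping.keys c. Poly_Mapping.lookup c x)\<rparr>"

text \<open>The chain map \<open>C\<^sub>*(EG, \<int>) \<rightarrow> C\<^sub>*(EH, \<int>)\<close> given by applying a homomorphism entrywise.\<close>

definition bar_map :: "('g \<Rightarrow> 'h) \<Rightarrow> ('g list \<Rightarrow>\<^sub>0 int) \<Rightarrow> ('h list \<Rightarrow>\<^sub>0 int)" where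
  "bar_map \<alpha> = frag_extend (frag_of \<circ> map \<alpha>)"


section \<open>The group \<open>K \<rtimes> K\<close> and the resolution \<open>Tot\<^sub>*(C\<^sub>*(EK, \<int>) \<otimes> C\<^sub>*(EK, \<int>))\<close>\<close>

definition conj_semidirect :: "('a, 'm) monoid_scheme \<Rightarrow> ('a \<times> 'a) monoid" where
  "conj_semidirect K =
     \<lparr>carrier = carrier K \<times> carrier K,
      monoid.mult = (\<lambda>(a, g) (b, h). (a \<otimes>\<^bsub>K\<^esub> (g \<otimes>\<^bsub>K\<^esub> b \<otimes>\<^bsub>K\<^esub> inv\<^bsub>K\<^esub> g), g \<otimes>\<^bsub>K\<^esub> h)),
      one = (\<one>\<^bsub>K\<^esub>, \<one>\<^bsub>K\<^esub>)\<rparr>"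

definition semidirect_mu :: "('a, 'm) monoid_scheme \<Rightarrow> 'a \<times> 'a \<Rightarrow> 'a" where
  "semidirect_mu K = (\<lambda>(a, g). a \<otimes>\<^bsub>K\<^esub> g)"

lemma group_conj_semidirect:
  assumes "group K"
  shows "group (conj_semidirect K)"
proof -
  interpret group K by fact
  have cancel: "g \<otimes>\<^bsub>K\<^esub> (inv\<^bsub>K\<^esub> g \<otimes>\<^bsub>K\<^esub> x) = x" "inv\<^bsub>K\<^esub> g \<otimes>\<^bsub>K\<^esub> (g \<otimes>\<^bsub>K\<^esub> x) = x"
    if "g \<in> carrier K" "x \<in> carrier K" for g x
    using that by (simp_all flip: m_assoc)
  show ?thesis
  proof (rule groupI)
    fix x assume "x \<in> carrier (conj_semidirect K)"
    then obtain a g where x: "x = (a, g)" "a \<in> carrier K" "g \<in> carrier K"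
      by (auto simp: conj_semidirect_def)
    then show "\<exists>y\<in>carrier (conj_semidirect K).
        y \<otimes>\<^bsub>conj_semidirect K\<^esub> x = \<one>\<^bsub>conj_semidirect K\<^esub>"
      by (intro bexI[of _ "(inv\<^bsub>K\<^esub> g \<otimes>\<^bsub>K\<^esub> inv\<^bsub>K\<^esub> a \<otimes>\<^bsub>K\<^esub> g, inv\<^bsub>K\<^esub> g)"])
        (auto simp: conj_semidirect_def m_assoc cancel)
  qed (auto simp: conj_semidirect_def m_assoc inv_mult_group cancel)
qed

lemma semidirect_mu_hom:
  assumes "group K"
  shows "semidirect_mu K \<in> hom (conj_semidirect K) K"
proof -
  interpret group K by fact
  have cancel: "g \<otimes>\<^bsub>K\<^esub> (inv\<^bsub>K\<^esub> g \<otimes>\<^bsub>K\<^esub> x) = x" "inv\<^bsub>K\<^esub> g \<otimes>\<^bsub>K\<^esub> (g \<otimes>\<^bsub>K\<^esub> x) = x"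
    if "g \<in> carrier K" "x \<in> carrier K" for g x
    using that by (simp_all flip: m_assoc)
  show ?thesis
    by (auto simp: hom_def conj_semidirect_def semidirect_mu_def m_assoc cancel)
qed

text \<open>The generator \<open>(g\<^sub>1, \<dots>, g\<^sub>p\<^sub>+\<^sub>1 || k\<^sub>1, \<dots>, k\<^sub>q\<^sub>+\<^sub>1)\<close> of \<open>C\<^sub>p \<otimes> C\<^sub>q\<close> is the pair of its two lists.\<close>

definition tot_bdry_gen :: "('a, 'm) monoid_scheme \<Rightarrow> 'a list \<times> 'a list \<Rightarrow> ('a list \<times> 'a list \<Rightarrow>\<^sub>0 int)" where
  "tot_bdry_gen K = (\<lambda>(xs, ys).
     frag_extend (\<lambda>xs'. frag_of (xs', ys)) (bar_bdry_gen K xs)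
     + frag_cmul ((-1) ^ (length xs - 1)) (frag_extend (\<lambda>ys'. frag_of (xs, ys')) (bar_bdry_gen K ys)))"

definition tot_act_gen :: "('a, 'm) monoid_scheme \<Rightarrow> 'a \<times> 'a \<Rightarrow> 'a list \<times> 'a list \<Rightarrow> 'a list \<times> 'a list" where
  "tot_act_gen K = (\<lambda>(k, g) (xs, ys).
     (butlast xs @ [last xs \<otimes>\<^bsub>K\<^esub> inv\<^bsub>K\<^esub> g],
      map (\<lambda>y. g \<otimes>\<^bsub>K\<^esub> y \<otimes>\<^bsub>K\<^esub> inv\<^bsub>K\<^esub> g) (butlast ys)
        @ [g \<otimes>\<^bsub>K\<^esub> last ys \<otimes>\<^bsub>K\<^esub> inv\<^bsub>K\<^esub> g \<otimes>\<^bsub>K\<^esub> inv\<^bsub>K\<^esub> k]))"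

definition tot_resolution :: "('a, 'm) monoid_scheme \<Rightarrow> ('a \<times> 'a, 'a list \<times> 'a list) based_resolution" where
  "tot_resolution K =
     \<lparr>res_basis = (\<lambda>n. \<Union>p\<le>n. res_basis (bar_resolution K) p \<times> res_basis (bar_resolution K) (n - p)),
      res_bdry = frag_extend (tot_bdry_gen K),
      res_act = (\<lambda>x. frag_extend (frag_of \<circ> tot_act_gen K x)),
      res_aug = (\<lambda>c. \<Sum>(x, y)\<in>Poly_Mapping.keys c. Poly_Mapping.lookup c (x, y)
        * (res_aug (bar_resolution K) (frag_of x) * res_aug (bar_resolution K) (frag_of y)))\<rparr>"


section \<open>The shuffle homomorphism\<close>

definition shuffle_perms :: "nat \<Rightarrow> nat \<Rightarrow> (nat \<Rightarrow> nat) set" where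
  "shuffle_perms p q = {\<pi>. \<pi> permutes {1..p + q} \<and>
     (\<forall>i j. (1 \<le> i \<and> i < j \<and> j \<le> p) \<or> (p + 1 \<le> i \<and> i < j \<and> j \<le> p + q) \<longrightarrow> \<pi> i < \<pi> j)}"

text \<open>\<open>shuffle_entry K \<pi> gs ks i\<close> is the entry \<open>s\<^bsub>\<pi>(i)\<^esub>\<close>. The indices \<open>i\<close> and \<open>\<pi>(i)\<close> count from \<open>1\<close>,
  list positions from \<open>0\<close>, so the list dropped to below starts with \<open>g\<^bsub>p + \<pi>(i) - i + 1\<^esub>\<close>.
  For a shuffle \<open>\<pi>\<close> and \<open>i > p\<close> one has \<open>p + \<pi>(i) \<ge> i\<close>, so that the subtraction does not truncate.\<close>

definition shuffle_entry :: "('a, 'm) monoid_scheme \<Rightarrow> (nat \<Rightarrow> nat) \<Rightarrow> 'a list \<Rightarrow> 'a list \<Rightarrow> nat \<Rightarrow> 'a" where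
  "shuffle_entry K \<pi> gs ks i =
     (let p = length gs in
      if i \<le> p then gs ! (i - 1)
      else let u = foldr (\<otimes>\<^bsub>K\<^esub>) (drop (p + \<pi> i - i) gs) \<one>\<^bsub>K\<^esub>
           in u \<otimes>\<^bsub>K\<^esub> ks ! (i - p - 1) \<otimes>\<^bsub>K\<^esub> inv\<^bsub>K\<^esub> u)"

text \<open>The list \<open>(s\<^sub>1, \<dots>, s\<^bsub>p+q\<^esub>, 1)\<close>, which stands for \<open>\<pi>[g\<^sub>1|\<dots>|g\<^sub>p|k\<^sub>1|\<dots>|k\<^sub>q] = [s\<^sub>1|\<dots>|s\<^bsub>p+q\<^esub>]\<close>.\<close>

definition shuffle_gen :: "('a, 'm) monoid_scheme \<Rightarrow> (nat \<Rightarrow> nat) \<Rightarrow> 'a list \<Rightarrow> 'a list \<Rightarrow> 'a list" where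
  "shuffle_gen K \<pi> gs ks =
     map (\<lambda>m. shuffle_entry K \<pi> gs ks (inv_into UNIV \<pi> m)) [1..<length gs + length ks + 1] @ [\<one>\<^bsub>K\<^esub>]"

definition shuffle_hom_gen :: "('a, 'm) monoid_scheme \<Rightarrow> 'a list \<times> 'a list \<Rightarrow> ('a list \<Rightarrow>\<^sub>0 int)" where
  "shuffle_hom_gen K = (\<lambda>(xs, ys).
     let gs = butlast xs; g = last xs; ks = butlast ys; k = last ys in
     (\<Sum>\<pi>\<in>shuffle_perms (length gs) (length ks).
        res_act (bar_resolution K) (inv\<^bsub>K\<^esub> (g \<otimes>\<^bsub>K\<^esub> k))
          (frag_cmul (sign \<pi>)
            (frag_of (shuffle_gen K \<pi> gs (map (\<lambda>y. g \<otimes>\<^bsub>K\<^esub> y \<otimes>\<^bsub>K\<^esub> inv\<^bsub>K\<^esub> g) ks))))))"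

definition shuffle_hom :: "('a, 'm) monoid_scheme \<Rightarrow> ('a list \<times> 'a list \<Rightarrow>\<^sub>0 int) \<Rightarrow> ('a list \<Rightarrow>\<^sub>0 int)" where
  "shuffle_hom K = frag_extend (shuffle_hom_gen K)"


section \<open>Group homology computed from a resolution\<close>

text \<open>\<open>M \<otimes>\<^bsub>\<int>G\<^esub> \<int>\<close> for \<open>M\<close> the group of \<open>n\<close>-chains and \<open>\<int>\<close> the trivial module: the free abelian
  group on \<open>M \<times> \<int>\<close> (the generator \<open>(c, z)\<close> stands for \<open>c \<otimes> z\<close>) modulo biadditivity and
  \<open>g c \<otimes> z = c \<otimes> z\<close>. By additivity it suffices to impose the last relation for group elements \<open>g\<close>.\<close>

definition tensor_free :: "('g, 'x) based_resolution \<Rightarrow> nat \<Rightarrow> ((('x \<Rightarrow>\<^sub>0 int) \<times> int) \<Rightarrow>\<^sub>0 int) monoid" where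
  "tensor_free R n = free_Abelian_group (chains R n \<times> UNIV)"

definition tensor_relators ::
  "('g, 'm) monoid_scheme \<Rightarrow> ('g, 'x) based_resolution \<Rightarrow> nat \<Rightarrow> ((('x \<Rightarrow>\<^sub>0 int) \<times> int) \<Rightarrow>\<^sub>0 int) set" where
  "tensor_relators G R n =
     {frag_of (c + c', z) - frag_of (c, z) - frag_of (c', z) | c c' z. c \<in> chains R n \<and> c' \<in> chains R n}
   \<union> {frag_of (c, z + z') - frag_of (c, z) - frag_of (c, z') | c z z'. c \<in> chains R n}
   \<union> {frag_of (res_act R g c, z) - frag_of (c, z) | g c z. g \<in> carrier G \<and> c \<in> chains R n}"

definition tensor_rel ::
  "('g, 'm) monoid_scheme \<Rightarrow> ('g, 'x) based_resolution \<Rightarrow> nat \<Rightarrow> ((('x \<Rightarrow>\<^sub>0 int) \<times> int) \<Rightarrow>\<^sub>0 int) set" where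
  "tensor_rel G R n = generate (tensor_free R n) (tensor_relators G R n)"

definition tensor_Z ::
  "('g, 'm) monoid_scheme \<Rightarrow> ('g, 'x) based_resolution \<Rightarrow> nat \<Rightarrow> ((('x \<Rightarrow>\<^sub>0 int) \<times> int) \<Rightarrow>\<^sub>0 int) set monoid" where
  "tensor_Z G R n = tensor_free R n Mod tensor_rel G R n"

text \<open>The map \<open>A Mod N \<rightarrow> B Mod M\<close> induced by \<open>f\<close>. The union below is a single coset of \<open>M\<close> exactly
  when all \<open>f x\<close> with \<open>x \<in> C\<close> lie in the same coset.\<close>

definition induced_quotient_map :: "('b, 'm) monoid_scheme \<Rightarrow> 'b set \<Rightarrow> ('a \<Rightarrow> 'b) \<Rightarrow> 'a set \<Rightarrow> 'b set" where
  "induced_quotient_map B M f C = (\<Union>x\<in>C. M #>\<^bsub>B\<^esub> f x)"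

text \<open>The map \<open>f \<otimes> 1\<close> into the group \<open>tensor_Z G R n\<close>.\<close>

definition tensor_Z_map ::
  "('g, 'm) monoid_scheme \<Rightarrow> ('g, 'y) based_resolution \<Rightarrow> nat \<Rightarrow> (('x \<Rightarrow>\<^sub>0 int) \<Rightarrow> ('y \<Rightarrow>\<^sub>0 int)) \<Rightarrow>
     ((('x \<Rightarrow>\<^sub>0 int) \<times> int) \<Rightarrow>\<^sub>0 int) set \<Rightarrow> ((('y \<Rightarrow>\<^sub>0 int) \<times> int) \<Rightarrow>\<^sub>0 int) set" where
  "tensor_Z_map G R n f =
     induced_quotient_map (tensor_free R n) (tensor_rel G R n) (frag_extend (\<lambda>(c, z). frag_of (f c, z)))"

definition cycle_group ::
  "('g, 'm) monoid_scheme \<Rightarrow> ('g, 'x) based_resolution \<Rightarrow> nat \<Rightarrow> ((('x \<Rightarrow>\<^sub>0 int) \<times> int) \<Rightarrow>\<^sub>0 int) set monoid" where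
  "cycle_group G R n = (tensor_Z G R n)
     \<lparr>carrier := if n = 0 then carrier (tensor_Z G R 0)
        else kernel (tensor_Z G R n) (tensor_Z G R (n - 1)) (tensor_Z_map G R (n - 1) (res_bdry R))\<rparr>"

definition boundaries ::
  "('g, 'm) monoid_scheme \<Rightarrow> ('g, 'x) based_resolution \<Rightarrow> nat \<Rightarrow> ((('x \<Rightarrow>\<^sub>0 int) \<times> int) \<Rightarrow>\<^sub>0 int) set set" where
  "boundaries G R n = tensor_Z_map G R n (res_bdry R) ` carrier (tensor_Z G R (n + 1))"

text \<open>\<open>H\<^sub>n(G, \<int>)\<close> computed with the resolution \<open>R\<close>.\<close>

definition homology ::
  "('g, 'm) monoid_scheme \<Rightarrow> ('g, 'x) based_resolution \<Rightarrow> nat \<Rightarrow> ((('x \<Rightarrow>\<^sub>0 int) \<times> int) \<Rightarrow>\<^sub>0 int) set set monoid" where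
  "homology G R n = cycle_group G R n Mod boundaries G R n"

text \<open>The map \<open>f\<^sub>*\<close> into \<open>homology G R n\<close> induced by a chain map \<open>f\<close>.\<close>

definition homology_map ::
  "('g, 'm) monoid_scheme \<Rightarrow> ('g, 'y) based_resolution \<Rightarrow> nat \<Rightarrow> (('x \<Rightarrow>\<^sub>0 int) \<Rightarrow> ('y \<Rightarrow>\<^sub>0 int)) \<Rightarrow>
     ((('x \<Rightarrow>\<^sub>0 int) \<times> int) \<Rightarrow>\<^sub>0 int) set set \<Rightarrow> ((('y \<Rightarrow>\<^sub>0 int) \<times> int) \<Rightarrow>\<^sub>0 int) set set" where
  "homology_map G R n f = induced_quotient_map (cycle_group G R n) (boundaries G R n) (tensor_Z_map G R n f)"

definition is_graded_hom ::
  "('g, 'x) based_resolution \<Rightarrow> ('h, 'y) based_resolution \<Rightarrow> (('x \<Rightarrow>\<^sub>0 int) \<Rightarrow> ('y \<Rightarrow>\<^sub>0 int)) \<Rightarrow> bool" where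
  "is_graded_hom R S f \<longleftrightarrow> (\<forall>n. f \<in> hom (chain_group R n) (chain_group S n))"

definition is_chain_map ::
  "('g, 'x) based_resolution \<Rightarrow> ('h, 'y) based_resolution \<Rightarrow> (('x \<Rightarrow>\<^sub>0 int) \<Rightarrow> ('y \<Rightarrow>\<^sub>0 int)) \<Rightarrow> bool" where
  "is_chain_map R S f \<longleftrightarrow> is_graded_hom R S f \<and> (\<forall>n. \<forall>c\<in>chains R n. res_bdry S (f c) = f (res_bdry R c))"

text \<open>Comparison maps between two resolutions of \<open>\<int>\<close> over the same group ring. Any two of them are
  equivariantly chain homotopic, so they all induce the same, canonical, identification of the
  homology groups computed with the two resolutions.\<close>

definition is_comparison_map ::
  "('g, 'm) monoid_scheme \<Rightarrow> ('g, 'x) based_resolution \<Rightarrow> ('g, 'y) based_resolution \<Rightarrow>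
     (('x \<Rightarrow>\<^sub>0 int) \<Rightarrow> ('y \<Rightarrow>\<^sub>0 int)) \<Rightarrow> bool" where
  "is_comparison_map G R S f \<longleftrightarrow> is_chain_map R S f
     \<and> (\<forall>g\<in>carrier G. \<forall>n. \<forall>c\<in>chains R n. f (res_act R g c) = res_act S g (f c))
     \<and> (\<forall>c\<in>chains R 0. res_aug S (f c) = res_aug R c)"

text \<open>\<open>\<alpha>\<^sub>* : H\<^sub>n(G, \<int>) \<rightarrow> H\<^sub>n(H, \<int>)\<close> for a homomorphism \<open>\<alpha> : G \<rightarrow> H\<close>, both sides computed with the
  resolutions \<open>C\<^sub>*(EG, \<int>)\<close> and \<open>C\<^sub>*(EH, \<int>)\<close>.\<close>

definition pushforward ::
  "('h, 'm) monoid_scheme \<Rightarrow> nat \<Rightarrow> ('g \<Rightarrow> 'h) \<Rightarrow>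
     ((('g list \<Rightarrow>\<^sub>0 int) \<times> int) \<Rightarrow>\<^sub>0 int) set set \<Rightarrow> ((('h list \<Rightarrow>\<^sub>0 int) \<times> int) \<Rightarrow>\<^sub>0 int) set set" where
  "pushforward H n \<alpha> = homology_map H (bar_resolution H) n (bar_map \<alpha>)"

end

theory Submission
  imports Defs
begin

text \<open>Replace the generator \<open>(h\<^sub>1, \<dots>, h\<^sub>n\<^sub>+\<^sub>1)\<close> by the simplex with vertices \<open>y\<^sub>i = h\<^sub>i \<dots> h\<^sub>n\<^sub>+\<^sub>1\<close>. Then
  \<open>C\<^sub>*(EK, \<int>)\<close> is the ordered chain complex of the full simplex on \<open>K\<close>, and the shuffle homomorphism
  is the Eilenberg-Zilber map followed by the map induced by \<open>(x, z) \<mapsto> x z\<close> on vertices. The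
  Eilenberg-Zilber map is a chain map by induction on the last step of the lattice paths. The element
  \<open>(k, g)\<close> acts on vertices by \<open>x \<mapsto> x g\<^sup>-\<^sup>1\<close> and \<open>z \<mapsto> g z g\<^sup>-\<^sup>1 k\<^sup>-\<^sup>1\<close>, hence on \<open>x z\<close> by right multiplication
  with \<open>(k g)\<^sup>-\<^sup>1\<close>, so that \<open>\<tau>\<close> is equivariant along \<open>\<mu>\<close>. Both complexes are free and contractible; by the
  comparison theorem any comparison map \<open>\<phi>\<close> induces an isomorphism, and \<open>\<tau> \<circ> \<phi>\<close> and the map of bar
  resolutions induced by \<open>\<mu>\<close> are homotopic, being chain maps equivariant along \<open>\<mu>\<close> that preserve the
  augmentation.\<close>

section \<open>Maps induced on quotients\<close>

text \<open>In vertex coordinates the Eilenberg-Zilber part knows nothing of the group: it is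
  combinatorics of lattice paths, and multiplication enters only when the two coordinates of each
  vertex are multiplied. The conjugations in the definition of \<tau> then come out as quotients of
  consecutive products. In the induction for the boundary, the terms that must cancel belong to
  paths that turn in their last two steps: deleting the turning point leaves the same vertex list
  for both orders of these steps, and the two signs are opposite. One mismatch recurs in low
  degrees. The simplicial boundary of a single vertex is the empty list, the bar boundary is zero;
  products with the empty list are therefore set to zero, and degrees zero and one are often treated
  apart. The comparison theorem builds maps degree by degree, whereas a chain map is one function on
  all degrees. The pieces are glued by means of the disjointness of the bases, and a homotopy is
  handled in the same way.\<close>

lemma induced_quotient_map_coset:
  assumes "comm_group A" "subgroup N A" "comm_group B" "subgroup M B"
    and F: "F \<in> hom A B" "F ` N \<subseteq> M" and a: "a \<in> carrier A"
  shows "induced_quotient_map B M F (N #>\<^bsub>A\<^esub> a) = M #>\<^bsub>B\<^esub> F a"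
proof -
  interpret A: comm_group A by fact
  interpret B: comm_group B by fact
  interpret N: subgroup N A by fact
  have Fa: "F a \<in> carrier B" using F a by (auto simp: hom_def)
  \<comment> \<open>All elements of the coset of \<open>a\<close> are sent into the one coset of
    \<open>F a\<close>, so the union in \<open>induced_quotient_map\<close> collapses.\<close>
  have *: "M #>\<^bsub>B\<^esub> F x = M #>\<^bsub>B\<^esub> F a" if x: "x \<in> N #>\<^bsub>A\<^esub> a" for x
  proof -
    obtain n where n: "n \<in> N" "x = n \<otimes>\<^bsub>A\<^esub> a" using x by (auto simp: r_coset_def)
    have "F x = F n \<otimes>\<^bsub>B\<^esub> F a" using n a F by (auto simp: hom_def)
    then have "F x \<in> M #>\<^bsub>B\<^esub> F a" using n F by (auto simp: r_coset_def)
    then show ?thesis using B.repr_independence[OF _ Fa assms(4)] by metis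
  qed
  have "a \<in> N #>\<^bsub>A\<^esub> a" by (rule A.rcos_self[OF a assms(2)])
  then show ?thesis unfolding induced_quotient_map_def using * by blast
qed

lemma induced_quotient_map_hom:
  assumes "comm_group A" "subgroup N A" "comm_group B" "subgroup M B"
    and F: "F \<in> hom A B" "F ` N \<subseteq> M"
  shows "induced_quotient_map B M F \<in> hom (A Mod N) (B Mod M)"
proof -
  interpret A: comm_group A by fact
  interpret B: comm_group B by fact
  interpret N: normal N A using assms A.normal_iff_subgroup by blast
  interpret M: normal M B using assms B.normal_iff_subgroup by blast
  note coset = induced_quotient_map_coset[OF assms]
  show ?thesis
  proof (rule homI)
    fix x assume "x \<in> carrier (A Mod N)"
    then obtain a where "a \<in> carrier A" "x = N #>\<^bsub>A\<^esub> a" by (auto simp: carrier_FactGroup)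
    then show "induced_quotient_map B M F x \<in> carrier (B Mod M)"
      using F by (auto simp: carrier_FactGroup coset hom_def)
  next
    fix x y assume "x \<in> carrier (A Mod N)" "y \<in> carrier (A Mod N)"
    then obtain a b where ab: "a \<in> carrier A" "x = N #>\<^bsub>A\<^esub> a" "b \<in> carrier A" "y = N #>\<^bsub>A\<^esub> b"
      by (auto simp: carrier_FactGroup)
    have "F a \<in> carrier B" "F b \<in> carrier B" "F (a \<otimes>\<^bsub>A\<^esub> b) = F a \<otimes>\<^bsub>B\<^esub> F b"
      using F ab by (auto simp: hom_def)
    then show "induced_quotient_map B M F (x \<otimes>\<^bsub>A Mod N\<^esub> y)
        = induced_quotient_map B M F x \<otimes>\<^bsub>B Mod M\<^esub> induced_quotient_map B M F y"
      using ab by (simp add: N.rcos_sum M.rcos_sum coset)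
  qed
qed

section \<open>Resolutions with a free basis action\<close>

text \<open>Generators and differences exhaust a free abelian group, so statements compatible with
  subtraction need no treatment of coefficients. The premises on \<open>c\<close> and
  \<open>d\<close> keep the degree available during the induction.\<close>

lemma chains_induct [consumes 1, case_names zero one diff]:
  assumes "c \<in> chains R n" "P 0" "\<And>x. x \<in> res_basis R n \<Longrightarrow> P (frag_of x)"
    "\<And>c d. c \<in> chains R n \<Longrightarrow> d \<in> chains R n \<Longrightarrow> P c \<Longrightarrow> P d \<Longrightarrow> P (c - d)"
  shows "P c"
  using assms by (intro free_Abelian_group_induct[of c "res_basis R n" P]) (auto simp: chain_group_def)

text \<open>The bases of different degrees have to be disjoint because a chain map is a single function for
  all degrees.\<close>

locale free_resolution = group G for G :: "('g, 'm) monoid_scheme" (structure) +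
  fixes R :: "('g, 'x) based_resolution"
  assumes bdry_extend: "res_bdry R c = frag_extend (\<lambda>x. res_bdry R (frag_of x)) c"
    and act_extend: "res_act R g c = frag_extend (\<lambda>x. res_act R g (frag_of x)) c"
    and aug_add: "res_aug R (c + d) = res_aug R c + res_aug R d"
    and bdry_basis: "x \<in> res_basis R (Suc n) \<Longrightarrow> res_bdry R (frag_of x) \<in> chains R n"
    and bdry_basis_0: "x \<in> res_basis R 0 \<Longrightarrow> res_bdry R (frag_of x) = 0"
    and bdry_bdry_basis: "x \<in> res_basis R n \<Longrightarrow> res_bdry R (res_bdry R (frag_of x)) = 0"
    and aug_bdry_basis: "x \<in> res_basis R (Suc 0) \<Longrightarrow> res_aug R (res_bdry R (frag_of x)) = 0"
    and act_basis: "g \<in> carrier G \<Longrightarrow> x \<in> res_basis R n \<Longrightarrow>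
      \<exists>y\<in>res_basis R n. res_act R g (frag_of x) = frag_of y"
    and act_one_basis: "x \<in> res_basis R n \<Longrightarrow> res_act R \<one> (frag_of x) = frag_of x"
    and act_mult_basis: "g \<in> carrier G \<Longrightarrow> h \<in> carrier G \<Longrightarrow> x \<in> res_basis R n \<Longrightarrow>
      res_act R (g \<otimes> h) (frag_of x) = res_act R g (res_act R h (frag_of x))"
    and act_free: "g \<in> carrier G \<Longrightarrow> x \<in> res_basis R n \<Longrightarrow>
      res_act R g (frag_of x) = frag_of x \<Longrightarrow> g = \<one>"
    and bdry_act_basis: "g \<in> carrier G \<Longrightarrow> x \<in> res_basis R n \<Longrightarrow>
      res_bdry R (res_act R g (frag_of x)) = res_act R g (res_bdry R (frag_of x))"
    and aug_basis: "x \<in> res_basis R 0 \<Longrightarrow> res_aug R (frag_of x) = 1"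
    and basis_disjoint: "x \<in> res_basis R n \<Longrightarrow> x \<in> res_basis R m \<Longrightarrow> n = m"
    and basis_0: "res_basis R 0 \<noteq> {}"
    and exact_0: "c \<in> chains R 0 \<Longrightarrow> res_aug R c = 0 \<Longrightarrow> \<exists>d\<in>chains R (Suc 0). res_bdry R d = c"
    and exact_Suc: "c \<in> chains R (Suc n) \<Longrightarrow> res_bdry R c = 0 \<Longrightarrow>
      \<exists>d\<in>chains R (Suc (Suc n)). res_bdry R d = c"
begin

lemma chains_iff: "c \<in> chains R n \<longleftrightarrow> Poly_Mapping.keys c \<subseteq> res_basis R n"
  by (simp add: chain_group_def)

lemma chain_group_simps [simp]:
  "c \<otimes>\<^bsub>chain_group R n\<^esub> d = c + d" "\<one>\<^bsub>chain_group R n\<^esub> = 0"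
  by (simp_all add: chain_group_def)

lemma chains_zero [simp]: "0 \<in> chains R n"
  by (simp add: chains_iff)

lemma chains_frag_of [simp]: "frag_of x \<in> chains R n \<longleftrightarrow> x \<in> res_basis R n"
  by (simp add: chains_iff)

lemma chains_add: "c \<in> chains R n \<Longrightarrow> d \<in> chains R n \<Longrightarrow> c + d \<in> chains R n"
  unfolding chains_iff using keys_add[of c d] by blast

lemma chains_diff: "c \<in> chains R n \<Longrightarrow> d \<in> chains R n \<Longrightarrow> c - d \<in> chains R n"
  unfolding chains_iff using keys_diff[of c d] by blast

lemma bdry_zero [simp]: "res_bdry R 0 = 0"
  by (subst bdry_extend) simp

lemma bdry_add: "res_bdry R (c + d) = res_bdry R c + res_bdry R d"
  by (subst (1 2 3) bdry_extend) (simp add: frag_extend_add)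

lemma bdry_diff: "res_bdry R (c - d) = res_bdry R c - res_bdry R d"
  by (subst (1 2 3) bdry_extend) (simp add: frag_extend_diff)

lemma act_zero [simp]: "res_act R g 0 = 0"
  by (subst act_extend) simp

lemma act_add: "res_act R g (c + d) = res_act R g c + res_act R g d"
  by (subst (1 2 3) act_extend) (simp add: frag_extend_add)

lemma act_diff: "res_act R g (c - d) = res_act R g c - res_act R g d"
  by (subst (1 2 3) act_extend) (simp add: frag_extend_diff)

lemma aug_zero [simp]: "res_aug R 0 = 0"
  using aug_add[of 0 0] by simp

lemma aug_diff: "res_aug R (c - d) = res_aug R c - res_aug R d"
  using aug_add[of "c - d" d] by simp

lemma bdry_closed: "c \<in> chains R (Suc n) \<Longrightarrow> res_bdry R c \<in> chains R n"
  by (induction c rule: chains_induct) (auto simp: bdry_diff bdry_basis chains_diff)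

lemma bdry_0: "c \<in> chains R 0 \<Longrightarrow> res_bdry R c = 0"
  by (induction c rule: chains_induct) (auto simp: bdry_diff bdry_basis_0)

lemma bdry_bdry: "c \<in> chains R n \<Longrightarrow> res_bdry R (res_bdry R c) = 0"
  by (induction c rule: chains_induct) (auto simp: bdry_diff bdry_bdry_basis)

lemma aug_bdry: "c \<in> chains R (Suc 0) \<Longrightarrow> res_aug R (res_bdry R c) = 0"
  by (induction c rule: chains_induct) (auto simp: bdry_diff aug_diff aug_bdry_basis)

lemma act_closed: "c \<in> chains R n \<Longrightarrow> g \<in> carrier G \<Longrightarrow> res_act R g c \<in> chains R n"
proof (induction c rule: chains_induct)
  case (one x)
  then show ?case using act_basis[of g x n] by auto
qed (auto simp: act_diff chains_diff)

lemma act_mult: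
  "c \<in> chains R n \<Longrightarrow> g \<in> carrier G \<Longrightarrow> h \<in> carrier G \<Longrightarrow>
    res_act R (g \<otimes> h) c = res_act R g (res_act R h c)"
  by (induction c rule: chains_induct) (auto simp: act_diff act_mult_basis)

lemma bdry_act:
  "c \<in> chains R n \<Longrightarrow> g \<in> carrier G \<Longrightarrow> res_bdry R (res_act R g c) = res_act R g (res_bdry R c)"
  by (induction c rule: chains_induct) (auto simp: act_diff bdry_diff bdry_act_basis)

lemma aug_act: "c \<in> chains R 0 \<Longrightarrow> g \<in> carrier G \<Longrightarrow> res_aug R (res_act R g c) = res_aug R c"
proof (induction c rule: chains_induct)
  case (one x)
  then show ?case using act_basis[of g x 0] by (auto simp: aug_basis)
qed (auto simp: act_diff aug_diff)

end

section \<open>The functor \<open>- \<otimes>\<^bsub>\<int>G\<^esub> \<int>\<close>\<close>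

text \<open>The two degrees are separate parameters so that one notion covers boundary operators,
  chain maps and homotopies. Everything is required on chains of degree \<open>n\<close> only, which
  allows a different formula in each degree before glueing.\<close>

definition equivariant ::
  "('g, 'm) monoid_scheme \<Rightarrow> ('g, 'x) based_resolution \<Rightarrow> nat \<Rightarrow> ('h, 'y) based_resolution \<Rightarrow> nat \<Rightarrow>
     ('g \<Rightarrow> 'h) \<Rightarrow> (('x \<Rightarrow>\<^sub>0 int) \<Rightarrow> ('y \<Rightarrow>\<^sub>0 int)) \<Rightarrow> bool" where
  "equivariant G R n S m \<alpha> f \<longleftrightarrow>
     (\<forall>c\<in>chains R n. f c \<in> chains S m)
   \<and> (\<forall>c\<in>chains R n. \<forall>d\<in>chains R n. f (c + d) = f c + f d)
   \<and> (\<forall>g\<in>carrier G. \<forall>c\<in>chains R n. f (res_act R g c) = res_act S (\<alpha> g) (f c))"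

abbreviation tensor_lift :: "('c \<Rightarrow> 'd) \<Rightarrow> (('c \<times> int) \<Rightarrow>\<^sub>0 int) \<Rightarrow> (('d \<times> int) \<Rightarrow>\<^sub>0 int)" where
  "tensor_lift f \<equiv> frag_extend (\<lambda>(c, z). frag_of (f c, z))"

lemma carrier_tensor_free: "w \<in> carrier (tensor_free R n) \<longleftrightarrow> Poly_Mapping.keys w \<subseteq> chains R n \<times> UNIV"
  by (simp add: tensor_free_def)

lemma tensor_free_simps [simp]:
  "v \<otimes>\<^bsub>tensor_free R n\<^esub> w = v + w" "\<one>\<^bsub>tensor_free R n\<^esub> = 0"
  by (simp_all add: tensor_free_def)

lemma comm_group_tensor_free: "comm_group (tensor_free R n)"
  unfolding tensor_free_def by (rule abelian_free_Abelian_group)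

lemma tensor_free_diff:
  "v \<in> carrier (tensor_free R n) \<Longrightarrow> w \<in> carrier (tensor_free R n) \<Longrightarrow> v - w \<in> carrier (tensor_free R n)"
  unfolding carrier_tensor_free using keys_diff[of v w] by blast

lemma tensor_free_add:
  "v \<in> carrier (tensor_free R n) \<Longrightarrow> w \<in> carrier (tensor_free R n) \<Longrightarrow> v + w \<in> carrier (tensor_free R n)"
  unfolding carrier_tensor_free using keys_add[of v w] by blast

context free_resolution
begin

lemma tensor_relators_closed: "tensor_relators G R n \<subseteq> carrier (tensor_free R n)"
proof -
  have "frag_of (c, z) \<in> carrier (tensor_free R n)" if "c \<in> chains R n" for c and z :: int
    using that by (simp add: carrier_tensor_free)
  then show ?thesis
    by (auto simp: tensor_relators_def intro!: tensor_free_diff chains_add act_closed)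
qed

lemma tensor_rel_subgroup: "subgroup (tensor_rel G R n) (tensor_free R n)"
proof -
  interpret T: comm_group "tensor_free R n" by (rule comm_group_tensor_free)
  show ?thesis
    unfolding tensor_rel_def by (rule T.generate_is_subgroup[OF tensor_relators_closed])
qed

lemma tensor_rel_add:
  "v \<in> tensor_rel G R n \<Longrightarrow> w \<in> tensor_rel G R n \<Longrightarrow> v + w \<in> tensor_rel G R n"
  using subgroup.m_closed[OF tensor_rel_subgroup] by force

lemma tensor_rel_diff:
  assumes "v \<in> tensor_rel G R n" "w \<in> tensor_rel G R n" shows "v - w \<in> tensor_rel G R n"
proof -
  have "inv\<^bsub>tensor_free R n\<^esub> w = - w"
    using subgroup.mem_carrier[OF tensor_rel_subgroup assms(2)] by (simp add: tensor_free_def)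
  then have "- w \<in> tensor_rel G R n"
    using subgroup.m_inv_closed[OF tensor_rel_subgroup assms(2)] by simp
  then show ?thesis using tensor_rel_add[OF assms(1)] by fastforce
qed

lemma comm_group_tensor_Z: "comm_group (tensor_Z G R n)"
  unfolding tensor_Z_def
  by (rule comm_group.abelian_FactGroup[OF comm_group_tensor_free tensor_rel_subgroup])

lemma carrier_tensor_Z:
  "carrier (tensor_Z G R n) = (\<lambda>w. tensor_rel G R n #>\<^bsub>tensor_free R n\<^esub> w) ` carrier (tensor_free R n)"
  by (simp add: tensor_Z_def carrier_FactGroup)

lemma tensor_Z_mult_coset:
  assumes "v \<in> carrier (tensor_free R n)" "w \<in> carrier (tensor_free R n)"
  shows "(tensor_rel G R n #>\<^bsub>tensor_free R n\<^esub> v) \<otimes>\<^bsub>tensor_Z G R n\<^esub> (tensor_rel G R n #>\<^bsub>tensor_free R n\<^esub> w)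
    = tensor_rel G R n #>\<^bsub>tensor_free R n\<^esub> (v + w)"
proof -
  interpret T: comm_group "tensor_free R n" by (rule comm_group_tensor_free)
  interpret normal "tensor_rel G R n" "tensor_free R n"
    using tensor_rel_subgroup T.normal_iff_subgroup by blast
  show ?thesis using rcos_sum[OF assms] by (simp add: tensor_Z_def)
qed

lemma tensor_Z_coset_eqI:
  assumes "v \<in> carrier (tensor_free R n)" "w \<in> carrier (tensor_free R n)" "v - w \<in> tensor_rel G R n"
  shows "tensor_rel G R n #>\<^bsub>tensor_free R n\<^esub> v = tensor_rel G R n #>\<^bsub>tensor_free R n\<^esub> w"
proof -
  interpret T: comm_group "tensor_free R n" by (rule comm_group_tensor_free)
  have "v = (v - w) \<otimes>\<^bsub>tensor_free R n\<^esub> w" by simp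
  then have "v \<in> tensor_rel G R n #>\<^bsub>tensor_free R n\<^esub> w"
    using assms(3) unfolding r_coset_def by blast
  then show ?thesis using T.repr_independence[OF _ assms(2) tensor_rel_subgroup] by simp
qed

end

text \<open>With \<alpha> the identity this is the setting for comparing two resolutions over one
  group; with \<open>semidirect_mu\<close> it is the setting for \<tau> and for the bar map of
  \<mu>.\<close>

locale resolution_pair =
  R: free_resolution G R + S: free_resolution H S
  for G :: "('g, 'm) monoid_scheme" and R :: "('g, 'x) based_resolution"
    and H :: "('h, 'n) monoid_scheme" and S :: "('h, 'y) based_resolution" +
  fixes \<alpha> :: "'g \<Rightarrow> 'h"
  assumes hom: "\<alpha> \<in> hom G H"
begin

lemma hom_closed [simp]: "g \<in> carrier G \<Longrightarrow> \<alpha> g \<in> carrier H"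
  using hom by (auto simp: hom_def)

lemma hom_mult: "g \<in> carrier G \<Longrightarrow> h \<in> carrier G \<Longrightarrow> \<alpha> (g \<otimes>\<^bsub>G\<^esub> h) = \<alpha> g \<otimes>\<^bsub>H\<^esub> \<alpha> h"
  using hom by (auto simp: hom_def)

lemma hom_one: "\<alpha> \<one>\<^bsub>G\<^esub> = \<one>\<^bsub>H\<^esub>"
  using hom R.is_group S.is_group by (rule hom_one)

context
  fixes f n k
  assumes f: "equivariant G R n S k \<alpha> f"
begin

lemma tensor_lift_closed:
  "w \<in> carrier (tensor_free R n) \<Longrightarrow> tensor_lift f w \<in> carrier (tensor_free S k)"
proof -
  assume w: "w \<in> carrier (tensor_free R n)"
  have "Poly_Mapping.keys (frag_of (f (fst p), snd p)) \<subseteq> chains S k \<times> UNIV" if "p \<in> Poly_Mapping.keys w" for p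
    using that w f by (auto simp: carrier_tensor_free equivariant_def)
  then show ?thesis
    using keys_frag_extend[of "\<lambda>(c, z). frag_of (f c, z)" w]
    unfolding carrier_tensor_free split_def by blast
qed

lemma tensor_lift_hom: "tensor_lift f \<in> hom (tensor_free R n) (tensor_free S k)"
  by (rule homI) (simp_all add: tensor_lift_closed frag_extend_add)

text \<open>Each of the three kinds of relators goes to relators of the same kind: additivity of
  \<open>f\<close> serves the first, and equivariance turns the relator of \<open>g\<close> into
  that of \<open>\<alpha> g\<close>.\<close>

lemma tensor_lift_relators: "tensor_lift f ` tensor_relators G R n \<subseteq> tensor_relators H S k"
proof -
  have cl: "f c \<in> chains S k" and eq: "g \<in> carrier G \<Longrightarrow> f (res_act R g c) = res_act S (\<alpha> g) (f c)"
    if "c \<in> chains R n" for c g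
    using that f by (auto simp: equivariant_def)
  have add: "f (c + d) = f c + f d" if "c \<in> chains R n" "d \<in> chains R n" for c d
    using that f by (auto simp: equivariant_def)
  show ?thesis
  proof
    fix w assume "w \<in> tensor_lift f ` tensor_relators G R n"
    then consider
        (1) c c' z where "c \<in> chains R n" "c' \<in> chains R n"
          "w = tensor_lift f (frag_of (c + c', z) - frag_of (c, z) - frag_of (c', z))"
      | (2) c z z' where "c \<in> chains R n"
          "w = tensor_lift f (frag_of (c, z + z') - frag_of (c, z) - frag_of (c, z'))"
      | (3) g c z where "g \<in> carrier G" "c \<in> chains R n"
          "w = tensor_lift f (frag_of (res_act R g c, z) - frag_of (c, z))"
      unfolding tensor_relators_def by blast
    then show "w \<in> tensor_relators H S k"
    proof cases
      case 1
      then have "w = frag_of (f c + f c', z) - frag_of (f c, z) - frag_of (f c', z)"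
        by (simp add: frag_extend_diff add)
      then show ?thesis using cl[OF 1(1)] cl[OF 1(2)] unfolding tensor_relators_def by blast
    next
      case 2
      then have "w = frag_of (f c, z + z') - frag_of (f c, z) - frag_of (f c, z')"
        by (simp add: frag_extend_diff)
      then show ?thesis using cl[OF 2(1)] unfolding tensor_relators_def by blast
    next
      case 3
      then have "w = frag_of (res_act S (\<alpha> g) (f c), z) - frag_of (f c, z)"
        by (simp add: frag_extend_diff eq)
      then show ?thesis using cl[OF 3(2)] hom_closed[OF 3(1)] unfolding tensor_relators_def by blast
    qed
  qed
qed

lemma tensor_lift_rel: "tensor_lift f ` tensor_rel G R n \<subseteq> tensor_rel H S k"
proof -
  interpret group_hom "tensor_free R n" "tensor_free S k" "tensor_lift f"
    using comm_group_tensor_free[of R n] comm_group_tensor_free[of S k]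
    by (simp add: group_hom_def group_hom_axioms_def tensor_lift_hom comm_group_def)
  have "tensor_lift f ` tensor_rel G R n = generate (tensor_free S k) (tensor_lift f ` tensor_relators G R n)"
    unfolding tensor_rel_def by (rule generate_img[symmetric, OF R.tensor_relators_closed])
  also have "\<dots> \<subseteq> tensor_rel H S k"
    unfolding tensor_rel_def by (rule H.mono_generate[OF tensor_lift_relators])
  finally show ?thesis .
qed

lemma tensor_Z_map_coset:
  "w \<in> carrier (tensor_free R n) \<Longrightarrow>
    tensor_Z_map H S k f (tensor_rel G R n #>\<^bsub>tensor_free R n\<^esub> w)
      = tensor_rel H S k #>\<^bsub>tensor_free S k\<^esub> tensor_lift f w"
  unfolding tensor_Z_map_def
  by (rule induced_quotient_map_coset[OF comm_group_tensor_free R.tensor_rel_subgroup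
        comm_group_tensor_free S.tensor_rel_subgroup tensor_lift_hom tensor_lift_rel])

lemma tensor_Z_map_hom: "tensor_Z_map H S k f \<in> hom (tensor_Z G R n) (tensor_Z H S k)"
  unfolding tensor_Z_map_def tensor_Z_def
  by (rule induced_quotient_map_hom[OF comm_group_tensor_free R.tensor_rel_subgroup
        comm_group_tensor_free S.tensor_rel_subgroup tensor_lift_hom tensor_lift_rel])

end

lemma tensor_Z_map_cong:
  assumes "equivariant G R n S k \<alpha> f" "equivariant G R n S k \<alpha> f'"
    and eq: "\<And>c. c \<in> chains R n \<Longrightarrow> f c = f' c" and u: "u \<in> carrier (tensor_Z G R n)"
  shows "tensor_Z_map H S k f u = tensor_Z_map H S k f' u"
proof -
  obtain w where w: "w \<in> carrier (tensor_free R n)" "u = tensor_rel G R n #>\<^bsub>tensor_free R n\<^esub> w"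
    using u by (auto simp: R.carrier_tensor_Z)
  have "tensor_lift f w = tensor_lift f' w"
    by (rule frag_extend_eq) (use w eq in \<open>auto simp: carrier_tensor_free\<close>)
  then show ?thesis using w by (simp add: tensor_Z_map_coset assms)
qed

text \<open>On the free group over pairs the lift of a sum is not the sum of the lifts. On each
  generator the two differ by a biadditivity relator, so equality holds only after passing to the
  quotient.\<close>

lemma tensor_Z_map_add:
  assumes f: "equivariant G R n S k \<alpha> f" and f': "equivariant G R n S k \<alpha> f'"
    and sum: "equivariant G R n S k \<alpha> (\<lambda>c. f c + f' c)"
    and u: "u \<in> carrier (tensor_Z G R n)"
  shows "tensor_Z_map H S k (\<lambda>c. f c + f' c) u
    = tensor_Z_map H S k f u \<otimes>\<^bsub>tensor_Z H S k\<^esub> tensor_Z_map H S k f' u"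
proof -
  obtain w where w: "w \<in> carrier (tensor_free R n)" "u = tensor_rel G R n #>\<^bsub>tensor_free R n\<^esub> w"
    using u by (auto simp: R.carrier_tensor_Z)
  let ?D = "\<lambda>w. tensor_lift (\<lambda>c. f c + f' c) w - (tensor_lift f w + tensor_lift f' w)"
  have "Poly_Mapping.keys w \<subseteq> chains R n \<times> UNIV" using w by (simp add: carrier_tensor_free)
  then have "?D w \<in> tensor_rel H S k"
  proof (induction w rule: free_Abelian_group_induct[consumes 1])
    case 1
    show ?case using subgroup.one_closed[OF S.tensor_rel_subgroup] by simp
  next
    case (2 v w)
    have "?D (v - w) = ?D v - ?D w" by (simp add: frag_extend_diff)
    then show ?case using S.tensor_rel_diff[OF 2(3,4)] by simp
  next
    case (3 a)
    then obtain c z where a: "a = (c, z)" "c \<in> chains R n" by auto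
    then have "f c \<in> chains S k" "f' c \<in> chains S k" using f f' by (auto simp: equivariant_def)
    then have "frag_of (f c + f' c, z) - frag_of (f c, z) - frag_of (f' c, z) \<in> tensor_relators H S k"
      unfolding tensor_relators_def by blast
    then show ?case unfolding tensor_rel_def a by (auto intro: generate.incl simp: diff_diff_add)
  qed
  moreover have "tensor_lift f w + tensor_lift f' w \<in> carrier (tensor_free S k)"
    using tensor_lift_closed[OF f w(1)] tensor_lift_closed[OF f' w(1)] by (rule tensor_free_add)
  ultimately have "tensor_rel H S k #>\<^bsub>tensor_free S k\<^esub> tensor_lift (\<lambda>c. f c + f' c) w
     = tensor_rel H S k #>\<^bsub>tensor_free S k\<^esub> (tensor_lift f w + tensor_lift f' w)"
    using S.tensor_Z_coset_eqI tensor_lift_closed[OF sum w(1)] by blast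
  then show ?thesis
    using w by (simp add: tensor_Z_map_coset f f' sum S.tensor_Z_mult_coset tensor_lift_closed[OF f] tensor_lift_closed[OF f'])
qed

text \<open>The lift of the zero map sends a generator \<open>(c, z)\<close> to the generator
  \<open>(0, z)\<close>, which is not zero in the free group. Its class is trivial because
  additivity, applied to 0 + 0 = 0, makes every value equal to its own square.\<close>

lemma tensor_Z_map_zero:
  assumes u: "u \<in> carrier (tensor_Z G R n)"
  shows "tensor_Z_map H S k (\<lambda>c. 0) u = \<one>\<^bsub>tensor_Z H S k\<^esub>"
proof -
  have z: "equivariant G R n S k \<alpha> (\<lambda>c. 0)" by (simp add: equivariant_def)
  interpret T: comm_group "tensor_Z H S k" by (rule S.comm_group_tensor_Z)
  let ?y = "tensor_Z_map H S k (\<lambda>c. 0) u"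
  have "?y \<otimes>\<^bsub>tensor_Z H S k\<^esub> ?y = ?y" using tensor_Z_map_add[OF z z _ u] z by simp
  moreover have "?y \<in> carrier (tensor_Z H S k)" using tensor_Z_map_hom[OF z] u by (auto simp: hom_def)
  ultimately show ?thesis using T.l_cancel_one by simp
qed

end

lemma tensor_Z_map_comp:
  assumes RS: "resolution_pair G R H S \<alpha>" and ST: "resolution_pair H S L T \<beta>"
    and f: "equivariant G R n S k \<alpha> f" and f': "equivariant H S k T l \<beta> f'"
    and u: "u \<in> carrier (tensor_Z G R n)"
  shows "tensor_Z_map L T l f' (tensor_Z_map H S k f u) = tensor_Z_map L T l (\<lambda>c. f' (f c)) u"
proof -
  interpret RS: resolution_pair G R H S \<alpha> by fact
  interpret ST: resolution_pair H S L T \<beta> by fact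
  interpret RT: resolution_pair G R L T "\<beta> \<circ> \<alpha>"
    by (intro resolution_pair.intro resolution_pair_axioms.intro RS.R.free_resolution_axioms
        ST.S.free_resolution_axioms hom_compose[OF RS.hom ST.hom])
  have c: "equivariant G R n T l (\<beta> \<circ> \<alpha>) (\<lambda>c. f' (f c))"
    using f f' by (auto simp: equivariant_def)
  obtain w where w: "w \<in> carrier (tensor_free R n)" "u = tensor_rel G R n #>\<^bsub>tensor_free R n\<^esub> w"
    using u by (auto simp: RS.R.carrier_tensor_Z)
  have "tensor_lift f' (tensor_lift f w) = tensor_lift (\<lambda>c. f' (f c)) w"
    by (induction w rule: frag_induction[OF subset_UNIV]) (auto simp: frag_extend_diff)
  then show ?thesis
    using w by (simp add: RS.tensor_Z_map_coset f ST.tensor_Z_map_coset f' RT.tensor_Z_map_coset c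
        RS.tensor_lift_closed[OF f])
qed

lemma (in free_resolution) tensor_Z_map_id:
  assumes "u \<in> carrier (tensor_Z G R n)"
  shows "tensor_Z_map G R n (\<lambda>c. c) u = u"
proof -
  interpret resolution_pair G R G R "\<lambda>x. x"
    by unfold_locales (simp add: hom_def)
  have "tensor_lift (\<lambda>c :: 'x \<Rightarrow>\<^sub>0 int. c) w = w" for w
    by (induction w rule: frag_induction[OF subset_UNIV]) (auto simp: frag_extend_diff)
  then show ?thesis using assms
    by (auto simp: carrier_tensor_Z tensor_Z_map_coset[of n n "\<lambda>c. c"] equivariant_def)
qed

section \<open>Functoriality of homology\<close>

definition equivariant_chain_map ::
  "('g, 'm) monoid_scheme \<Rightarrow> ('g, 'x) based_resolution \<Rightarrow> ('h, 'y) based_resolution \<Rightarrow>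
     ('g \<Rightarrow> 'h) \<Rightarrow> (('x \<Rightarrow>\<^sub>0 int) \<Rightarrow> ('y \<Rightarrow>\<^sub>0 int)) \<Rightarrow> bool" where
  "equivariant_chain_map G R S \<alpha> f \<longleftrightarrow>
     (\<forall>n. equivariant G R n S n \<alpha> f) \<and> (\<forall>n. \<forall>c\<in>chains R n. res_bdry S (f c) = f (res_bdry R c))"

text \<open>The identity is written as a sum instead of a difference, so that
  \<open>tensor_Z_map_add\<close> applies to it as it stands.\<close>

definition equivariant_homotopy ::
  "('g, 'm) monoid_scheme \<Rightarrow> ('g, 'x) based_resolution \<Rightarrow> ('h, 'y) based_resolution \<Rightarrow>
     ('g \<Rightarrow> 'h) \<Rightarrow> (('x \<Rightarrow>\<^sub>0 int) \<Rightarrow> ('y \<Rightarrow>\<^sub>0 int)) \<Rightarrow> (('x \<Rightarrow>\<^sub>0 int) \<Rightarrow> ('y \<Rightarrow>\<^sub>0 int)) \<Rightarrow>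
     (('x \<Rightarrow>\<^sub>0 int) \<Rightarrow> ('y \<Rightarrow>\<^sub>0 int)) \<Rightarrow> bool" where
  "equivariant_homotopy G R S \<alpha> h f f' \<longleftrightarrow>
     (\<forall>n. equivariant G R n S (Suc n) \<alpha> h)
   \<and> (\<forall>n. \<forall>c\<in>chains R n. f c = res_bdry S (h c) + h (res_bdry R c) + f' c)"

lemma equivariant_chain_mapD:
  assumes "equivariant_chain_map G R S \<alpha> f"
  shows "equivariant G R n S n \<alpha> f" "c \<in> chains R n \<Longrightarrow> res_bdry S (f c) = f (res_bdry R c)"
  using assms by (auto simp: equivariant_chain_map_def)

lemma equivariant_homotopyD:
  assumes "equivariant_homotopy G R S \<alpha> h f f'"
  shows "equivariant G R n S (Suc n) \<alpha> h"
    "c \<in> chains R n \<Longrightarrow> f c = res_bdry S (h c) + h (res_bdry R c) + f' c"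
  using assms by (auto simp: equivariant_homotopy_def)

lemma equivariant_closed: "equivariant G R n S m \<alpha> f \<Longrightarrow> c \<in> chains R n \<Longrightarrow> f c \<in> chains S m"
  by (simp add: equivariant_def)

context free_resolution
begin

lemma resolution_pair_id: "resolution_pair G R G R (\<lambda>x. x)"
  by unfold_locales (simp add: hom_def)

lemma bdry_equivariant: "equivariant G R (Suc n) R n (\<lambda>x. x) (res_bdry R)"
  by (auto simp: equivariant_def bdry_closed bdry_add bdry_act)

lemma tensor_bdry_hom: "tensor_Z_map G R n (res_bdry R) \<in> hom (tensor_Z G R (Suc n)) (tensor_Z G R n)"
  by (rule resolution_pair.tensor_Z_map_hom[OF resolution_pair_id bdry_equivariant])

lemma cycles_subset: "carrier (cycle_group G R n) \<subseteq> carrier (tensor_Z G R n)"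
  by (auto simp: cycle_group_def kernel_def)

lemma mem_cycles_Suc:
  "u \<in> carrier (cycle_group G R (Suc n)) \<longleftrightarrow> u \<in> carrier (tensor_Z G R (Suc n))
    \<and> tensor_Z_map G R n (res_bdry R) u = \<one>\<^bsub>tensor_Z G R n\<^esub>"
  by (simp add: cycle_group_def kernel_def)

lemma cycle_group_simps [simp]:
  "u \<otimes>\<^bsub>cycle_group G R n\<^esub> v = u \<otimes>\<^bsub>tensor_Z G R n\<^esub> v"
  "\<one>\<^bsub>cycle_group G R n\<^esub> = \<one>\<^bsub>tensor_Z G R n\<^esub>"
  by (simp_all add: cycle_group_def)

lemma cycles_subgroup: "subgroup (carrier (cycle_group G R n)) (tensor_Z G R n)"
proof (cases n)
  case 0
  interpret T: comm_group "tensor_Z G R 0" by (rule comm_group_tensor_Z)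
  show ?thesis using T.subgroup_self 0 by (simp add: cycle_group_def)
next
  case (Suc m)
  interpret T: comm_group "tensor_Z G R n" by (rule comm_group_tensor_Z)
  interpret T': comm_group "tensor_Z G R m" by (rule comm_group_tensor_Z)
  interpret group_hom "tensor_Z G R n" "tensor_Z G R m" "tensor_Z_map G R m (res_bdry R)"
    by unfold_locales (use tensor_bdry_hom Suc in simp)
  show ?thesis using subgroup_kernel Suc by (simp add: cycle_group_def)
qed

lemma cycle_group_eq: "cycle_group G R n = (tensor_Z G R n)\<lparr>carrier := carrier (cycle_group G R n)\<rparr>"
  by (simp add: cycle_group_def)

lemma comm_group_cycle_group: "comm_group (cycle_group G R n)"
proof -
  interpret T: comm_group "tensor_Z G R n" by (rule comm_group_tensor_Z)
  have "group (cycle_group G R n)"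
    by (subst cycle_group_eq) (rule T.subgroup_imp_group[OF cycles_subgroup])
  then show ?thesis
    by (rule group.group_comm_groupI) (simp add: T.m_comm subsetD[OF cycles_subset])
qed

lemma boundaries_subset_cycles: "boundaries G R n \<subseteq> carrier (cycle_group G R n)"
proof
  fix v assume "v \<in> boundaries G R n"
  then obtain u where u: "u \<in> carrier (tensor_Z G R (Suc n))" "v = tensor_Z_map G R n (res_bdry R) u"
    by (auto simp: boundaries_def)
  have v: "v \<in> carrier (tensor_Z G R n)" using u tensor_bdry_hom by (auto simp: hom_def)
  show "v \<in> carrier (cycle_group G R n)"
  proof (cases n)
    case 0
    then show ?thesis using v by (simp add: cycle_group_def)
  next
    case (Suc m)
    interpret P: resolution_pair G R G R "\<lambda>x. x" by (rule resolution_pair_id)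
    have z: "equivariant G R (Suc n) R m (\<lambda>x. x) (\<lambda>c. 0)" by (simp add: equivariant_def)
    have bb: "equivariant G R (Suc n) R m (\<lambda>x. x) (\<lambda>c. res_bdry R (res_bdry R c))"
      using bdry_equivariant[of n] bdry_equivariant[of m] Suc by (auto simp: equivariant_def)
    have "tensor_Z_map G R m (res_bdry R) v = tensor_Z_map G R m (\<lambda>c. res_bdry R (res_bdry R c)) u"
      unfolding u(2)
      by (rule tensor_Z_map_comp[OF resolution_pair_id resolution_pair_id bdry_equivariant _ u(1)])
        (use Suc bdry_equivariant in simp)
    also have "\<dots> = tensor_Z_map G R m (\<lambda>c. 0) u"
      by (rule P.tensor_Z_map_cong[OF bb z _ u(1)]) (rule bdry_bdry)
    also have "\<dots> = \<one>\<^bsub>tensor_Z G R m\<^esub>" by (rule P.tensor_Z_map_zero[OF u(1)])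
    finally show ?thesis using v Suc by (simp add: mem_cycles_Suc)
  qed
qed

lemma boundaries_subgroup: "subgroup (boundaries G R n) (cycle_group G R n)"
proof -
  interpret T: comm_group "tensor_Z G R n" by (rule comm_group_tensor_Z)
  interpret T': comm_group "tensor_Z G R (Suc n)" by (rule comm_group_tensor_Z)
  interpret group_hom "tensor_Z G R (Suc n)" "tensor_Z G R n" "tensor_Z_map G R n (res_bdry R)"
    by unfold_locales (rule tensor_bdry_hom)
  have "subgroup (boundaries G R n) (tensor_Z G R n)"
    using img_is_subgroup by (simp add: boundaries_def)
  then show ?thesis
    by (subst cycle_group_eq) (rule T.subgroup_incl[OF _ cycles_subgroup boundaries_subset_cycles])
qed

lemma carrier_homology:
  "carrier (homology G R n) = (\<lambda>u. boundaries G R n #>\<^bsub>cycle_group G R n\<^esub> u) ` carrier (cycle_group G R n)"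
  by (simp add: homology_def carrier_FactGroup)

end

section \<open>Maps induced on homology\<close>

context resolution_pair
begin

context
  fixes f
  assumes f: "equivariant_chain_map G R S \<alpha> f"
begin

lemma tensor_Z_map_bdry:
  assumes u: "u \<in> carrier (tensor_Z G R (Suc n))"
  shows "tensor_Z_map H S n (res_bdry S) (tensor_Z_map H S (Suc n) f u)
    = tensor_Z_map H S n f (tensor_Z_map G R n (res_bdry R) u)"
proof -
  have eq: "equivariant G R k S k \<alpha> f" for k by (rule equivariant_chain_mapD[OF f])
  have c1: "equivariant G R (Suc n) S n \<alpha> (\<lambda>c. res_bdry S (f c))"
    using eq[of "Suc n"] S.bdry_equivariant[of n] by (auto simp: equivariant_def)
  have c2: "equivariant G R (Suc n) S n \<alpha> (\<lambda>c. f (res_bdry R c))"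
    using eq[of n] R.bdry_equivariant[of n] by (auto simp: equivariant_def)
  have "tensor_Z_map H S n (res_bdry S) (tensor_Z_map H S (Suc n) f u) = tensor_Z_map H S n (\<lambda>c. res_bdry S (f c)) u"
    by (rule tensor_Z_map_comp[OF resolution_pair_axioms S.resolution_pair_id eq S.bdry_equivariant u])
  also have "\<dots> = tensor_Z_map H S n (\<lambda>c. f (res_bdry R c)) u"
    by (rule tensor_Z_map_cong[OF c1 c2 _ u]) (rule equivariant_chain_mapD[OF f])
  also have "\<dots> = tensor_Z_map H S n f (tensor_Z_map G R n (res_bdry R) u)"
    by (rule tensor_Z_map_comp[OF R.resolution_pair_id resolution_pair_axioms R.bdry_equivariant eq u, symmetric])
  finally show ?thesis .
qed

lemma tensor_Z_map_cycle:
  assumes u: "u \<in> carrier (cycle_group G R n)"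
  shows "tensor_Z_map H S n f u \<in> carrier (cycle_group H S n)"
proof -
  have eq: "tensor_Z_map H S k f \<in> hom (tensor_Z G R k) (tensor_Z H S k)" for k
    by (rule tensor_Z_map_hom[OF equivariant_chain_mapD(1)[OF f]])
  have u': "u \<in> carrier (tensor_Z G R n)" using u R.cycles_subset by blast
  then have fu: "tensor_Z_map H S n f u \<in> carrier (tensor_Z H S n)" using eq by (auto simp: hom_def)
  show ?thesis
  proof (cases n)
    case 0
    then show ?thesis using fu by (simp add: cycle_group_def)
  next
    case (Suc m)
    interpret T: comm_group "tensor_Z H S m" by (rule S.comm_group_tensor_Z)
    interpret T': comm_group "tensor_Z G R m" by (rule R.comm_group_tensor_Z)
    have "tensor_Z_map H S m f \<one>\<^bsub>tensor_Z G R m\<^esub> = \<one>\<^bsub>tensor_Z H S m\<^esub>"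
      using Group.hom_one[OF eq T'.is_group T.is_group] .
    then show ?thesis
      using fu u u' tensor_Z_map_bdry Suc by (simp add: R.mem_cycles_Suc S.mem_cycles_Suc)
  qed
qed

lemma tensor_Z_map_cycle_hom: "tensor_Z_map H S n f \<in> hom (cycle_group G R n) (cycle_group H S n)"
proof -
  have "tensor_Z_map H S n f \<in> hom (tensor_Z G R n) (tensor_Z H S n)"
    by (rule tensor_Z_map_hom[OF equivariant_chain_mapD(1)[OF f]])
  then show ?thesis
    using R.cycles_subset by (auto simp: hom_def tensor_Z_map_cycle subset_iff)
qed

lemma tensor_Z_map_boundaries: "tensor_Z_map H S n f ` boundaries G R n \<subseteq> boundaries H S n"
proof -
  have "tensor_Z_map H S (Suc n) f \<in> hom (tensor_Z G R (Suc n)) (tensor_Z H S (Suc n))"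
    by (rule tensor_Z_map_hom[OF equivariant_chain_mapD(1)[OF f]])
  then have "tensor_Z_map H S (Suc n) f u \<in> carrier (tensor_Z H S (Suc n))"
    if "u \<in> carrier (tensor_Z G R (Suc n))" for u using that by (auto simp: hom_def)
  then show ?thesis by (auto simp: boundaries_def tensor_Z_map_bdry[symmetric])
qed

lemma homology_map_coset:
  "u \<in> carrier (cycle_group G R n) \<Longrightarrow>
    homology_map H S n f (boundaries G R n #>\<^bsub>cycle_group G R n\<^esub> u)
      = boundaries H S n #>\<^bsub>cycle_group H S n\<^esub> tensor_Z_map H S n f u"
  unfolding homology_map_def
  by (rule induced_quotient_map_coset[OF R.comm_group_cycle_group R.boundaries_subgroup
        S.comm_group_cycle_group S.boundaries_subgroup tensor_Z_map_cycle_hom tensor_Z_map_boundaries])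

lemma homology_map_hom: "homology_map H S n f \<in> hom (homology G R n) (homology H S n)"
  unfolding homology_map_def homology_def
  by (rule induced_quotient_map_hom[OF R.comm_group_cycle_group R.boundaries_subgroup
        S.comm_group_cycle_group S.boundaries_subgroup tensor_Z_map_cycle_hom tensor_Z_map_boundaries])

end

text \<open>On a cycle the summand \<open>h\<close> after the boundary vanishes, and the summand
  boundary after \<open>h\<close> is a boundary; the two images therefore lie in the same
  coset.\<close>

lemma homology_map_homotopic:
  assumes f: "equivariant_chain_map G R S \<alpha> f" and f': "equivariant_chain_map G R S \<alpha> f'"
    and h: "equivariant_homotopy G R S \<alpha> h f f'" and x: "x \<in> carrier (homology G R n)"
  shows "homology_map H S n f x = homology_map H S n f' x"
proof -
  obtain u where u: "u \<in> carrier (cycle_group G R n)" "x = boundaries G R n #>\<^bsub>cycle_group G R n\<^esub> u"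
    using x by (auto simp: R.carrier_homology)
  have u': "u \<in> carrier (tensor_Z G R n)" using u R.cycles_subset by blast
  interpret T: comm_group "tensor_Z H S n" by (rule S.comm_group_tensor_Z)
  interpret Z: comm_group "cycle_group H S n" by (rule S.comm_group_cycle_group)
  have eqf: "equivariant G R k S k \<alpha> f" "equivariant G R k S k \<alpha> f'" for k
    using f f' by (auto simp: equivariant_chain_map_def)
  have eqh: "equivariant G R k S (Suc k) \<alpha> h" for k by (rule equivariant_homotopyD[OF h])
  \<comment> \<open>In degree zero there is no lower tensor group to factor through. There the
    second summand of the homotopy vanishes because the boundary does and
    \<open>h 0 = 0\<close>.\<close>
  have "h (0 + 0) = h 0 + h 0"
    using eqh[of 0] R.chains_zero unfolding equivariant_def by blast
  then have h0: "h 0 = 0" by simp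
  let ?bh = "\<lambda>c. res_bdry S (h c)" and ?hb = "\<lambda>c. h (res_bdry R c)"
  have bh: "equivariant G R n S n \<alpha> ?bh"
    using eqh[of n] S.bdry_equivariant[of n] by (auto simp: equivariant_def)
  have hb: "equivariant G R n S n \<alpha> ?hb"
  proof (cases n)
    case 0
    then show ?thesis by (simp add: equivariant_def R.bdry_0 h0 R.chains_add R.act_closed)
  next
    case (Suc m)
    then show ?thesis using eqh[of m] R.bdry_equivariant[of m] by (auto simp: equivariant_def)
  qed
  have sum1: "equivariant G R n S n \<alpha> (\<lambda>c. ?bh c + ?hb c)"
    using bh hb by (auto simp: equivariant_def S.chains_add S.act_add)
  have sum2: "equivariant G R n S n \<alpha> (\<lambda>c. (?bh c + ?hb c) + f' c)"
    using sum1 eqf(2)[of n] by (auto simp: equivariant_def S.chains_add S.act_add)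
  have hb1: "tensor_Z_map H S n ?hb u = \<one>\<^bsub>tensor_Z H S n\<^esub>"
  proof (cases n)
    case 0
    have "tensor_Z_map H S n ?hb u = tensor_Z_map H S n (\<lambda>c. 0) u"
      by (rule tensor_Z_map_cong[OF hb _ _ u']) (use 0 in \<open>auto simp: equivariant_def R.bdry_0 h0\<close>)
    then show ?thesis using tensor_Z_map_zero[OF u'] by simp
  next
    case (Suc m)
    interpret T': comm_group "tensor_Z G R m" by (rule R.comm_group_tensor_Z)
    have "tensor_Z_map H S n ?hb u = tensor_Z_map H S n h (tensor_Z_map G R m (res_bdry R) u)"
      using tensor_Z_map_comp[OF R.resolution_pair_id resolution_pair_axioms R.bdry_equivariant eqh] u' Suc
      by simp
    also have "\<dots> = tensor_Z_map H S n h \<one>\<^bsub>tensor_Z G R m\<^esub>" using u(1) Suc by (simp add: R.mem_cycles_Suc)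
    also have "\<dots> = \<one>\<^bsub>tensor_Z H S n\<^esub>"
      using Group.hom_one[OF tensor_Z_map_hom[OF eqh] T'.is_group] T.is_group Suc by simp
    finally show ?thesis .
  qed
  have bh1: "tensor_Z_map H S n ?bh u \<in> boundaries H S n"
  proof -
    have "tensor_Z_map H S n ?bh u = tensor_Z_map H S n (res_bdry S) (tensor_Z_map H S (Suc n) h u)"
      by (rule tensor_Z_map_comp[OF resolution_pair_axioms S.resolution_pair_id eqh S.bdry_equivariant u', symmetric])
    moreover have "tensor_Z_map H S (Suc n) h u \<in> carrier (tensor_Z H S (Suc n))"
      using tensor_Z_map_hom[OF eqh] u' by (auto simp: hom_def)
    ultimately show ?thesis by (auto simp: boundaries_def)
  qed
  have carr: "tensor_Z_map H S n g u \<in> carrier (tensor_Z H S n)" if "equivariant G R n S n \<alpha> g" for g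
    using tensor_Z_map_hom[OF that] u' by (auto simp: hom_def)
  have "tensor_Z_map H S n f u = tensor_Z_map H S n (\<lambda>c. (?bh c + ?hb c) + f' c) u"
    by (rule tensor_Z_map_cong[OF eqf(1) sum2 _ u']) (use equivariant_homotopyD(2)[OF h] in simp)
  also have "\<dots> = (tensor_Z_map H S n ?bh u \<otimes>\<^bsub>tensor_Z H S n\<^esub> tensor_Z_map H S n ?hb u)
      \<otimes>\<^bsub>tensor_Z H S n\<^esub> tensor_Z_map H S n f' u"
    by (simp only: tensor_Z_map_add[OF sum1 eqf(2) sum2 u'] tensor_Z_map_add[OF bh hb sum1 u'])
  also have "\<dots> = tensor_Z_map H S n ?bh u \<otimes>\<^bsub>tensor_Z H S n\<^esub> tensor_Z_map H S n f' u"
    using carr[OF bh] by (simp add: hb1)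
  finally have "tensor_Z_map H S n f u \<in> boundaries H S n #>\<^bsub>cycle_group H S n\<^esub> tensor_Z_map H S n f' u"
    using bh1 by (auto simp: r_coset_def)
  then have "boundaries H S n #>\<^bsub>cycle_group H S n\<^esub> tensor_Z_map H S n f u
      = boundaries H S n #>\<^bsub>cycle_group H S n\<^esub> tensor_Z_map H S n f' u"
    using Z.repr_independence[OF _ tensor_Z_map_cycle[OF f' u(1)] S.boundaries_subgroup] by simp
  then show ?thesis using u homology_map_coset[OF f] homology_map_coset[OF f'] by simp
qed

end

lemma equivariant_chain_map_comp:
  assumes RS: "resolution_pair G R H S \<alpha>"
    and f: "equivariant_chain_map G R S \<alpha> f" and f': "equivariant_chain_map H S T \<beta> f'"
  shows "equivariant_chain_map G R T (\<beta> \<circ> \<alpha>) (\<lambda>c. f' (f c))"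
proof -
  interpret RS: resolution_pair G R H S \<alpha> by fact
  have eq: "equivariant G R k S k \<alpha> f" "equivariant H S k T k \<beta> f'" for k
    using f f' by (auto simp: equivariant_chain_map_def)
  have "equivariant G R k T k (\<beta> \<circ> \<alpha>) (\<lambda>c. f' (f c))" for k
    using eq[of k] by (simp add: equivariant_def)
  moreover have "res_bdry T (f' (f c)) = f' (f (res_bdry R c))" if "c \<in> chains R k" for c k
    using that equivariant_chain_mapD(2)[OF f that] equivariant_chain_mapD(2)[OF f']
      equivariant_closed[OF eq(1) that] by metis
  ultimately show ?thesis by (simp add: equivariant_chain_map_def)
qed

lemma homology_map_comp:
  assumes RS: "resolution_pair G R H S \<alpha>" and ST: "resolution_pair H S L T \<beta>"
    and f: "equivariant_chain_map G R S \<alpha> f" and f': "equivariant_chain_map H S T \<beta> f'"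
    and x: "x \<in> carrier (homology G R n)"
  shows "homology_map L T n f' (homology_map H S n f x) = homology_map L T n (\<lambda>c. f' (f c)) x"
proof -
  interpret RS: resolution_pair G R H S \<alpha> by fact
  interpret ST: resolution_pair H S L T \<beta> by fact
  interpret RT: resolution_pair G R L T "\<beta> \<circ> \<alpha>"
    by (intro resolution_pair.intro resolution_pair_axioms.intro RS.R.free_resolution_axioms
        ST.S.free_resolution_axioms hom_compose[OF RS.hom ST.hom])
  obtain u where u: "u \<in> carrier (cycle_group G R n)" "x = boundaries G R n #>\<^bsub>cycle_group G R n\<^esub> u"
    using x by (auto simp: RS.R.carrier_homology)
  have u': "u \<in> carrier (tensor_Z G R n)" using u RS.R.cycles_subset by blast
  have eq: "equivariant G R k S k \<alpha> f" "equivariant H S k T k \<beta> f'" for k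
    using f f' by (auto simp: equivariant_chain_map_def)
  note c = equivariant_chain_map_comp[OF RS f f']
  show ?thesis
    using u RS.homology_map_coset[OF f] ST.homology_map_coset[OF f'] RT.homology_map_coset[OF c]
      RS.tensor_Z_map_cycle[OF f] tensor_Z_map_comp[OF RS ST eq u'] by simp
qed

lemma (in free_resolution) homology_map_id:
  assumes x: "x \<in> carrier (homology G R n)"
  shows "homology_map G R n (\<lambda>c. c) x = x"
proof -
  interpret resolution_pair G R G R "\<lambda>x. x" by (rule resolution_pair_id)
  have "equivariant_chain_map G R R (\<lambda>x. x) (\<lambda>c. c)"
    by (auto simp: equivariant_chain_map_def equivariant_def)
  note coset = homology_map_coset[OF this]
  obtain u where u: "u \<in> carrier (cycle_group G R n)" "x = boundaries G R n #>\<^bsub>cycle_group G R n\<^esub> u"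
    using x by (auto simp: carrier_homology)
  moreover have "u \<in> carrier (tensor_Z G R n)" using u cycles_subset by blast
  ultimately show ?thesis using coset by (simp add: tensor_Z_map_id)
qed

section \<open>The comparison theorem\<close>

text \<open>In degree zero these are the cycles of the augmented complex, not of
  \<open>cycle_group\<close>; this gives exactness the same form in every degree.\<close>

definition is_cycle :: "('g, 'x) based_resolution \<Rightarrow> nat \<Rightarrow> ('x \<Rightarrow>\<^sub>0 int) \<Rightarrow> bool" where
  "is_cycle R n c \<longleftrightarrow> c \<in> chains R n \<and> (if n = 0 then res_aug R c = 0 else res_bdry R c = 0)"

context free_resolution
begin

lemma is_cycle_bdry: "c \<in> chains R (Suc n) \<Longrightarrow> is_cycle R n (res_bdry R c)"
  by (auto simp: is_cycle_def bdry_closed bdry_bdry aug_bdry)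

lemma is_cycle_exact: "is_cycle R n c \<Longrightarrow> \<exists>d\<in>chains R (Suc n). res_bdry R d = c"
  by (cases n) (auto simp: is_cycle_def exact_0 exact_Suc)

text \<open>The element \<open>inv h \<otimes> g\<close> fixes \<open>x\<close>, hence is trivial by
  freeness.\<close>

lemma act_cancel:
  assumes "g \<in> carrier G" "h \<in> carrier G" "x \<in> res_basis R n"
    "res_act R g (frag_of x) = res_act R h (frag_of x)"
  shows "g = h"
proof -
  have "res_act R (inv h \<otimes> g) (frag_of x) = res_act R (inv h) (res_act R h (frag_of x))"
    using assms by (simp add: act_mult_basis)
  also have "\<dots> = res_act R (inv h \<otimes> h) (frag_of x)"
    using assms by (intro act_mult_basis[symmetric]) auto
  also have "\<dots> = frag_of x"
    using assms by (simp add: act_one_basis)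
  finally have "inv h \<otimes> g = \<one>"
    using assms by (intro act_free[of _ x n]) auto
  then show ?thesis using assms by (metis inv_closed inv_equality inv_inv)
qed

end

section \<open>Equivariant maps prescribed on orbit representatives\<close>

context resolution_pair
begin

lemma equivariant_diff:
  assumes f: "equivariant G R n S m \<alpha> f" and "c \<in> chains R n" "d \<in> chains R n"
  shows "f (c - d) = f c - f d"
proof -
  have "f (c - d + d) = f (c - d) + f d"
    using f R.chains_diff[of c n d] assms(2,3) unfolding equivariant_def by blast
  then show ?thesis by simp
qed

lemma equivariant_zero: "equivariant G R n S m \<alpha> f \<Longrightarrow> f 0 = 0"
  using equivariant_diff[of n m f 0 0] by simp

lemma equivariant_eqI:
  assumes "equivariant G R n S m \<alpha> f" "equivariant G R n S m \<alpha> f'"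
    and "\<And>x. x \<in> res_basis R n \<Longrightarrow> f (frag_of x) = f' (frag_of x)" and "c \<in> chains R n"
  shows "f c = f' c"
  using assms(4)
  by (induction c rule: chains_induct)
    (simp_all add: assms(3) equivariant_zero[OF assms(1)] equivariant_zero[OF assms(2)]
      equivariant_diff[OF assms(1)] equivariant_diff[OF assms(2)])

text \<open>Since the action on the basis is free, values can be prescribed on one representative of each
  orbit and extended equivariantly.\<close>

lemma equivariant_choice:
  assumes P_act: "\<And>g x y w. g \<in> carrier G \<Longrightarrow> x \<in> res_basis R n \<Longrightarrow> y \<in> res_basis R n \<Longrightarrow>
      res_act R g (frag_of x) = frag_of y \<Longrightarrow> w \<in> chains S m \<Longrightarrow> P x w \<Longrightarrow> P y (res_act S (\<alpha> g) w)"
    and ex: "\<And>x. x \<in> res_basis R n \<Longrightarrow> \<exists>w\<in>chains S m. P x w"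
  shows "\<exists>f. equivariant G R n S m \<alpha> f \<and> (\<forall>x\<in>res_basis R n. P x (f (frag_of x)))"
proof -
  \<comment> \<open>The predicate \<open>orb x\<close> describes the orbit of \<open>x\<close>.
    Because \<open>rep x\<close> depends on \<open>x\<close> only through it, elements of one orbit
    get the same representative, and \<open>\<gamma> x\<close> is the group element that carries the
    representative to \<open>x\<close>.\<close>
  define orb where "orb x y \<longleftrightarrow> y \<in> res_basis R n \<and> (\<exists>g\<in>carrier G. res_act R g (frag_of y) = frag_of x)" for x y
  define rep where "rep x = (SOME y. orb x y)" for x
  define \<gamma> where "\<gamma> x = (SOME g. g \<in> carrier G \<and> res_act R g (frag_of (rep x)) = frag_of x)" for x
  define W where "W x = (SOME w. w \<in> chains S m \<and> P x w)" for x
  define F where "F x = res_act S (\<alpha> (\<gamma> x)) (W (rep x))" for x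
  have rep: "orb x (rep x)" if "x \<in> res_basis R n" for x
  proof -
    have "orb x x" using that R.act_one_basis R.one_closed unfolding orb_def by blast
    then show ?thesis unfolding rep_def by (rule someI)
  qed
  have \<gamma>: "\<gamma> x \<in> carrier G" "res_act R (\<gamma> x) (frag_of (rep x)) = frag_of x" if "x \<in> res_basis R n" for x
  proof -
    have "\<exists>g. g \<in> carrier G \<and> res_act R g (frag_of (rep x)) = frag_of x"
      using rep[OF that] by (auto simp: orb_def)
    then have "\<gamma> x \<in> carrier G \<and> res_act R (\<gamma> x) (frag_of (rep x)) = frag_of x"
      unfolding \<gamma>_def by (rule someI_ex)
    then show "\<gamma> x \<in> carrier G" "res_act R (\<gamma> x) (frag_of (rep x)) = frag_of x" by auto
  qed
  have W: "W x \<in> chains S m" "P x (W x)" if "x \<in> res_basis R n" for x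
  proof -
    have "\<exists>w. w \<in> chains S m \<and> P x w" using ex[OF that] by blast
    then have "W x \<in> chains S m \<and> P x (W x)" unfolding W_def by (rule someI_ex)
    then show "W x \<in> chains S m" "P x (W x)" by auto
  qed
  have F: "F x \<in> chains S m" "P x (F x)" if "x \<in> res_basis R n" for x
  proof -
    have r: "rep x \<in> res_basis R n" using rep[OF that] by (simp add: orb_def)
    show "F x \<in> chains S m" unfolding F_def using W(1)[OF r] \<gamma>(1)[OF that] by (simp add: S.act_closed)
    show "P x (F x)" unfolding F_def by (rule P_act[OF \<gamma>(1)[OF that] r that \<gamma>(2)[OF that] W[OF r]])
  qed
  have F_act: "F y = res_act S (\<alpha> g) (F x)"
    if g: "g \<in> carrier G" and x: "x \<in> res_basis R n" and y: "y \<in> res_basis R n"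
      and eq: "res_act R g (frag_of x) = frag_of y" for g x y
  proof -
    have inv_act: "res_act R (inv\<^bsub>G\<^esub> g) (frag_of y) = frag_of x"
      using g x R.act_mult_basis[of "inv\<^bsub>G\<^esub> g" g x n] by (simp add: eq[symmetric] R.act_one_basis)
    have orb_eq: "orb x = orb y"
    proof (intro ext iffI)
      fix z assume "orb x z"
      then obtain k where k: "z \<in> res_basis R n" "k \<in> carrier G" "res_act R k (frag_of z) = frag_of x"
        by (auto simp: orb_def)
      then have "res_act R (g \<otimes>\<^bsub>G\<^esub> k) (frag_of z) = frag_of y"
        using g eq by (simp add: R.act_mult_basis)
      then show "orb y z" using k g unfolding orb_def by blast
    next
      fix z assume "orb y z"
      then obtain k where k: "z \<in> res_basis R n" "k \<in> carrier G" "res_act R k (frag_of z) = frag_of y"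
        by (auto simp: orb_def)
      then have "res_act R (inv\<^bsub>G\<^esub> g \<otimes>\<^bsub>G\<^esub> k) (frag_of z) = frag_of x"
        using g inv_act by (simp add: R.act_mult_basis)
      then show "orb x z" using k g unfolding orb_def by blast
    qed
    then have rr: "rep y = rep x" by (simp add: rep_def)
    have r: "rep x \<in> res_basis R n" using rep[OF x] by (simp add: orb_def)
    \<comment> \<open>Both group elements carry the common representative to \<open>y\<close>, so
      freeness identifies them. This is what makes the extension \<open>F\<close>
      equivariant.\<close>
    have "res_act R (\<gamma> y) (frag_of (rep x)) = res_act R (g \<otimes>\<^bsub>G\<^esub> \<gamma> x) (frag_of (rep x))"
      using \<gamma>(2)[OF y] \<gamma>[OF x] g r by (simp add: rr R.act_mult_basis eq)
    then have "\<gamma> y = g \<otimes>\<^bsub>G\<^esub> \<gamma> x"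
      using R.act_cancel[OF \<gamma>(1)[OF y] _ r] g \<gamma>(1)[OF x] by simp
    then show ?thesis
      using g \<gamma>(1)[OF x] W(1)[OF r] by (simp add: F_def rr hom_mult S.act_mult[of _ m])
  qed
  let ?f = "frag_extend F"
  have closed: "?f c \<in> chains S m" if "c \<in> chains R n" for c
    using that by (induction c rule: chains_induct) (auto simp: frag_extend_diff S.chains_diff F)
  have "?f (res_act R g c) = res_act S (\<alpha> g) (?f c)" if "c \<in> chains R n" "g \<in> carrier G" for g c
    using that
  proof (induction c rule: chains_induct)
    case (one x)
    then obtain y where y: "y \<in> res_basis R n" "res_act R g (frag_of x) = frag_of y"
      using R.act_basis by blast
    then show ?case using F_act[OF one(2,1) y] by simp
  qed (auto simp: frag_extend_diff R.act_diff S.act_diff)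
  then have "equivariant G R n S m \<alpha> ?f" by (simp add: equivariant_def closed frag_extend_add)
  then show ?thesis using F by (intro exI[of _ ?f]) simp
qed

text \<open>The condition that \<open>w\<close> bounds the prescribed cycle is carried along orbits,
  since \<open>z\<close> and the boundary are equivariant. So it is enough to fill cycles by
  exactness and let \<open>equivariant_choice\<close> make the fillings compatible.\<close>

lemma equivariant_lift:
  assumes z: "equivariant G R n S m \<alpha> z"
    and cyc: "\<And>x. x \<in> res_basis R n \<Longrightarrow> is_cycle S m (z (frag_of x))"
  shows "\<exists>f. equivariant G R n S (Suc m) \<alpha> f \<and> (\<forall>c\<in>chains R n. res_bdry S (f c) = z c)"
proof -
  have "\<exists>f. equivariant G R n S (Suc m) \<alpha> f \<and> (\<forall>x\<in>res_basis R n. res_bdry S (f (frag_of x)) = z (frag_of x))"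
  proof (rule equivariant_choice)
    fix g x y w assume *: "g \<in> carrier G" "x \<in> res_basis R n" "y \<in> res_basis R n"
      "res_act R g (frag_of x) = frag_of y" "w \<in> chains S (Suc m)" "res_bdry S w = z (frag_of x)"
    have "z (frag_of y) = res_act S (\<alpha> g) (z (frag_of x))"
      using z *(1,2) unfolding equivariant_def *(4)[symmetric] by simp
    then show "res_bdry S (res_act S (\<alpha> g) w) = z (frag_of y)"
      using * by (simp add: S.bdry_act)
  next
    fix x assume "x \<in> res_basis R n"
    then show "\<exists>w\<in>chains S (Suc m). res_bdry S w = z (frag_of x)"
      by (rule S.is_cycle_exact[OF cyc])
  qed
  then obtain f where f: "equivariant G R n S (Suc m) \<alpha> f"
    "\<And>x. x \<in> res_basis R n \<Longrightarrow> res_bdry S (f (frag_of x)) = z (frag_of x)" by blast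
  have "equivariant G R n S m \<alpha> (\<lambda>c. res_bdry S (f c))"
    using f(1) S.bdry_equivariant[of m] by (auto simp: equivariant_def)
  then have "res_bdry S (f c) = z c" if "c \<in> chains R n" for c
    using equivariant_eqI[OF _ z f(2) that] by blast
  then show ?thesis using f(1) by blast
qed

text \<open>A basis element has only one degree, so the family may be read off generator by
  generator. The shift \<open>d\<close> is the identity for chain maps and \<open>Suc\<close> for
  homotopies.\<close>

lemma equivariant_glue:
  assumes f: "\<And>n. equivariant G R n S (d n) \<alpha> (f n)"
  shows "\<exists>F. \<forall>n. equivariant G R n S (d n) \<alpha> F \<and> (\<forall>c\<in>chains R n. F c = f n c)"
proof -
  define F where "F = frag_extend (\<lambda>x. f (THE n. x \<in> res_basis R n) (frag_of x))"
  have eq: "F c = f n c" if "c \<in> chains R n" for n c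
    using that
  proof (induction c rule: chains_induct)
    case zero
    show ?case using equivariant_zero[OF f] by (simp add: F_def)
  next
    case (one x)
    then have "(THE n. x \<in> res_basis R n) = n" using R.basis_disjoint by blast
    then show ?case by (simp add: F_def)
  next
    case (diff c d)
    then show ?case using equivariant_diff[OF f] by (simp add: F_def frag_extend_diff)
  qed
  have "equivariant G R n S (d n) \<alpha> F" for n
    using f[of n] by (simp add: equivariant_def eq[of _ n] R.chains_add R.act_closed)
  then show ?thesis using eq by blast
qed

theorem exists_equivariant_chain_map:
  "\<exists>f. equivariant_chain_map G R S \<alpha> f \<and> (\<forall>c\<in>chains R 0. res_aug S (f c) = res_aug R c)"
proof -
  \<comment> \<open>Preservation of cycles is the invariant that makes the next lifting problem
    solvable. In degree zero cycles are defined by the augmentation, so there the invariant follows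
    from preserving it.\<close>
  let ?Q = "\<lambda>n f. equivariant G R n S n \<alpha> f \<and> (\<forall>c. is_cycle R n c \<longrightarrow> is_cycle S n (f c))
    \<and> (n = 0 \<longrightarrow> (\<forall>c\<in>chains R 0. res_aug S (f c) = res_aug R c))"
  let ?U = "\<lambda>n f f'. \<forall>c\<in>chains R (Suc n). res_bdry S (f' c) = f (res_bdry R c)"
  have "\<exists>f. \<forall>n. ?Q n (f n) \<and> ?U n (f n) (f (Suc n))"
  proof (rule dependent_nat_choice[where P = ?Q and Q = ?U])
    obtain y where y: "y \<in> res_basis S 0" using S.basis_0 by blast
    \<comment> \<open>One fixed vertex of \<open>S\<close> serves for every orbit: its augmentation
      is one, and the action does not change that.\<close>
    have "\<exists>f. equivariant G R 0 S 0 \<alpha> f \<and> (\<forall>x\<in>res_basis R 0. res_aug S (f (frag_of x)) = 1)"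
      by (rule equivariant_choice) (use y S.aug_basis S.aug_act in \<open>auto intro!: bexI[of _ "frag_of y"]\<close>)
    then obtain f where f: "equivariant G R 0 S 0 \<alpha> f"
      "\<And>x. x \<in> res_basis R 0 \<Longrightarrow> res_aug S (f (frag_of x)) = 1" by blast
    have aug: "res_aug S (f c) = res_aug R c" if "c \<in> chains R 0" for c
      using that
      by (induction c rule: chains_induct)
        (auto simp: equivariant_zero[OF f(1)] f(2) R.aug_basis R.aug_diff S.aug_diff equivariant_diff[OF f(1)])
    have "is_cycle S 0 (f c)" if "is_cycle R 0 c" for c
      using that aug equivariant_closed[OF f(1)] by (simp add: is_cycle_def)
    then show "\<exists>f. ?Q 0 f" using f(1) aug by (intro exI[of _ f]) simp
  next
    fix f n assume Q: "?Q n f"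
    then have f: "equivariant G R n S n \<alpha> f" by blast
    have z: "equivariant G R (Suc n) S n \<alpha> (\<lambda>c. f (res_bdry R c))"
      using f R.bdry_equivariant[of n] by (auto simp: equivariant_def)
    have "\<exists>f'. equivariant G R (Suc n) S (Suc n) \<alpha> f' \<and> (\<forall>c\<in>chains R (Suc n). res_bdry S (f' c) = f (res_bdry R c))"
      by (rule equivariant_lift[OF z]) (use Q R.is_cycle_bdry in simp)
    then obtain f' where f': "equivariant G R (Suc n) S (Suc n) \<alpha> f'" "?U n f f'" by blast
    have "is_cycle S (Suc n) (f' c)" if "is_cycle R (Suc n) c" for c
      using that f' equivariant_closed[OF f'(1)] equivariant_zero[OF f] by (simp add: is_cycle_def)
    then have "?Q (Suc n) f'" using f'(1) by simp
    then show "\<exists>f'. ?Q (Suc n) f' \<and> ?U n f f'" using f'(2) by blast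
  qed
  then obtain f where Q: "\<And>n. ?Q n (f n)" and U: "\<And>n. ?U n (f n) (f (Suc n))" by blast
  obtain F where F: "\<And>n. equivariant G R n S n \<alpha> F" "\<And>n c. c \<in> chains R n \<Longrightarrow> F c = f n c"
    using equivariant_glue[of "\<lambda>n. n" f] Q by blast
  have "res_bdry S (F c) = F (res_bdry R c)" if c: "c \<in> chains R n" for n c
  proof (cases n)
    case 0
    then show ?thesis using c F(1)[of 0] equivariant_zero[OF F(1)] equivariant_closed[OF F(1)]
      by (simp add: R.bdry_0 S.bdry_0)
  next
    case (Suc m)
    then show ?thesis using c U[of m] by (simp add: F(2)[of _ n] F(2)[of _ m] R.bdry_closed)
  qed
  then have "equivariant_chain_map G R S \<alpha> F" using F(1) by (simp add: equivariant_chain_map_def)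
  moreover have "\<forall>c\<in>chains R 0. res_aug S (F c) = res_aug R c" using Q[of 0] F(2)[of _ 0] by simp
  ultimately show ?thesis by blast
qed

theorem exists_equivariant_homotopy:
  assumes f: "equivariant_chain_map G R S \<alpha> f" "\<And>c. c \<in> chains R 0 \<Longrightarrow> res_aug S (f c) = res_aug R c"
    and f': "equivariant_chain_map G R S \<alpha> f'" "\<And>c. c \<in> chains R 0 \<Longrightarrow> res_aug S (f' c) = res_aug R c"
  shows "\<exists>h. equivariant_homotopy G R S \<alpha> h f f'"
proof -
  have eq: "equivariant G R n S n \<alpha> f" "equivariant G R n S n \<alpha> f'" for n
    using f(1) f'(1) by (auto simp: equivariant_chain_map_def)
  have sub: "equivariant G R n S m \<alpha> (\<lambda>c. a c - b c)"
    if "equivariant G R n S m \<alpha> a" "equivariant G R n S m \<alpha> b" for n m a b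
    using that by (auto simp: equivariant_def S.act_diff S.chains_diff)
  let ?D = "\<lambda>c. f c - f' c"
  have D: "equivariant G R n S n \<alpha> ?D" for n by (rule sub[OF eq])
  have bD: "res_bdry S (?D c) = ?D (res_bdry R c)" if "c \<in> chains R n" for n c
    using equivariant_chain_mapD(2)[OF f(1) that] equivariant_chain_mapD(2)[OF f'(1) that]
    by (simp add: S.bdry_diff)
  \<comment> \<open>The homotopy identity in degree \<open>n\<close>, tested on boundaries, where
    the term with the homotopy one degree lower drops out. The invariant thus mentions one
    \<open>h\<close> only, and it says exactly that the right-hand side of \<open>?U\<close> is a
    cycle.\<close>
  let ?Q = "\<lambda>n h. equivariant G R n S (Suc n) \<alpha> h
    \<and> (\<forall>c\<in>chains R (Suc n). res_bdry S (h (res_bdry R c)) = ?D (res_bdry R c))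
    \<and> (n = 0 \<longrightarrow> (\<forall>c\<in>chains R 0. res_bdry S (h c) = ?D c))"
  let ?U = "\<lambda>n h h'. \<forall>c\<in>chains R (Suc n). res_bdry S (h' c) = ?D c - h (res_bdry R c)"
  have "\<exists>h. \<forall>n. ?Q n (h n) \<and> ?U n (h n) (h (Suc n))"
  proof (rule dependent_nat_choice[where P = ?Q and Q = ?U])
    have "is_cycle S 0 (?D (frag_of x))" if "x \<in> res_basis R 0" for x
      using that equivariant_closed[OF D, of "frag_of x" 0] f(2) f'(2) by (simp add: is_cycle_def S.aug_diff)
    then obtain h where h: "equivariant G R 0 S (Suc 0) \<alpha> h" "\<forall>c\<in>chains R 0. res_bdry S (h c) = ?D c"
      using equivariant_lift[OF D] by blast
    then show "\<exists>h. ?Q 0 h" using R.bdry_closed by (intro exI[of _ h]) simp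
  next
    fix h n assume Q: "?Q n h"
    then have h: "equivariant G R n S (Suc n) \<alpha> h" by blast
    have "equivariant G R (Suc n) S (Suc n) \<alpha> (\<lambda>c. h (res_bdry R c))"
      using h R.bdry_equivariant[of n] by (auto simp: equivariant_def)
    then have z: "equivariant G R (Suc n) S (Suc n) \<alpha> (\<lambda>c. ?D c - h (res_bdry R c))"
      by (rule sub[OF D])
    have "is_cycle S (Suc n) (?D (frag_of x) - h (res_bdry R (frag_of x)))" if x: "x \<in> res_basis R (Suc n)" for x
    proof -
      have c: "frag_of x \<in> chains R (Suc n)" using x by simp
      have "res_bdry S (h (res_bdry R (frag_of x))) = ?D (res_bdry R (frag_of x))" using Q c by blast
      then show ?thesis using equivariant_closed[OF z c] bD[OF c]
        by (simp add: is_cycle_def S.bdry_diff)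
    qed
    then obtain h' where h': "equivariant G R (Suc n) S (Suc (Suc n)) \<alpha> h'" "?U n h h'"
      using equivariant_lift[OF z] by blast
    have "res_bdry S (h' (res_bdry R c)) = ?D (res_bdry R c)" if "c \<in> chains R (Suc (Suc n))" for c
      using h'(2) R.bdry_closed[OF that] R.bdry_bdry[OF that] equivariant_zero[OF h] by simp
    then have "?Q (Suc n) h'" using h'(1) by simp
    then show "\<exists>h'. ?Q (Suc n) h' \<and> ?U n h h'" using h'(2) by blast
  qed
  then obtain h where Q: "\<And>n. ?Q n (h n)" and U: "\<And>n. ?U n (h n) (h (Suc n))" by blast
  obtain F where F: "\<And>n. equivariant G R n S (Suc n) \<alpha> F" "\<And>n c. c \<in> chains R n \<Longrightarrow> F c = h n c"
    using equivariant_glue[of Suc h] Q by blast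
  have "f c = res_bdry S (F c) + F (res_bdry R c) + f' c" if c: "c \<in> chains R n" for n c
  proof (cases n)
    case 0
    then have "res_bdry S (F c) = ?D c" using Q[of 0] c by (simp add: F(2)[of _ 0])
    then show ?thesis using c 0 equivariant_zero[OF F(1)] by (simp add: R.bdry_0)
  next
    case (Suc m)
    have "res_bdry S (F c) = ?D c - F (res_bdry R c)"
      using Suc c U[of m] by (simp add: F(2)[of _ n] F(2)[of _ m] R.bdry_closed)
    then show ?thesis by simp
  qed
  then show ?thesis using F(1) unfolding equivariant_homotopy_def by blast
qed

end

lemma comparison_map_iff:
  assumes "free_resolution G R" "free_resolution G S"
  shows "is_comparison_map G R S f \<longleftrightarrow>
    equivariant_chain_map G R S (\<lambda>x. x) f \<and> (\<forall>c\<in>chains R 0. res_aug S (f c) = res_aug R c)"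
proof -
  interpret R: free_resolution G R by fact
  interpret S: free_resolution G S by fact
  show ?thesis
    by (auto simp: is_comparison_map_def is_chain_map_def is_graded_hom_def equivariant_chain_map_def
        equivariant_def hom_def)
qed

text \<open>A comparison map back exists. Both composites preserve the augmentation, so each is
  homotopic to the identity.\<close>

theorem comparison_map_iso:
  assumes RS: "resolution_pair G R G S (\<lambda>x. x)" and f: "is_comparison_map G R S f"
  shows "homology_map G S n f \<in> iso (homology G R n) (homology G S n)"
proof -
  interpret RS: resolution_pair G R G S "\<lambda>x. x" by fact
  interpret SR: resolution_pair G S G R "\<lambda>x. x"
    by unfold_locales (simp add: hom_def)
  interpret RR: resolution_pair G R G R "\<lambda>x. x" by (rule RS.R.resolution_pair_id)
  interpret SS: resolution_pair G S G S "\<lambda>x. x" by (rule RS.S.resolution_pair_id)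
  have f: "equivariant_chain_map G R S (\<lambda>x. x) f" "\<And>c. c \<in> chains R 0 \<Longrightarrow> res_aug S (f c) = res_aug R c"
    using f comparison_map_iff[OF RS.R.free_resolution_axioms RS.S.free_resolution_axioms] by auto
  obtain g where g: "equivariant_chain_map G S R (\<lambda>x. x) g" "\<And>c. c \<in> chains S 0 \<Longrightarrow> res_aug R (g c) = res_aug S c"
    using SR.exists_equivariant_chain_map by blast
  have closed: "f c \<in> chains S 0" if "c \<in> chains R 0" for c
    by (rule equivariant_closed[OF equivariant_chain_mapD(1)[OF f(1)] that])
  have closed': "g c \<in> chains R 0" if "c \<in> chains S 0" for c
    by (rule equivariant_closed[OF equivariant_chain_mapD(1)[OF g(1)] that])
  have gf: "equivariant_chain_map G R R (\<lambda>x. x) (\<lambda>c. g (f c))"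
    using equivariant_chain_map_comp[OF RS f(1) g(1)] by (simp add: comp_def)
  have fg: "equivariant_chain_map G S S (\<lambda>x. x) (\<lambda>c. f (g c))"
    using equivariant_chain_map_comp[OF SR.resolution_pair_axioms g(1) f(1)] by (simp add: comp_def)
  have idR: "equivariant_chain_map G R R (\<lambda>x. x) (\<lambda>c. c)" and idS: "equivariant_chain_map G S S (\<lambda>x. x) (\<lambda>c. c)"
    by (auto simp: equivariant_chain_map_def equivariant_def)
  obtain h where h: "equivariant_homotopy G R R (\<lambda>x. x) h (\<lambda>c. g (f c)) (\<lambda>c. c)"
    using RR.exists_equivariant_homotopy[OF gf _ idR] f(2) g(2) closed by auto
  obtain h' where h': "equivariant_homotopy G S S (\<lambda>x. x) h' (\<lambda>c. f (g c)) (\<lambda>c. c)"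
    using SS.exists_equivariant_homotopy[OF fg _ idS] f(2) g(2) closed' by auto
  have inv1: "homology_map G R n g (homology_map G S n f x) = x" if "x \<in> carrier (homology G R n)" for x
    using homology_map_comp[OF RS SR.resolution_pair_axioms f(1) g(1) that]
      RR.homology_map_homotopic[OF gf idR h that] RS.R.homology_map_id[OF that] by simp
  have inv2: "homology_map G S n f (homology_map G R n g x) = x" if "x \<in> carrier (homology G S n)" for x
    using homology_map_comp[OF SR.resolution_pair_axioms RS g(1) f(1) that]
      SS.homology_map_homotopic[OF fg idS h' that] RS.S.homology_map_id[OF that] by simp
  have hf: "homology_map G S n f \<in> hom (homology G R n) (homology G S n)" by (rule RS.homology_map_hom[OF f(1)])
  have hg: "homology_map G R n g \<in> hom (homology G S n) (homology G R n)" by (rule SR.homology_map_hom[OF g(1)])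
  have "bij_betw (homology_map G S n f) (carrier (homology G R n)) (carrier (homology G S n))"
    by (rule bij_betw_byWitness[where f' = "homology_map G R n g"])
      (use inv1 inv2 hf hg in \<open>auto simp: hom_def\<close>)
  then show ?thesis using hf by (simp add: iso_def)
qed

section \<open>The bar resolution in homogeneous coordinates\<close>

abbreviation frag_map :: "('x \<Rightarrow> 'y) \<Rightarrow> ('x \<Rightarrow>\<^sub>0 int) \<Rightarrow> ('y \<Rightarrow>\<^sub>0 int)" where
  "frag_map f \<equiv> frag_extend (frag_of \<circ> f)"

text \<open>This is the augmented form: the boundary of a single vertex is the generator
  \<open>[]\<close>. The recursion on the first vertex makes adjoining a vertex in front a
  contraction by definition.\<close>

primrec simplex_bdry :: "'a list \<Rightarrow> ('a list \<Rightarrow>\<^sub>0 int)" where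
  "simplex_bdry [] = 0"
| "simplex_bdry (x # xs) = frag_of xs - frag_map (Cons x) (simplex_bdry xs)"

lemma simplex_bdry_alternating_sum:
  "simplex_bdry xs = (\<Sum>i<length xs. frag_cmul ((-1) ^ i) (frag_of (take i xs @ drop (Suc i) xs)))"
proof (induction xs)
  case (Cons x xs)
  have "frag_map (Cons x) (simplex_bdry xs)
      = (\<Sum>i<length xs. frag_cmul ((-1) ^ i) (frag_of (x # take i xs @ drop (Suc i) xs)))"
    unfolding Cons by (simp add: frag_extend_sum frag_extend_cmul comp_def)
  then show ?case
    by (simp add: sum.lessThan_Suc_shift del: sum.lessThan_Suc flip: sum_negf)
qed simp

lemma keys_simplex_bdry:
  "Poly_Mapping.keys (simplex_bdry xs) \<subseteq> {ys. length ys = length xs - 1 \<and> set ys \<subseteq> set xs}"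
proof (induction xs)
  case (Cons x xs)
  have "Poly_Mapping.keys (frag_map (Cons x) (simplex_bdry xs)) \<subseteq> Cons x ` Poly_Mapping.keys (simplex_bdry xs)"
    using keys_frag_extend[of "frag_of \<circ> Cons x" "simplex_bdry xs"] by auto
  moreover have "length xs \<noteq> 0" if "ys \<in> Poly_Mapping.keys (simplex_bdry xs)" for ys
    using that by auto
  ultimately show ?case
    using Cons keys_diff[of "frag_of xs" "frag_map (Cons x) (simplex_bdry xs)"] by fastforce
qed simp

text \<open>The cone formula d(x c) = c - x d(c), extended from simplices to chains, turns the
  boundary of the cone term into \<open>simplex_bdry xs\<close> minus a cone over a double
  boundary.\<close>

lemma simplex_bdry_bdry: "frag_extend simplex_bdry (simplex_bdry xs) = 0"
proof (induction xs)
  case (Cons x xs)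
  have "frag_extend simplex_bdry (frag_map (Cons x) c)
      = c - frag_map (Cons x) (frag_extend simplex_bdry c)" for c
    by (induction c rule: frag_induction[OF subset_UNIV]) (auto simp: frag_extend_diff comp_def)
  then show ?case by (simp add: frag_extend_diff Cons)
qed simp

lemma simplex_bdry_map: "simplex_bdry (map f xs) = frag_map (map f) (simplex_bdry xs)"
proof (induction xs)
  case (Cons x xs)
  have "frag_map (Cons (f x)) (frag_map (map f) c)
      = frag_map (map f) (frag_map (Cons x) c)" for c
    by (induction c rule: frag_induction[OF subset_UNIV]) (auto simp: frag_extend_diff comp_def)
  then show ?case by (simp add: frag_extend_diff Cons comp_def)
qed simp

text \<open>The expansion at the last vertex, matching the recursion of lattice paths on their last
  step.\<close>

lemma simplex_bdry_snoc:
  "simplex_bdry (xs @ [x]) = frag_extend (\<lambda>ys. frag_of (ys @ [x])) (simplex_bdry xs)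
    + frag_cmul ((-1) ^ length xs) (frag_of xs)"
proof (induction xs)
  case (Cons y xs)
  have "frag_map (Cons y) (frag_extend (\<lambda>ys. frag_of (ys @ [x])) c)
      = frag_extend (\<lambda>ys. frag_of (ys @ [x])) (frag_map (Cons y) c)" for c
    by (induction c rule: frag_induction[OF subset_UNIV]) (auto simp: frag_extend_diff comp_def)
  then show ?case
    by (simp add: frag_extend_diff Cons frag_extend_add frag_extend_cmul flip: minus_frag_cmul)
qed simp

section \<open>Translation between bar generators and vertex lists\<close>

fun bar_of_vertices :: "('g, 'm) monoid_scheme \<Rightarrow> 'g list \<Rightarrow> 'g list" where
  "bar_of_vertices G [] = []"
| "bar_of_vertices G [y] = [y]"
| "bar_of_vertices G (y # y' # ys) = (y \<otimes>\<^bsub>G\<^esub> inv\<^bsub>G\<^esub> y') # bar_of_vertices G (y' # ys)"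

primrec vertices_of_bar :: "('g, 'm) monoid_scheme \<Rightarrow> 'g list \<Rightarrow> 'g list" where
  "vertices_of_bar G [] = []"
| "vertices_of_bar G (x # xs) = foldr (\<otimes>\<^bsub>G\<^esub>) (x # xs) \<one>\<^bsub>G\<^esub> # vertices_of_bar G xs"

lemma length_bar_of_vertices [simp]: "length (bar_of_vertices G ys) = length ys"
  by (induction G ys rule: bar_of_vertices.induct) auto

lemma length_vertices_of_bar [simp]: "length (vertices_of_bar G xs) = length xs"
  by (induction xs) auto

lemma bar_of_vertices_Nil_iff [simp]: "bar_of_vertices G ys = [] \<longleftrightarrow> ys = []"
  using length_bar_of_vertices[of G ys] by (metis length_0_conv)

lemma nth_vertices_of_bar:
  "i < length xs \<Longrightarrow> vertices_of_bar G xs ! i = foldr (\<otimes>\<^bsub>G\<^esub>) (drop i xs) \<one>\<^bsub>G\<^esub>"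
  by (induction xs arbitrary: i) (auto simp: nth_Cons split: nat.splits)

lemma nth_bar_of_vertices:
  "Suc i < length ys \<Longrightarrow> bar_of_vertices G ys ! i = ys ! i \<otimes>\<^bsub>G\<^esub> inv\<^bsub>G\<^esub> (ys ! Suc i)"
proof (induction G ys arbitrary: i rule: bar_of_vertices.induct)
  case (3 G y y' ys)
  then show ?case by (cases i) auto
qed auto

lemma last_bar_of_vertices: "ys \<noteq> [] \<Longrightarrow> last (bar_of_vertices G ys) = last ys"
  by (induction G ys rule: bar_of_vertices.induct) auto

lemma vertices_of_bar_Nil_iff [simp]: "vertices_of_bar G xs = [] \<longleftrightarrow> xs = []"
  using length_vertices_of_bar[of G xs] by (metis length_0_conv)

text \<open>Deleting an inner vertex multiplies the two adjacent quotients, in which the vertex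
  cancels. Deleting the first one drops the first entry. For the last one the final quotient is
  multiplied by the final entry, which is that vertex itself, and the preceding vertex
  remains.\<close>

lemma bar_of_vertices_delete:
  assumes "group G" "set ys \<subseteq> carrier G" "i < length ys" "length ys \<ge> 2"
  shows "bar_of_vertices G (take i ys @ drop (Suc i) ys) = bar_face G (bar_of_vertices G ys) i"
proof -
  interpret group G by fact
  have shift: "bar_face G (h # xs) (Suc (Suc j)) = h # bar_face G xs (Suc j)" for h xs j
    by (simp add: bar_face_def)
  have canc: "y \<otimes>\<^bsub>G\<^esub> inv\<^bsub>G\<^esub> y' \<otimes>\<^bsub>G\<^esub> y' = y" if "y \<in> carrier G" "y' \<in> carrier G" for y y'
    using that by (simp add: m_assoc)
  show ?thesis using assms(2-)
  proof (induction ys arbitrary: i rule: induct_list012)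
    case (3 y y' ys)
    consider "i = 0" | "i = Suc 0" | j where "i = Suc (Suc j)" by (metis not0_implies_Suc)
    then show ?case
    proof cases
      case 1
      then show ?thesis by (simp add: bar_face_def)
    next
      case 2
      then show ?thesis using 3(3) canc by (cases ys) (auto simp: bar_face_def m_assoc[symmetric])
    next
      case (3 j)
      then have "bar_of_vertices G (take (Suc j) (y' # ys) @ drop (Suc (Suc j)) (y' # ys))
          = bar_face G (bar_of_vertices G (y' # ys)) (Suc j)"
        using "3.prems" by (intro "3.IH"(2)) (auto simp: Suc_le_eq)
      then show ?thesis using 3 by (simp add: shift)
    qed
  qed auto
qed

lemma bar_bdry_gen_of_vertices:
  assumes "group G" "set ys \<subseteq> carrier G" "length ys \<ge> 2"
  shows "bar_bdry_gen G (bar_of_vertices G ys) = frag_map (bar_of_vertices G) (simplex_bdry ys)"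
proof -
  obtain n where n: "length ys = Suc n" "n \<noteq> 0" using assms(3) by (cases "length ys") auto
  have "frag_map (bar_of_vertices G) (simplex_bdry ys)
      = (\<Sum>i<length ys. frag_cmul ((-1) ^ i) (frag_of (bar_of_vertices G (take i ys @ drop (Suc i) ys))))"
    by (simp add: simplex_bdry_alternating_sum frag_extend_sum frag_extend_cmul comp_def)
  also have "\<dots> = (\<Sum>i<Suc n. frag_cmul ((-1) ^ i) (frag_of (bar_face G (bar_of_vertices G ys) i)))"
    unfolding n(1)[symmetric] by (rule sum.cong) (simp_all add: bar_of_vertices_delete[OF assms(1,2) _ assms(3)])
  also have "\<dots> = bar_bdry_gen G (bar_of_vertices G ys)"
    using n by (simp add: bar_bdry_gen_def lessThan_Suc_atMost atMost_atLeast0 sum.atLeast_Suc_atMost)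
  finally show ?thesis by simp
qed

context group
begin

lemma bar_of_vertices_closed: "set ys \<subseteq> carrier G \<Longrightarrow> set (bar_of_vertices G ys) \<subseteq> carrier G"
  by (induction ys rule: induct_list012) auto

lemma foldr_mult_closed: "set xs \<subseteq> carrier G \<Longrightarrow> foldr (\<otimes>) xs \<one> \<in> carrier G"
  by (induction xs) auto

lemma vertices_of_bar_closed: "set xs \<subseteq> carrier G \<Longrightarrow> set (vertices_of_bar G xs) \<subseteq> carrier G"
  using foldr_mult_closed by (induction xs) auto

lemma foldr_bar_of_vertices:
  "set ys \<subseteq> carrier G \<Longrightarrow> ys \<noteq> [] \<Longrightarrow> foldr (\<otimes>) (bar_of_vertices G ys) \<one> = hd ys"
  by (induction ys rule: induct_list012) (auto simp: m_assoc)

lemma vertices_of_bar_of_vertices: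
  "set ys \<subseteq> carrier G \<Longrightarrow> vertices_of_bar G (bar_of_vertices G ys) = ys"
  by (induction ys rule: induct_list012) (auto simp: foldr_bar_of_vertices m_assoc)

lemma bar_of_vertices_of_bar:
  "set xs \<subseteq> carrier G \<Longrightarrow> bar_of_vertices G (vertices_of_bar G xs) = xs"
  by (induction xs rule: induct_list012) (auto simp: foldr_mult_closed m_assoc)

text \<open>Translating all vertices on the right leaves the quotients of neighbours unchanged and
  alters only the final entry.\<close>

lemma bar_act_gen_of_vertices:
  "set ys \<subseteq> carrier G \<Longrightarrow> ys \<noteq> [] \<Longrightarrow> h \<in> carrier G \<Longrightarrow>
    bar_act_gen G h (bar_of_vertices G ys) = bar_of_vertices G (map (\<lambda>y. y \<otimes> inv h) ys)"
proof (induction ys rule: induct_list012)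
  case (3 y y' ys)
  have "(y \<otimes> inv h) \<otimes> inv (y' \<otimes> inv h) = y \<otimes> inv y'"
    using 3 by (simp add: inv_mult_group m_assoc) (simp add: m_assoc[symmetric])
  then show ?case using 3 by (auto simp: bar_act_gen_def)
qed (auto simp: bar_act_gen_def)

lemma bar_of_vertices_map_hom:
  assumes "group H" "\<alpha> \<in> hom G H"
  shows "set ys \<subseteq> carrier G \<Longrightarrow> bar_of_vertices H (map \<alpha> ys) = map \<alpha> (bar_of_vertices G ys)"
proof -
  interpret h: group_hom G H \<alpha> using assms by (simp add: group_hom_def group_hom_axioms_def)
  show "set ys \<subseteq> carrier G \<Longrightarrow> bar_of_vertices H (map \<alpha> ys) = map \<alpha> (bar_of_vertices G ys)"
    by (induction ys rule: induct_list012) auto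
qed

end

section \<open>Augmentation and contraction of the bar resolution\<close>

lemma sum_keys_add:
  fixes c d :: "'x \<Rightarrow>\<^sub>0 int" and w :: "'x \<Rightarrow> int"
  shows "(\<Sum>x\<in>Poly_Mapping.keys (c + d). Poly_Mapping.lookup (c + d) x * w x)
    = (\<Sum>x\<in>Poly_Mapping.keys c. Poly_Mapping.lookup c x * w x)
      + (\<Sum>x\<in>Poly_Mapping.keys d. Poly_Mapping.lookup d x * w x)"
proof -
  \<comment> \<open>Supports may shrink under addition, so the three sums are compared on the union
    of the supports, where absent keys contribute zero.\<close>
  let ?U = "Poly_Mapping.keys c \<union> Poly_Mapping.keys d"
  have "(\<Sum>x\<in>Poly_Mapping.keys e. Poly_Mapping.lookup e x * w x) = (\<Sum>x\<in>?U. Poly_Mapping.lookup e x * w x)"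
    if "Poly_Mapping.keys e \<subseteq> ?U" for e
    using that by (intro sum.mono_neutral_left) (auto simp: in_keys_iff)
  from this[OF keys_add] this[of c] this[of d] show ?thesis
    by (simp add: lookup_add distrib_right sum.distrib)
qed

lemma res_basis_bar [simp]:
  "xs \<in> res_basis (bar_resolution G) n \<longleftrightarrow> length xs = Suc n \<and> set xs \<subseteq> carrier G"
  by (simp add: bar_resolution_def)

lemma res_bdry_bar: "res_bdry (bar_resolution G) = frag_extend (bar_bdry_gen G)"
  by (simp add: bar_resolution_def)

lemma res_act_bar: "res_act (bar_resolution G) h = frag_map (bar_act_gen G h)"
  by (simp add: bar_resolution_def)

lemma chains_bar:
  "c \<in> chains (bar_resolution G) n \<longleftrightarrow> Poly_Mapping.keys c \<subseteq> {xs. length xs = Suc n \<and> set xs \<subseteq> carrier G}"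
  by (simp add: chain_group_def bar_resolution_def)

lemma res_aug_bar_add:
  "res_aug (bar_resolution G) (c + d) = res_aug (bar_resolution G) c + res_aug (bar_resolution G) d"
  using sum_keys_add[of c d "\<lambda>_. 1"] by (simp add: bar_resolution_def)

lemma res_aug_bar_diff:
  "res_aug (bar_resolution G) (c - d) = res_aug (bar_resolution G) c - res_aug (bar_resolution G) d"
  using res_aug_bar_add[of G "c - d" d] by simp

lemma res_aug_bar_frag_of [simp]: "res_aug (bar_resolution G) (frag_of x) = 1"
  by (simp add: bar_resolution_def)

text \<open>The cone with apex 1 in vertex coordinates; it provides the fillings in the proofs of
  exactness.\<close>

definition bar_contraction :: "('g, 'm) monoid_scheme \<Rightarrow> ('g list \<Rightarrow>\<^sub>0 int) \<Rightarrow> ('g list \<Rightarrow>\<^sub>0 int)" where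
  "bar_contraction G = frag_extend (\<lambda>xs. frag_of (bar_of_vertices G (\<one>\<^bsub>G\<^esub> # vertices_of_bar G xs)))"

abbreviation (in group) "Bar \<equiv> bar_resolution G"

context group
begin

lemma bar_basis_cases:
  assumes "xs \<in> res_basis Bar n"
  obtains ys where "xs = bar_of_vertices G ys" "length ys = Suc n" "set ys \<subseteq> carrier G"
  using assms bar_of_vertices_of_bar[of xs] vertices_of_bar_closed[of xs]
  by (metis length_vertices_of_bar res_basis_bar)

lemma bar_bdry_of_vertices:
  assumes "set ys \<subseteq> carrier G" "length ys = Suc (Suc n)"
  shows "res_bdry Bar (frag_of (bar_of_vertices G ys))
    = frag_map (bar_of_vertices G) (simplex_bdry ys)"
  using assms by (simp add: res_bdry_bar bar_bdry_gen_of_vertices)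

lemma bar_bdry_chain_of_vertices:
  assumes "Poly_Mapping.keys c \<subseteq> {ys. length ys = Suc (Suc n) \<and> set ys \<subseteq> carrier G}"
  shows "res_bdry Bar (frag_map (bar_of_vertices G) c)
    = frag_map (bar_of_vertices G) (frag_extend simplex_bdry c)"
  using assms
proof (induction c rule: frag_induction)
  case (one ys)
  then show ?case by (simp add: bar_bdry_of_vertices comp_def)
next
  case (diff a b)
  then show ?case by (simp add: frag_extend_diff res_bdry_bar)
qed (simp add: res_bdry_bar)

lemma bar_bdry_vertex: "length ys = Suc 0 \<Longrightarrow> res_bdry Bar (frag_of ys) = 0"
  by (simp add: res_bdry_bar bar_bdry_gen_def)

lemma bar_chain_of_vertices_closed:
  assumes "Poly_Mapping.keys c \<subseteq> {ys. length ys = Suc n \<and> set ys \<subseteq> carrier G}"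
  shows "frag_map (bar_of_vertices G) c \<in> chains Bar n"
  using keys_frag_extend[of "frag_of \<circ> bar_of_vertices G" c] assms bar_of_vertices_closed
  by (fastforce simp: chains_bar)

lemma keys_simplex_bdry_closed:
  "length ys = Suc n \<Longrightarrow> set ys \<subseteq> carrier G \<Longrightarrow>
    Poly_Mapping.keys (simplex_bdry ys) \<subseteq> {zs. length zs = n \<and> set zs \<subseteq> carrier G}"
  using keys_simplex_bdry[of ys] by auto

lemma bar_contraction_of_vertices:
  assumes "Poly_Mapping.keys c \<subseteq> {ys. set ys \<subseteq> carrier G}"
  shows "bar_contraction G (frag_map (bar_of_vertices G) c)
    = frag_map (bar_of_vertices G) (frag_map (Cons \<one>) c)"
  using assms
  by (induction c rule: frag_induction)
    (auto simp: bar_contraction_def frag_extend_diff vertices_of_bar_of_vertices)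

lemma bar_contraction_closed:
  "c \<in> chains Bar n \<Longrightarrow> bar_contraction G c \<in> chains Bar (Suc n)"
proof -
  assume "c \<in> chains Bar n"
  then have "frag_of (bar_of_vertices G (\<one> # vertices_of_bar G xs)) \<in> chains Bar (Suc n)"
    if "xs \<in> Poly_Mapping.keys c" for xs
    using that bar_of_vertices_closed[of "\<one> # vertices_of_bar G xs"] vertices_of_bar_closed[of xs]
    by (auto simp: chains_bar)
  then show ?thesis
    using keys_frag_extend[of "\<lambda>xs. frag_of (bar_of_vertices G (\<one> # vertices_of_bar G xs))" c]
    unfolding bar_contraction_def chains_bar by fast
qed

text \<open>In vertex coordinates this is the defining recursion of \<open>simplex_bdry\<close> at
  the list \<open>\<one> # ys\<close>.\<close>

lemma bar_contraction_homotopy: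
  assumes "c \<in> chains Bar (Suc n)"
  shows "res_bdry Bar (bar_contraction G c)
    + bar_contraction G (res_bdry Bar c) = c"
proof -
  show ?thesis using assms
  proof (induction c rule: chains_induct)
    case (one xs)
    then obtain ys where ys: "xs = bar_of_vertices G ys" "length ys = Suc (Suc n)" "set ys \<subseteq> carrier G"
      by (rule bar_basis_cases)
    have "res_bdry Bar (bar_contraction G (frag_of xs))
        = frag_map (bar_of_vertices G) (simplex_bdry (\<one> # ys))"
      using ys bar_bdry_of_vertices[of "\<one> # ys"] by (simp add: bar_contraction_def vertices_of_bar_of_vertices)
    moreover have "bar_contraction G (res_bdry Bar (frag_of xs))
        = frag_map (bar_of_vertices G) (frag_map (Cons \<one>) (simplex_bdry ys))"
      using ys keys_simplex_bdry_closed[OF ys(2,3)]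
      by (subst bar_contraction_of_vertices[symmetric]) (auto simp: bar_bdry_of_vertices)
    ultimately show ?case using ys(1) by (simp add: frag_extend_diff)
  next
    case (diff a b)
    then show ?case by (simp add: res_bdry_bar bar_contraction_def frag_extend_diff algebra_simps)
  qed (simp add: res_bdry_bar bar_contraction_def)
qed

text \<open>The edge from the apex to a vertex \<open>y\<close> has boundary \<open>[y]\<close>
  minus \<open>[\<one>]\<close>; counting the second terms with coefficients yields the
  augmentation.\<close>

lemma bar_contraction_homotopy_0:
  assumes "c \<in> chains Bar 0"
  shows "res_bdry Bar (bar_contraction G c)
    = c - frag_cmul (res_aug Bar c) (frag_of [\<one>])"
proof -
  show ?thesis using assms
  proof (induction c rule: chains_induct)
    case (one xs)
    then obtain y where y: "xs = [y]" "y \<in> carrier G"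
      by (auto simp: length_Suc_conv)
    then have "res_bdry Bar (bar_contraction G (frag_of xs))
        = frag_map (bar_of_vertices G) (simplex_bdry [\<one>, y])"
      using bar_bdry_of_vertices[of "[\<one>, y]"] by (simp add: bar_contraction_def)
    then show ?case using y by (simp add: frag_extend_diff)
  next
    case (diff a b)
    then show ?case
      by (simp add: res_aug_bar_diff res_bdry_bar bar_contraction_def frag_extend_diff frag_cmul_diff_distrib)
  qed (simp add: res_bdry_bar bar_contraction_def bar_resolution_def)
qed

text \<open>In vertex coordinates the homomorphism acts vertex by vertex, which commutes with
  deleting a vertex. Degree zero is separate because of the empty simplex.\<close>

lemma bar_map_bdry_basis:
  assumes H: "group H" and \<alpha>: "\<alpha> \<in> hom G H" and x: "x \<in> res_basis Bar n"
  shows "res_bdry (bar_resolution H) (bar_map \<alpha> (frag_of x)) = bar_map \<alpha> (res_bdry Bar (frag_of x))"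
proof -
  obtain ys where ys: "x = bar_of_vertices G ys" "length ys = Suc n" "set ys \<subseteq> carrier G"
    using x by (rule bar_basis_cases)
  have map_closed: "set (map \<alpha> ys) \<subseteq> carrier H" using ys(3) \<alpha> by (auto simp: hom_def)
  note map = bar_of_vertices_map_hom[OF H \<alpha>]
  show ?thesis
  proof (cases n)
    case 0
    then show ?thesis using ys by (simp add: bar_map_def res_bdry_bar bar_bdry_gen_def)
  next
    case (Suc m)
    have "res_bdry (bar_resolution H) (bar_map \<alpha> (frag_of x))
        = frag_map (bar_of_vertices H) (simplex_bdry (map \<alpha> ys))"
      using group.bar_bdry_of_vertices[OF H map_closed, of m] ys Suc by (simp add: bar_map_def map)
    also have "\<dots> = frag_map (bar_of_vertices H \<circ> map \<alpha>) (simplex_bdry ys)"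
      by (simp only: simplex_bdry_map frag_extend_compose comp_assoc)
    also have "\<dots> = frag_map (map \<alpha> \<circ> bar_of_vertices G) (simplex_bdry ys)"
      by (rule frag_extend_eq) (use keys_simplex_bdry_closed[OF ys(2,3)] map in auto)
    also have "\<dots> = bar_map \<alpha> (frag_map (bar_of_vertices G) (simplex_bdry ys))"
      by (simp only: bar_map_def frag_extend_compose comp_assoc)
    finally show ?thesis using ys Suc by (simp add: bar_bdry_of_vertices)
  qed
qed

lemma bar_act_bdry_basis:
  assumes h: "h \<in> carrier G" and x: "x \<in> res_basis Bar n"
  shows "res_bdry Bar (res_act Bar h (frag_of x))
    = res_act Bar h (res_bdry Bar (frag_of x))"
proof -
  obtain ys where ys: "x = bar_of_vertices G ys" "length ys = Suc n" "set ys \<subseteq> carrier G"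
    using x by (rule bar_basis_cases)
  let ?t = "\<lambda>y. y \<otimes> inv h"
  have map_closed: "set (map ?t ys) \<subseteq> carrier G" using ys(3) h by auto
  have ne: "ys \<noteq> []" using ys(2) by auto
  show ?thesis
  proof (cases n)
    case 0
    then show ?thesis using ys by (simp add: res_bdry_bar bar_bdry_gen_def res_act_bar bar_act_gen_def)
  next
    case (Suc m)
    have "res_bdry Bar (res_act Bar h (frag_of x))
        = frag_map (bar_of_vertices G) (simplex_bdry (map ?t ys))"
      using bar_bdry_of_vertices[OF map_closed, of m] ys Suc h ne
      by (simp add: res_act_bar bar_act_gen_of_vertices)
    also have "\<dots> = frag_map (bar_of_vertices G \<circ> map ?t) (simplex_bdry ys)"
      by (simp only: simplex_bdry_map frag_extend_compose comp_assoc)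
    also have "\<dots> = frag_map (bar_act_gen G h \<circ> bar_of_vertices G) (simplex_bdry ys)"
    proof (rule frag_extend_eq)
      fix zs assume "zs \<in> Poly_Mapping.keys (simplex_bdry ys)"
      then have "length zs = Suc m" "set zs \<subseteq> carrier G"
        using keys_simplex_bdry_closed[OF ys(2,3)] Suc by auto
      then show "(frag_of \<circ> (bar_of_vertices G \<circ> map ?t)) zs = (frag_of \<circ> (bar_act_gen G h \<circ> bar_of_vertices G)) zs"
        using bar_act_gen_of_vertices[of zs h] h by (cases zs) auto
    qed
    also have "\<dots> = res_act Bar h (frag_map (bar_of_vertices G) (simplex_bdry ys))"
      by (simp only: res_act_bar frag_extend_compose comp_assoc)
    finally show ?thesis using ys Suc by (simp add: bar_bdry_of_vertices)
  qed
qed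

theorem free_resolution_bar: "free_resolution G Bar"
proof -
  let ?R = Bar
  have bdry_vertex: "res_bdry ?R c = 0" if "c \<in> chains ?R 0" for c
  proof -
    show ?thesis using that
      by (induction c rule: chains_induct)
        (auto simp: res_bdry_bar frag_extend_diff bar_bdry_gen_def)
  qed
  have bdry_closed: "res_bdry ?R (frag_of x) \<in> chains ?R n" if "x \<in> res_basis ?R (Suc n)" for x n
  proof -
    obtain ys where ys: "x = bar_of_vertices G ys" "length ys = Suc (Suc n)" "set ys \<subseteq> carrier G"
      using \<open>x \<in> res_basis ?R (Suc n)\<close> by (rule bar_basis_cases)
    show ?thesis
      unfolding ys(1) bar_bdry_of_vertices[OF ys(3,2)]
      by (rule bar_chain_of_vertices_closed[OF keys_simplex_bdry_closed[OF ys(2,3)]])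
  qed
  show ?thesis
  proof (unfold_locales)
    show "res_bdry ?R c = frag_extend (\<lambda>x. res_bdry ?R (frag_of x)) c"
      and "res_act ?R g c = frag_extend (\<lambda>x. res_act ?R g (frag_of x)) c" for c g
      by (simp_all add: res_bdry_bar res_act_bar comp_def)
    show "res_aug ?R (c + d) = res_aug ?R c + res_aug ?R d" for c d
      by (rule res_aug_bar_add)
    show "res_bdry ?R (frag_of x) \<in> chains ?R n" if "x \<in> res_basis ?R (Suc n)" for x n
      using that by (rule bdry_closed)
    show "res_bdry ?R (frag_of x) = 0" if "x \<in> res_basis ?R 0" for x
      using that by (simp add: bar_bdry_vertex)
    show "res_bdry ?R (res_bdry ?R (frag_of x)) = 0" if x: "x \<in> res_basis ?R n" for x n
    proof -
      obtain ys where ys: "x = bar_of_vertices G ys" "length ys = Suc n" "set ys \<subseteq> carrier G"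
        using x by (rule bar_basis_cases)
      \<comment> \<open>In degree one the first boundary consists of single vertices, where the bar
        boundary is zero but the simplicial one is the empty list. Only from degree two on does
        \<open>simplex_bdry_bdry\<close> carry over.\<close>
      consider "n = 0" | "n = 1" | m where "n = Suc (Suc m)" by (metis One_nat_def not0_implies_Suc)
      then show ?thesis
      proof cases
        case 1
        then show ?thesis using x by (simp add: bar_bdry_vertex) (simp add: res_bdry_bar)
      next
        case 2
        then show ?thesis using bdry_vertex[OF bdry_closed] x by simp
      next
        case (3 m)
        have "res_bdry ?R (res_bdry ?R (frag_of x))
          = frag_map (bar_of_vertices G) (frag_extend simplex_bdry (simplex_bdry ys))"
          using 3 ys keys_simplex_bdry_closed[OF ys(2,3)]
          by (simp add: bar_bdry_of_vertices bar_bdry_chain_of_vertices)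
        then show ?thesis by (simp add: simplex_bdry_bdry)
      qed
    qed
    show "res_aug ?R (res_bdry ?R (frag_of x)) = 0" if x: "x \<in> res_basis ?R (Suc 0)" for x
    proof -
      obtain ys where ys: "x = bar_of_vertices G ys" "length ys = Suc (Suc 0)" "set ys \<subseteq> carrier G"
        using x by (rule bar_basis_cases)
      then obtain a b where "ys = [a, b]" by (auto simp: length_Suc_conv)
      then show ?thesis using ys bar_bdry_of_vertices[OF ys(3,2)] by (simp add: frag_extend_diff res_aug_bar_diff)
    qed
    show "\<exists>y\<in>res_basis ?R n. res_act ?R g (frag_of x) = frag_of y"
      if "g \<in> carrier G" "x \<in> res_basis ?R n" for g x n
    proof -
      have "x \<noteq> []" using that by auto
      then have "last x \<in> carrier G" "set (butlast x) \<subseteq> carrier G"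
        using that last_in_set[of x] in_set_butlastD[of _ x] by auto
      then have "bar_act_gen G g x \<in> res_basis ?R n" using that by (simp add: bar_act_gen_def)
      then show ?thesis by (auto simp: res_act_bar)
    qed
    show "res_act ?R \<one> (frag_of x) = frag_of x" if "x \<in> res_basis ?R n" for x n
    proof -
      have "x \<noteq> []" using that by auto
      moreover from this have "last x \<in> carrier G" using that last_in_set[of x] by auto
      ultimately show ?thesis by (simp add: res_act_bar bar_act_gen_def)
    qed
    show "res_act ?R (g \<otimes> h) (frag_of x) = res_act ?R g (res_act ?R h (frag_of x))"
      if "g \<in> carrier G" "h \<in> carrier G" "x \<in> res_basis ?R n" for g h x n
    proof -
      have "x \<noteq> []" using that by auto
      moreover from this have "last x \<in> carrier G" using that last_in_set[of x] by auto
      ultimately show ?thesis using that by (simp add: res_act_bar bar_act_gen_def inv_mult_group m_assoc)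
    qed
    show "g = \<one>" if "g \<in> carrier G" "x \<in> res_basis ?R n" "res_act ?R g (frag_of x) = frag_of x" for g x n
    proof -
      have ne: "x \<noteq> []" using that by auto
      then have l: "last x \<in> carrier G" using that last_in_set[of x] by auto
      have "last x \<otimes> inv g = last x"
        using that(3) ne by (simp add: res_act_bar bar_act_gen_def frag_of_eq) (metis last_snoc)
      then show ?thesis using l that(1) by simp
    qed
    show "res_bdry ?R (res_act ?R g (frag_of x)) = res_act ?R g (res_bdry ?R (frag_of x))"
      if "g \<in> carrier G" "x \<in> res_basis ?R n" for g x n
      using that by (rule bar_act_bdry_basis)
    show "res_aug ?R (frag_of x) = 1" for x by simp
    show "n = m" if "x \<in> res_basis ?R n" "x \<in> res_basis ?R m" for x n m
      using that by simp
    have "[\<one>] \<in> res_basis ?R 0" by simp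
    then show "res_basis ?R 0 \<noteq> {}" by blast
    show "\<exists>d\<in>chains ?R (Suc 0). res_bdry ?R d = c" if "c \<in> chains ?R 0" "res_aug ?R c = 0" for c
      using bar_contraction_closed[OF that(1)] bar_contraction_homotopy_0[OF that(1)] that(2) by auto
    show "\<exists>d\<in>chains ?R (Suc (Suc n)). res_bdry ?R d = c" if "c \<in> chains ?R (Suc n)" "res_bdry ?R c = 0" for c n
      using bar_contraction_closed[OF that(1)] bar_contraction_homotopy[OF that(1)] that(2)
      by (auto simp: bar_contraction_def)
  qed
qed

end

lemma bar_map_equivariant_chain_map:
  assumes "group G" "group H" and \<alpha>: "\<alpha> \<in> hom G H"
  shows "equivariant_chain_map G (bar_resolution G) (bar_resolution H) \<alpha> (bar_map \<alpha>)"
    and "c \<in> chains (bar_resolution G) 0 \<Longrightarrow>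
      res_aug (bar_resolution H) (bar_map \<alpha> c) = res_aug (bar_resolution G) c"
proof -
  interpret G: group G by fact
  interpret H: group H by fact
  interpret R: free_resolution G "bar_resolution G" by (rule G.free_resolution_bar)
  interpret S: free_resolution H "bar_resolution H" by (rule H.free_resolution_bar)
  interpret h: group_hom G H \<alpha> using \<alpha> by unfold_locales
  have closed: "bar_map \<alpha> c \<in> chains (bar_resolution H) n" if "c \<in> chains (bar_resolution G) n" for c n
    using that by (induction c rule: chains_induct) (auto simp: bar_map_def frag_extend_diff S.chains_diff)
  have act: "bar_map \<alpha> (res_act (bar_resolution G) g c) = res_act (bar_resolution H) (\<alpha> g) (bar_map \<alpha> c)"
    if "c \<in> chains (bar_resolution G) n" "g \<in> carrier G" for c g n
    using that
  proof (induction c rule: chains_induct)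
    case (one x)
    then have ne: "x \<noteq> []" by auto
    then have "last x \<in> carrier G" using one last_in_set[of x] by auto
    then show ?case using one ne
      by (simp add: bar_map_def res_act_bar bar_act_gen_def map_butlast last_map)
  qed (auto simp: bar_map_def frag_extend_diff R.act_diff S.act_diff)
  have bdry: "res_bdry (bar_resolution H) (bar_map \<alpha> c) = bar_map \<alpha> (res_bdry (bar_resolution G) c)"
    if "c \<in> chains (bar_resolution G) n" for c n
    using that
  proof (induction c rule: chains_induct)
    case (one x)
    then show ?case by (rule G.bar_map_bdry_basis[OF assms(2) \<alpha>])
  qed (auto simp: bar_map_def frag_extend_diff R.bdry_diff S.bdry_diff)
  have add: "bar_map \<alpha> (c + d) = bar_map \<alpha> c + bar_map \<alpha> d" for c d
    by (simp add: bar_map_def frag_extend_add)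
  show "equivariant_chain_map G (bar_resolution G) (bar_resolution H) \<alpha> (bar_map \<alpha>)"
    using closed act bdry add by (simp add: equivariant_chain_map_def equivariant_def)
  show "res_aug (bar_resolution H) (bar_map \<alpha> c) = res_aug (bar_resolution G) c"
    if "c \<in> chains (bar_resolution G) 0"
    using that by (induction c rule: chains_induct)
      (auto simp: bar_map_def frag_extend_diff R.aug_diff S.aug_diff)
qed

section \<open>The total complex\<close>

lemma frag_cmul_diff_distrib2: "frag_cmul k (c - d) = frag_cmul k c - frag_cmul k d"
  using frag_cmul_distrib2[of k "c - d" d] by simp

text \<open>The tensor product of chains, with the tensor product of two free abelian groups
  identified with the free abelian group on pairs. Through it the total boundary, action and
  contraction can be expressed on chains by the maps of the factors.\<close>

definition frag_tensor :: "('x \<Rightarrow>\<^sub>0 int) \<Rightarrow> ('y \<Rightarrow>\<^sub>0 int) \<Rightarrow> ('x \<times> 'y \<Rightarrow>\<^sub>0 int)" where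
  "frag_tensor a b = frag_extend (\<lambda>x. frag_extend (\<lambda>y. frag_of (x, y)) b) a"

lemma frag_tensor_of [simp]: "frag_tensor (frag_of x) (frag_of y) = frag_of (x, y)"
  by (simp add: frag_tensor_def)

lemma frag_tensor_zero [simp]: "frag_tensor 0 b = 0" "frag_tensor a 0 = 0"
  by (simp_all add: frag_tensor_def frag_extend_eq_0)

lemma frag_tensor_diff_left: "frag_tensor (a - a') b = frag_tensor a b - frag_tensor a' b"
  by (simp add: frag_tensor_def frag_extend_diff)

lemma frag_tensor_diff_right: "frag_tensor a (b - b') = frag_tensor a b - frag_tensor a b'"
proof -
  let ?F = "\<lambda>b x. frag_extend (\<lambda>y. frag_of (x, y)) b"
  have "frag_extend (?F (b - b')) a = frag_extend (?F b) a - frag_extend (?F b') a"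
    by (induction a rule: frag_induction[OF subset_UNIV]) (auto simp: frag_extend_diff algebra_simps)
  then show ?thesis by (simp add: frag_tensor_def)
qed

lemma frag_tensor_minus_left: "frag_tensor (- a) b = - frag_tensor a b"
  using frag_tensor_diff_left[of 0 a b] by simp

lemma frag_tensor_minus_right: "frag_tensor a (- b) = - frag_tensor a b"
  using frag_tensor_diff_right[of a 0 b] by simp

lemma frag_tensor_add_left: "frag_tensor (a + a') b = frag_tensor a b + frag_tensor a' b"
  using frag_tensor_diff_left[of a "- a'" b] by (simp add: frag_tensor_minus_left)

lemma frag_tensor_add_right: "frag_tensor a (b + b') = frag_tensor a b + frag_tensor a b'"
  using frag_tensor_diff_right[of a b "- b'"] by (simp add: frag_tensor_minus_right)

lemma keys_frag_tensor: "Poly_Mapping.keys (frag_tensor a b) \<subseteq> Poly_Mapping.keys a \<times> Poly_Mapping.keys b"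
proof -
  have "Poly_Mapping.keys (frag_extend (\<lambda>y. frag_of (x, y)) b) \<subseteq> {x} \<times> Poly_Mapping.keys b" for x
    using keys_frag_extend[of "\<lambda>y. frag_of (x, y)" b] by auto
  then show ?thesis
    unfolding frag_tensor_def
    using keys_frag_extend[of "\<lambda>x. frag_extend (\<lambda>y. frag_of (x, y)) b" a] by fast
qed

lemma res_basis_tot [simp]:
  "(xs, ys) \<in> res_basis (tot_resolution K) n \<longleftrightarrow>
    xs \<noteq> [] \<and> ys \<noteq> [] \<and> length xs + length ys = Suc (Suc n) \<and> set xs \<subseteq> carrier K \<and> set ys \<subseteq> carrier K"
proof
  assume "(xs, ys) \<in> res_basis (tot_resolution K) n"
  then show "xs \<noteq> [] \<and> ys \<noteq> [] \<and> length xs + length ys = Suc (Suc n) \<and> set xs \<subseteq> carrier K \<and> set ys \<subseteq> carrier K"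
    by (auto simp: tot_resolution_def)
next
  assume *: "xs \<noteq> [] \<and> ys \<noteq> [] \<and> length xs + length ys = Suc (Suc n) \<and> set xs \<subseteq> carrier K \<and> set ys \<subseteq> carrier K"
  then obtain p q where "length xs = Suc p" "length ys = Suc q" by (cases xs; cases ys) auto
  then show "(xs, ys) \<in> res_basis (tot_resolution K) n"
    using * by (auto simp: tot_resolution_def intro!: bexI[of _ p])
qed

lemma tot_basis_cases:
  assumes "x \<in> res_basis (tot_resolution K) n"
  obtains xs ys p q where "x = (xs, ys)" "n = p + q"
    "xs \<in> res_basis (bar_resolution K) p" "ys \<in> res_basis (bar_resolution K) q"
proof -
  obtain xs ys where x: "x = (xs, ys)" by (cases x)
  then have "length xs = Suc (length xs - 1)" "length ys = Suc (length ys - 1)" "n = (length xs - 1) + (length ys - 1)"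
    using assms by (cases xs; cases ys; simp)+
  then show ?thesis using that[OF x, of "length xs - 1" "length ys - 1"] assms x by simp
qed

lemma res_act_tot: "res_act (tot_resolution K) g = frag_map (tot_act_gen K g)"
  by (simp add: tot_resolution_def)

lemma res_bdry_tot: "res_bdry (tot_resolution K) = frag_extend (tot_bdry_gen K)"
  by (simp add: tot_resolution_def)

lemma chains_bar_tensor:
  assumes "a \<in> chains (bar_resolution K) p" "b \<in> chains (bar_resolution K) q" "n = p + q"
  shows "frag_tensor a b \<in> chains (tot_resolution K) n"
proof -
  have "Poly_Mapping.keys a \<times> Poly_Mapping.keys b \<subseteq> res_basis (tot_resolution K) n"
    using assms by (fastforce simp: chains_bar)
  then show ?thesis using keys_frag_tensor[of a b] by (simp add: chain_group_def)
qed

lemma tot_bdry_basis: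
  "res_bdry (tot_resolution K) (frag_of (xs, ys))
    = frag_tensor (res_bdry (bar_resolution K) (frag_of xs)) (frag_of ys)
      + frag_cmul ((-1) ^ (length xs - 1)) (frag_tensor (frag_of xs) (res_bdry (bar_resolution K) (frag_of ys)))"
  by (simp add: res_bdry_tot tot_bdry_gen_def res_bdry_bar frag_tensor_def)

text \<open>The Leibniz rule. The sign reads off the degree of the first factor, which is why
  \<open>a\<close> has to be homogeneous.\<close>

lemma tot_bdry_tensor:
  assumes "a \<in> chains (bar_resolution K) p"
  shows "res_bdry (tot_resolution K) (frag_tensor a b)
    = frag_tensor (res_bdry (bar_resolution K) a) b
      + frag_cmul ((-1) ^ p) (frag_tensor a (res_bdry (bar_resolution K) b))"
proof -
  show ?thesis using assms
  proof (induction a rule: chains_induct)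
    case (one xs)
    show ?case
    proof (induction b rule: frag_induction[OF subset_UNIV])
      case (2 ys)
      then show ?case using one tot_bdry_basis[of K xs ys] by simp
    next
      case (3 b b')
      then show ?case
        by (simp add: frag_tensor_diff_right res_bdry_tot res_bdry_bar frag_extend_diff frag_cmul_diff_distrib2 algebra_simps)
    qed (simp add: res_bdry_tot res_bdry_bar)
  next
    case (diff a a')
    then show ?case
      by (simp add: frag_tensor_diff_left res_bdry_tot res_bdry_bar frag_extend_diff frag_cmul_diff_distrib2 algebra_simps)
  qed (simp add: res_bdry_tot res_bdry_bar)
qed

lemma res_aug_tot_add:
  "res_aug (tot_resolution K) (c + d) = res_aug (tot_resolution K) c + res_aug (tot_resolution K) d"
  using sum_keys_add[of c d "\<lambda>_. 1"] by (simp add: tot_resolution_def split_def)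

lemma res_aug_tot_diff:
  "res_aug (tot_resolution K) (c - d) = res_aug (tot_resolution K) c - res_aug (tot_resolution K) d"
  using res_aug_tot_add[of K "c - d" d] by simp

lemma res_aug_tot_frag_of [simp]: "res_aug (tot_resolution K) (frag_of x) = 1"
  by (simp add: tot_resolution_def split_def)

text \<open>This splits the action into bar actions and the bar map of a conjugation, so its
  compatibility with the boundary reduces to facts about the bar resolution.\<close>

lemma tot_act_gen_eq:
  "ys \<noteq> [] \<Longrightarrow> tot_act_gen K (k, g) (xs, ys)
    = (bar_act_gen K g xs, bar_act_gen K k (map (\<lambda>y. g \<otimes>\<^bsub>K\<^esub> y \<otimes>\<^bsub>K\<^esub> inv\<^bsub>K\<^esub> g) ys))"
  by (simp add: tot_act_gen_def bar_act_gen_def map_butlast last_map)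

lemma tot_act_tensor:
  assumes "b \<in> chains (bar_resolution K) q"
  shows "res_act (tot_resolution K) (k, g) (frag_tensor a b)
    = frag_tensor (res_act (bar_resolution K) g a)
        (res_act (bar_resolution K) k (bar_map (\<lambda>y. g \<otimes>\<^bsub>K\<^esub> y \<otimes>\<^bsub>K\<^esub> inv\<^bsub>K\<^esub> g) b))"
proof -
  show ?thesis using assms
  proof (induction b rule: chains_induct)
    case (one ys)
    then have "ys \<noteq> []" by auto
    then show ?case
      by (induction a rule: frag_induction[OF subset_UNIV])
        (auto simp: res_act_tot res_act_bar bar_map_def tot_act_gen_eq frag_tensor_diff_left frag_extend_diff)
  qed (simp_all add: res_act_tot res_act_bar bar_map_def frag_tensor_diff_right frag_extend_diff)
qed

text \<open>The contraction \<open>s \<otimes> 1 + \<eta>\<epsilon> \<otimes> s\<close> for \<open>s\<close> the contraction of the bar resolution and \<open>\<eta>\<close> the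
  inclusion of the generator \<open>(1)\<close>; the second summand vanishes unless the first degree is \<open>0\<close>.\<close>

definition tot_contraction :: "('a, 'm) monoid_scheme \<Rightarrow> ('a list \<times> 'a list \<Rightarrow>\<^sub>0 int) \<Rightarrow> ('a list \<times> 'a list \<Rightarrow>\<^sub>0 int)" where
  "tot_contraction K = frag_extend (\<lambda>(xs, ys).
     frag_tensor (bar_contraction K (frag_of xs)) (frag_of ys)
     + (if length xs = 1 then frag_tensor (frag_of [\<one>\<^bsub>K\<^esub>]) (bar_contraction K (frag_of ys)) else 0))"

lemma tot_contraction_tensor:
  assumes "a \<in> chains (bar_resolution K) p"
  shows "tot_contraction K (frag_tensor a b) = frag_tensor (bar_contraction K a) b
    + (if p = 0 then frag_cmul (res_aug (bar_resolution K) a) (frag_tensor (frag_of [\<one>\<^bsub>K\<^esub>]) (bar_contraction K b)) else 0)"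
proof -
  show ?thesis using assms
  proof (induction a rule: chains_induct)
    case zero
    have "res_aug (bar_resolution K) 0 = 0" using res_aug_bar_add[of K 0 0] by simp
    then show ?case by (simp add: tot_contraction_def bar_contraction_def)
  next
    case (one xs)
    then show ?case
      by (induction b rule: frag_induction[OF subset_UNIV])
        (auto simp: tot_contraction_def bar_contraction_def frag_tensor_diff_right frag_extend_diff)
  next
    case (diff a a')
    then show ?case
      by (auto simp: tot_contraction_def bar_contraction_def frag_tensor_diff_left frag_extend_diff res_aug_bar_diff
          frag_cmul_diff_distrib)
  qed
qed

section \<open>Contractibility and freeness of the total complex\<close>

abbreviation (in group) "Tot \<equiv> tot_resolution G"

context group
begin

text \<open>Passing from x to s x raises the degree by one and flips the sign of the second boundary
  term, so the terms with s in the first and the boundary in the second factor cancel and (ds + sd)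
  \<otimes> 1 remains. For p > 0 this is the identity. For p = 0 it is 1 - \<eta>\<epsilon> in the
  first factor, and the second summand supplies the missing part up to the base point in total
  degree zero.\<close>

lemma tot_contraction_homotopy_basis:
  assumes "x \<in> res_basis Tot n"
  shows "tot_contraction G (frag_of x) \<in> chains Tot (Suc n)" (is ?closed)
    and "res_bdry Tot (tot_contraction G (frag_of x))
      + tot_contraction G (res_bdry Tot (frag_of x))
      = frag_of x - (if n = 0 then frag_of ([\<one>], [\<one>]) else 0)" (is ?homotopy)
proof -
  interpret R: free_resolution G Bar by (rule free_resolution_bar)
  let ?s = "bar_contraction G" and ?d = "res_bdry Bar"
  let ?e = "frag_of [\<one>]"
  obtain xs ys p q where x: "x = (xs, ys)" "n = p + q"
    and xs: "xs \<in> res_basis Bar p" and ys: "ys \<in> res_basis Bar q"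
    using assms by (rule tot_basis_cases)
  let ?x = "frag_of xs" and ?y = "frag_of ys"
  have cx: "?x \<in> chains Bar p" and cy: "?y \<in> chains Bar q"
    and ce: "?e \<in> chains Bar 0" using xs ys by auto
  have sx: "?s ?x \<in> chains Bar (Suc p)" and sy: "?s ?y \<in> chains Bar (Suc q)"
    using cx cy by (auto intro: bar_contraction_closed)
  have T: "tot_contraction G (frag_of x) = frag_tensor (?s ?x) ?y
    + (if p = 0 then frag_tensor ?e (?s ?y) else 0)"
    using xs by (simp add: x tot_contraction_def)
  have d: "res_bdry Tot (frag_of x) = frag_tensor (?d ?x) ?y + frag_cmul ((-1) ^ p) (frag_tensor ?x (?d ?y))"
    using xs by (simp add: x tot_bdry_basis)
  have c1: "frag_tensor (?s ?x) ?y \<in> chains Tot (Suc n)"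
    by (rule chains_bar_tensor[OF sx cy]) (simp add: x)
  have c2: "frag_tensor ?e (?s ?y) \<in> chains Tot (Suc n)" if "p = 0"
    by (rule chains_bar_tensor[OF ce sy]) (simp add: x that)
  show ?closed
    using c1 c2 keys_add[of "frag_tensor (?s ?x) ?y" "frag_tensor ?e (?s ?y)"]
    by (auto simp: T chain_group_def)
  have dT: "res_bdry Tot (a + b) = res_bdry Tot a + res_bdry Tot b" for a b
    by (simp add: res_bdry_tot frag_extend_add)
  have TT: "tot_contraction G (a + b) = tot_contraction G a + tot_contraction G b"
    "tot_contraction G (frag_cmul k a) = frag_cmul k (tot_contraction G a)" for a b k
    by (simp_all add: tot_contraction_def frag_extend_add frag_extend_cmul)
  have T0: "tot_contraction G 0 = 0" by (simp add: tot_contraction_def)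
  note Tx = tot_contraction_tensor[OF cx]
  show ?homotopy
  proof (cases p)
    case 0
    have dx: "?d ?x = 0" by (rule R.bdry_0) (use cx 0 in simp)
    have de: "?d ?e = 0" by (rule R.bdry_0[OF ce])
    have dsx: "?d (?s ?x) = ?x - ?e" using bar_contraction_homotopy_0[of ?x] cx 0 by simp
    have *: "res_bdry Tot (tot_contraction G (frag_of x)) + tot_contraction G (res_bdry Tot (frag_of x))
      = frag_tensor ?x ?y - frag_tensor ?e ?y + frag_tensor ?e (?d (?s ?y) + ?s (?d ?y))"
      unfolding T d dT TT tot_bdry_tensor[OF sx]
      by (simp add: 0 dx dT tot_bdry_tensor[OF sx] tot_bdry_tensor[OF ce] de dsx Tx T0
          frag_tensor_diff_left frag_tensor_add_right)
    show ?thesis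
    proof (cases q)
      case 0
      then have "?d ?y = 0" "?d (?s ?y) = ?y - ?e"
        using R.bdry_0[of ?y] bar_contraction_homotopy_0[of ?y] cy by auto
      then show ?thesis unfolding * using 0 \<open>p = 0\<close>
        by (simp add: x frag_tensor_diff_right bar_contraction_def)
    next
      case (Suc r)
      have "?d (?s ?y) + ?s (?d ?y) = ?y" by (rule bar_contraction_homotopy) (use cy Suc in simp)
      then show ?thesis unfolding * using Suc by (simp add: x)
    qed
  next
    case (Suc r)
    have cdx: "?d ?x \<in> chains Bar r" by (rule R.bdry_closed) (use cx Suc in simp)
    \<comment> \<open>When \<open>p = 1\<close>, the boundary of \<open>xs\<close> has degree zero,
      so the second summand of the contraction could contribute. It vanishes because the
      augmentation of a boundary is zero.\<close>
    have "r = 0 \<Longrightarrow> res_aug Bar (?d ?x) = 0"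
      using R.aug_bdry[of ?x] cx Suc by simp
    then have Tdx: "tot_contraction G (frag_tensor (?d ?x) ?y) = frag_tensor (?s (?d ?x)) ?y"
      using tot_contraction_tensor[OF cdx] by auto
    have hx: "?d (?s ?x) + ?s (?d ?x) = ?x" by (rule bar_contraction_homotopy) (use cx Suc in simp)
    have "res_bdry Tot (tot_contraction G (frag_of x)) + tot_contraction G (res_bdry Tot (frag_of x))
      = frag_tensor (?d (?s ?x) + ?s (?d ?x)) ?y"
      unfolding T d TT Tdx frag_tensor_add_left
      using Suc by (simp add: tot_bdry_tensor[OF sx] Tx T0 frag_tensor_add_left flip: minus_frag_cmul)
    then show ?thesis unfolding hx using Suc by (simp add: x)
  qed
qed

lemma tot_contraction_homotopy:
  assumes "c \<in> chains Tot n"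
  shows "tot_contraction G c \<in> chains Tot (Suc n)" (is ?closed)
    and "res_bdry Tot (tot_contraction G c)
      + tot_contraction G (res_bdry Tot c)
      = c - (if n = 0 then frag_cmul (res_aug Tot c) (frag_of ([\<one>], [\<one>])) else 0)" (is ?homotopy)
proof -
  have aug_zero: "res_aug Tot 0 = 0" using res_aug_tot_add[of G 0 0] by simp
  have "?closed \<and> ?homotopy" using assms
  proof (induction c rule: chains_induct)
    case zero
    show ?case by (simp add: tot_contraction_def res_bdry_tot chain_group_def aug_zero)
  next
    case (one x)
    then show ?case using tot_contraction_homotopy_basis[of x n] by simp
  next
    case (diff a b)
    have "tot_contraction G (a - b) = tot_contraction G a - tot_contraction G b"
      by (simp add: tot_contraction_def frag_extend_diff)
    then show ?case using diff keys_diff[of "tot_contraction G a" "tot_contraction G b"]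
      by (auto simp: tot_contraction_def res_bdry_tot chain_group_def res_aug_tot_diff frag_extend_diff
          frag_cmul_diff_distrib algebra_simps)
  qed
  then show ?closed ?homotopy by auto
qed

lemma conj_hom: "g \<in> carrier G \<Longrightarrow> (\<lambda>y. g \<otimes> y \<otimes> inv g) \<in> hom G G"
proof (rule homI)
  fix y z assume *: "g \<in> carrier G" "y \<in> carrier G" "z \<in> carrier G"
  then have "inv g \<otimes> (g \<otimes> (z \<otimes> inv g)) = z \<otimes> inv g" by (simp add: m_assoc[symmetric])
  then show "g \<otimes> (y \<otimes> z) \<otimes> inv g = g \<otimes> y \<otimes> inv g \<otimes> (g \<otimes> z \<otimes> inv g)"
    using * by (simp add: m_assoc)
qed simp

lemma conj_mult:
  assumes "g \<in> carrier G" "h \<in> carrier G" "y \<in> carrier G"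
  shows "(g \<otimes> h) \<otimes> y \<otimes> inv (g \<otimes> h) = g \<otimes> (h \<otimes> y \<otimes> inv h) \<otimes> inv g"
  using assms by (simp add: inv_mult_group m_assoc)

theorem free_resolution_tot: "free_resolution (conj_semidirect G) Tot"
proof -
  interpret R: free_resolution G Bar by (rule free_resolution_bar)
  interpret L: group "conj_semidirect G" by (rule group_conj_semidirect[OF is_group])
  let ?T = Tot and ?B = Bar and ?L = "conj_semidirect G"
  let ?d = "res_bdry Bar"
  have carrier_L: "x \<in> carrier ?L \<longleftrightarrow> fst x \<in> carrier G \<and> snd x \<in> carrier G" for x
    by (cases x) (simp add: conj_semidirect_def)
  have bdry_add: "res_bdry ?T (a + b) = res_bdry ?T a + res_bdry ?T b"
    and bdry_cmul: "res_bdry ?T (frag_cmul k a) = frag_cmul k (res_bdry ?T a)" for a b k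
    by (simp_all add: res_bdry_tot frag_extend_add frag_extend_cmul)
  have act_basis: "tot_act_gen G (k, g) (xs, ys) \<in> res_basis ?T n"
    if "k \<in> carrier G" "g \<in> carrier G" "(xs, ys) \<in> res_basis ?T n" for k g xs ys n
  proof -
    have "xs \<noteq> []" "ys \<noteq> []" using that by auto
    then have "last xs \<in> carrier G" "set (butlast xs) \<subseteq> carrier G" "last ys \<in> carrier G" "set (butlast ys) \<subseteq> carrier G"
      using that last_in_set[of xs] last_in_set[of ys] in_set_butlastD[of _ xs] in_set_butlastD[of _ ys] by auto
    moreover have "length xs - Suc 0 + (length ys - Suc 0) = n" "xs \<noteq> []" "ys \<noteq> []"
      using that by (cases xs; cases ys; simp)+
    ultimately show ?thesis using that by (cases xs; cases ys) (auto simp: tot_act_gen_def)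
  qed
  show ?thesis
  proof (unfold_locales)
    show "res_bdry ?T c = frag_extend (\<lambda>x. res_bdry ?T (frag_of x)) c"
      and "res_act ?T g c = frag_extend (\<lambda>x. res_act ?T g (frag_of x)) c" for c g
      by (simp_all add: res_bdry_tot res_act_tot comp_def)
    show "res_aug ?T (c + d) = res_aug ?T c + res_aug ?T d" for c d by (rule res_aug_tot_add)
    show "res_aug ?T (frag_of x) = 1" for x by simp
    show "n = m" if "x \<in> res_basis ?T n" "x \<in> res_basis ?T m" for x n m
      using that by (cases x) auto
    have "([\<one>], [\<one>]) \<in> res_basis ?T 0" by simp
    then show "res_basis ?T 0 \<noteq> {}" by blast
    show "\<exists>d\<in>chains ?T (Suc 0). res_bdry ?T d = c" if c: "c \<in> chains ?T 0" "res_aug ?T c = 0" for c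
    proof -
      have "res_bdry ?T c = 0"
      proof -
        show ?thesis using c(1)
        proof (induction c rule: chains_induct)
          case (one x)
          obtain xs ys where x: "x = (xs, ys)" by (cases x)
          then have "length xs = 1" "length ys = 1" using one by (cases xs; cases ys; simp)+
          then show ?case by (simp add: x tot_bdry_basis bar_bdry_vertex)
        qed (auto simp: res_bdry_tot frag_extend_diff)
      qed
      then show ?thesis using tot_contraction_homotopy[OF c(1)] c(2) by (auto simp: tot_contraction_def)
    qed
    show "\<exists>d\<in>chains ?T (Suc (Suc n)). res_bdry ?T d = c" if "c \<in> chains ?T (Suc n)" "res_bdry ?T c = 0" for c n
      using tot_contraction_homotopy[OF that(1)] that(2) by (auto simp: tot_contraction_def)
  next
    fix x n assume "x \<in> res_basis ?T (Suc n)"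
    then obtain xs ys p q where x: "x = (xs, ys)" "Suc n = p + q"
      and xs: "xs \<in> res_basis ?B p" and ys: "ys \<in> res_basis ?B q"
      by (rule tot_basis_cases)
    have cx: "frag_of xs \<in> chains ?B p" and cy: "frag_of ys \<in> chains ?B q" using xs ys by auto
    have c1: "frag_tensor (?d (frag_of xs)) (frag_of ys) \<in> chains ?T n"
    proof (cases p)
      case 0
      then show ?thesis using R.bdry_0[of "frag_of xs"] cx by (simp add: chain_group_def)
    next
      case (Suc r)
      have "?d (frag_of xs) \<in> chains ?B r" by (rule R.bdry_closed) (use cx Suc in simp)
      then show ?thesis by (rule chains_bar_tensor[OF _ cy]) (use x Suc in simp)
    qed
    have c2: "frag_tensor (frag_of xs) (?d (frag_of ys)) \<in> chains ?T n"
    proof (cases q)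
      case 0
      then show ?thesis using R.bdry_0[of "frag_of ys"] cy by (simp add: chain_group_def)
    next
      case (Suc r)
      have "?d (frag_of ys) \<in> chains ?B r" by (rule R.bdry_closed) (use cy Suc in simp)
      then show ?thesis by (rule chains_bar_tensor[OF cx]) (use x Suc in simp)
    qed
    show "res_bdry ?T (frag_of x) \<in> chains ?T n"
      using c1 c2 unfolding x(1) tot_bdry_basis chain_group_def carrier_free_Abelian_group_iff
      by (meson keys_add keys_cmul order_trans Un_least)
  next
    fix x assume "x \<in> res_basis ?T 0"
    moreover obtain xs ys where x: "x = (xs, ys)" by (cases x)
    ultimately have "length xs = 1" "length ys = 1" by (cases xs; cases ys; simp)+
    then show "res_bdry ?T (frag_of x) = 0" by (simp add: x tot_bdry_basis bar_bdry_vertex)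
  next
    fix x n assume "x \<in> res_basis ?T n"
    then obtain xs ys p q where x: "x = (xs, ys)" "n = p + q"
      and xs: "xs \<in> res_basis ?B p" and ys: "ys \<in> res_basis ?B q"
      by (rule tot_basis_cases)
    have cx: "frag_of xs \<in> chains ?B p" and cy: "frag_of ys \<in> chains ?B q" using xs ys by auto
    note dd = R.bdry_bdry[OF cx] R.bdry_bdry[OF cy]
    show "res_bdry ?T (res_bdry ?T (frag_of x)) = 0"
    proof (cases p)
      case 0
      then show ?thesis using R.bdry_0[of "frag_of xs"] cx
        by (simp add: x tot_bdry_basis bdry_add bdry_cmul tot_bdry_tensor[OF cx] dd)
    next
      case (Suc r)
      then have cdx: "?d (frag_of xs) \<in> chains ?B r" using R.bdry_closed cx by simp
      have d2: "res_bdry ?T (frag_of x) = frag_tensor (?d (frag_of xs)) (frag_of ys)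
          + frag_cmul ((-1) ^ p) (frag_tensor (frag_of xs) (?d (frag_of ys)))"
        using xs by (simp add: x(1) tot_bdry_basis)
      have "res_bdry ?T (res_bdry ?T (frag_of x))
        = frag_cmul ((-1) ^ r) (frag_tensor (?d (frag_of xs)) (?d (frag_of ys)))
          + frag_cmul ((-1) ^ p) (frag_tensor (?d (frag_of xs)) (?d (frag_of ys)))"
        unfolding d2 bdry_add bdry_cmul tot_bdry_tensor[OF cx] tot_bdry_tensor[OF cdx] dd by simp
      also have "\<dots> = frag_cmul ((-1) ^ r + (-1) ^ p) (frag_tensor (?d (frag_of xs)) (?d (frag_of ys)))"
        by (simp only: frag_cmul_distrib)
      also have "\<dots> = 0" by (simp add: Suc)
      finally show ?thesis .
    qed
  next
    fix x assume "x \<in> res_basis ?T (Suc 0)"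
    then obtain xs ys p q where x: "x = (xs, ys)" "Suc 0 = p + q"
      and xs: "xs \<in> res_basis ?B p" and ys: "ys \<in> res_basis ?B q"
      by (rule tot_basis_cases)
    have edge: "\<exists>a b. ?d (frag_of zs) = frag_of a - frag_of b" if zs: "zs \<in> res_basis ?B 1" for zs
    proof -
      obtain vs where vs: "zs = bar_of_vertices G vs" "length vs = Suc (Suc 0)" "set vs \<subseteq> carrier G"
        using zs bar_basis_cases by (metis One_nat_def)
      then obtain a b where "vs = [a, b]" by (auto simp: length_Suc_conv)
      then show ?thesis using vs bar_bdry_of_vertices[OF vs(3,2)] by (auto simp: frag_extend_diff)
    qed
    consider "p = 0" "q = 1" | "p = 1" "q = 0" using x(2) by linarith
    then show "res_aug ?T (res_bdry ?T (frag_of x)) = 0"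
    proof cases
      case 1
      then obtain a b where "?d (frag_of ys) = frag_of a - frag_of b" using edge ys by blast
      moreover have "?d (frag_of xs) = 0" using xs 1 by (simp add: bar_bdry_vertex)
      ultimately show ?thesis using xs 1 by (simp add: x(1) tot_bdry_basis frag_tensor_diff_right res_aug_tot_diff)
    next
      case 2
      then obtain a b where "?d (frag_of xs) = frag_of a - frag_of b" using edge xs by blast
      moreover have "?d (frag_of ys) = 0" using ys 2 by (simp add: bar_bdry_vertex)
      ultimately show ?thesis by (simp add: x(1) tot_bdry_basis frag_tensor_diff_left res_aug_tot_diff)
    qed
  next
    fix u x n assume "u \<in> carrier ?L" "x \<in> res_basis ?T n"
    moreover obtain k g xs ys where "u = (k, g)" "x = (xs, ys)" by (cases u, cases x) auto
    ultimately show "\<exists>y\<in>res_basis ?T n. res_act ?T u (frag_of x) = frag_of y"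
      using act_basis by (auto simp: res_act_tot carrier_L)
  next
    fix x n assume *: "x \<in> res_basis ?T n"
    obtain xs ys where x: "x = (xs, ys)" by (cases x)
    have ne: "xs \<noteq> []" "ys \<noteq> []" using * x by auto
    then have "last xs \<in> carrier G" "set (butlast ys) \<subseteq> carrier G" "last ys \<in> carrier G"
      using * x last_in_set[of xs] last_in_set[of ys] in_set_butlastD[of _ ys] by auto
    moreover from this have "map (\<lambda>y. \<one> \<otimes> y \<otimes> inv \<one>) (butlast ys) = butlast ys"
      by (intro map_idI) auto
    ultimately show "res_act ?T \<one>\<^bsub>?L\<^esub> (frag_of x) = frag_of x"
      using ne by (simp add: x res_act_tot tot_act_gen_def conj_semidirect_def)
  next
    fix u v x n assume *: "u \<in> carrier ?L" "v \<in> carrier ?L" "x \<in> res_basis ?T n"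
    obtain a g b h xs ys where eq: "u = (a, g)" "v = (b, h)" "x = (xs, ys)" by (cases u, cases v, cases x) auto
    have ne: "xs \<noteq> []" "ys \<noteq> []" using * eq by auto
    then have l: "last xs \<in> carrier G" "set (butlast ys) \<subseteq> carrier G" "last ys \<in> carrier G"
      using * eq last_in_set[of xs] last_in_set[of ys] in_set_butlastD[of _ ys] by auto
    have car: "a \<in> carrier G" "g \<in> carrier G" "b \<in> carrier G" "h \<in> carrier G"
      using * eq by (auto simp: carrier_L)
    have 1: "map (\<lambda>y. (g \<otimes> h) \<otimes> y \<otimes> inv (g \<otimes> h)) (butlast ys)
      = map (\<lambda>y. g \<otimes> y \<otimes> inv g) (map (\<lambda>y. h \<otimes> y \<otimes> inv h) (butlast ys))"
      using l car conj_mult by (auto simp: subset_iff)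
    have canc: "inv g \<otimes> (g \<otimes> z) = z" if "z \<in> carrier G" for z
      using that car by (simp add: m_assoc[symmetric])
    \<comment> \<open>The twisted factor of the product in the semidirect group is a conjugate by
      \<open>g\<close>: conjugating after translating by \<open>inv b\<close> equals translating by
      the conjugate of \<open>inv b\<close> after conjugating.\<close>
    have 2: "(g \<otimes> h) \<otimes> z \<otimes> inv (g \<otimes> h) \<otimes> inv (a \<otimes> (g \<otimes> b \<otimes> inv g))
      = g \<otimes> (h \<otimes> z \<otimes> inv h \<otimes> inv b) \<otimes> inv g \<otimes> inv a" if "z \<in> carrier G" for z
      using that car by (simp add: inv_mult_group m_assoc canc)
    have 0: "last xs \<otimes> inv (g \<otimes> h) = last xs \<otimes> inv h \<otimes> inv g"
      using l car by (simp add: inv_mult_group m_assoc)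
    have T: "tot_act_gen G (a \<otimes> (g \<otimes> b \<otimes> inv g), g \<otimes> h) (xs, ys) = tot_act_gen G (a, g) (tot_act_gen G (b, h) (xs, ys))"
      unfolding tot_act_gen_def split butlast_snoc last_snoc 0 1 2[OF l(3)] ..
    show "res_act ?T (u \<otimes>\<^bsub>?L\<^esub> v) (frag_of x) = res_act ?T u (res_act ?T v (frag_of x))"
      by (simp add: eq res_act_tot conj_semidirect_def T)
  next
    fix u x n assume *: "u \<in> carrier ?L" "x \<in> res_basis ?T n" "res_act ?T u (frag_of x) = frag_of x"
    obtain k g xs ys where eq: "u = (k, g)" "x = (xs, ys)" by (cases u, cases x) auto
    have ne: "xs \<noteq> []" "ys \<noteq> []" using * eq by auto
    then have l: "last xs \<in> carrier G" "last ys \<in> carrier G"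
      using * eq last_in_set[of xs] last_in_set[of ys] by auto
    have car: "k \<in> carrier G" "g \<in> carrier G" using * eq by (auto simp: carrier_L)
    have "tot_act_gen G (k, g) (xs, ys) = (xs, ys)" using *(3) by (simp add: eq res_act_tot frag_of_eq)
    then have xs: "butlast xs @ [last xs \<otimes> inv g] = xs"
      and ys: "map (\<lambda>y. g \<otimes> y \<otimes> inv g) (butlast ys) @ [g \<otimes> last ys \<otimes> inv g \<otimes> inv k] = ys"
      by (auto simp: tot_act_gen_def)
    \<comment> \<open>The first list detects \<open>g\<close>; once \<open>g = \<one>\<close>, the
      last entry of the second list detects \<open>k\<close>.\<close>
    have "last xs \<otimes> inv g = last xs" using xs by (metis last_snoc)
    then have g: "g = \<one>" using l car by simp
    have "g \<otimes> last ys \<otimes> inv g \<otimes> inv k = last ys" using ys by (metis last_snoc)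
    then have "k = \<one>" using l car g by simp
    then show "u = \<one>\<^bsub>?L\<^esub>" using g eq by (simp add: conj_semidirect_def)
  next
    fix u x n assume *: "u \<in> carrier ?L" "x \<in> res_basis ?T n"
    obtain k g where u: "u = (k, g)" by (cases u)
    obtain xs ys p q where x: "x = (xs, ys)" "n = p + q"
      and xs: "xs \<in> res_basis ?B p" and ys: "ys \<in> res_basis ?B q"
      using *(2) by (rule tot_basis_cases)
    have car: "k \<in> carrier G" "g \<in> carrier G" using * u by (auto simp: carrier_L)
    let ?c = "bar_map (\<lambda>y. g \<otimes> y \<otimes> inv g)"
    have cx: "frag_of xs \<in> chains ?B p" and cy: "frag_of ys \<in> chains ?B q" using xs ys by auto
    have gx: "res_act ?B g (frag_of xs) \<in> chains ?B p" by (rule R.act_closed[OF cx car(2)])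
    note cm = bar_map_equivariant_chain_map(1)[OF is_group is_group conj_hom[OF car(2)]]
    have cyc: "?c (frag_of ys) \<in> chains ?B q"
      by (rule equivariant_closed[OF equivariant_chain_mapD(1)[OF cm] cy])
    have dc: "?d (?c (frag_of ys)) = ?c (?d (frag_of ys))" by (rule equivariant_chain_mapD(2)[OF cm cy])
    \<comment> \<open>The rule for the action on tensors asks for some degree of its second factor.
      For \<open>q = 0\<close> the boundary is zero, a chain of any degree.\<close>
    have "\<exists>r. ?d (frag_of ys) \<in> chains ?B r"
      using R.bdry_closed[of "frag_of ys"] R.bdry_0[of "frag_of ys"] cy by (cases q) auto
    then obtain r where dy: "?d (frag_of ys) \<in> chains ?B r" ..
    have act: "res_act ?T (k, g) (frag_of (xs, ys)) = frag_tensor (res_act ?B g (frag_of xs)) (res_act ?B k (?c (frag_of ys)))"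
      using tot_act_tensor[OF cy, of k g "frag_of xs"] by simp
    have "res_bdry ?T (res_act ?T u (frag_of x))
      = frag_tensor (res_act ?B g (?d (frag_of xs))) (res_act ?B k (?c (frag_of ys)))
        + frag_cmul ((-1) ^ p) (frag_tensor (res_act ?B g (frag_of xs)) (res_act ?B k (?c (?d (frag_of ys)))))"
      unfolding u x(1) act tot_bdry_tensor[OF gx] R.bdry_act[OF cx car(2)] R.bdry_act[OF cyc car(1)] dc ..
    also have "\<dots> = res_act ?T u (res_bdry ?T (frag_of x))"
      using xs
      by (simp add: u x(1) tot_bdry_basis tot_act_tensor[OF cy, symmetric] tot_act_tensor[OF dy, symmetric]
          res_act_tot frag_extend_add frag_extend_cmul)
    finally show "res_bdry ?T (res_act ?T u (frag_of x)) = res_act ?T u (res_bdry ?T (frag_of x))" .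
  qed
qed

end

section \<open>Shuffles and simplices of a product\<close>

text \<open>For a shuffle, the blocks \<open>a = 0\<close>, \<open>n = p\<close> and
  \<open>a = p\<close>, \<open>n = q\<close> give the two coordinates of the lattice path after
  \<open>m\<close> steps.\<close>

definition step_count :: "(nat \<Rightarrow> nat) \<Rightarrow> nat \<Rightarrow> nat \<Rightarrow> nat \<Rightarrow> nat" where
  "step_count \<pi> a n m = card {i \<in> {a + 1..a + n}. \<pi> i \<le> m}"

text \<open>The lattice path of a shuffle: entry \<open>m\<close> is reached after the first \<open>m\<close> steps, and step
  \<open>\<pi> i\<close> is taken in the first factor iff \<open>i \<le> p\<close>.\<close>

definition shuffle_vertices :: "(nat \<Rightarrow> nat) \<Rightarrow> 'a list \<Rightarrow> 'b list \<Rightarrow> ('a \<times> 'b) list" where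
  "shuffle_vertices \<pi> xs zs = (let p = length xs - 1; q = length zs - 1 in
     map (\<lambda>m. (xs ! step_count \<pi> 0 p m, zs ! step_count \<pi> p q m)) [0..<Suc (p + q)])"

text \<open>The Eilenberg-Zilber product of two simplices given by their vertices.\<close>

definition shuffle_product :: "'a list \<Rightarrow> 'b list \<Rightarrow> (('a \<times> 'b) list \<Rightarrow>\<^sub>0 int)" where
  "shuffle_product xs zs = (if xs = [] \<or> zs = [] then 0
     else \<Sum>\<pi>\<in>shuffle_perms (length xs - 1) (length zs - 1).
       frag_cmul (sign \<pi>) (frag_of (shuffle_vertices \<pi> xs zs)))"

text \<open>The zero value absorbs the empty simplex arising as the boundary of a vertex, and it
  stands for the absent alternative when a lattice path has no step left in one factor.\<close>

lemma shuffle_product_Nil [simp]: "shuffle_product [] zs = 0" "shuffle_product xs [] = 0"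
  by (simp_all add: shuffle_product_def)

lemma finite_shuffle_perms: "finite (shuffle_perms p q)"
  by (rule finite_subset[OF _ finite_permutations[of "{1..p + q}"]]) (auto simp: shuffle_perms_def)

lemma shuffle_permsD:
  assumes "\<pi> \<in> shuffle_perms p q"
  shows "\<pi> permutes {1..p + q}"
    "1 \<le> i \<Longrightarrow> i < j \<Longrightarrow> j \<le> p \<Longrightarrow> \<pi> i < \<pi> j"
    "p + 1 \<le> i \<Longrightarrow> i < j \<Longrightarrow> j \<le> p + q \<Longrightarrow> \<pi> i < \<pi> j"
  using assms by (auto simp: shuffle_perms_def)

lemma length_shuffle_vertices:
  "xs \<noteq> [] \<Longrightarrow> zs \<noteq> [] \<Longrightarrow> length (shuffle_vertices \<pi> xs zs) = length xs + length zs - 1"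
  by (cases xs; cases zs) (simp_all add: shuffle_vertices_def Let_def)

lemma step_count_le: "step_count \<pi> a n m \<le> n"
proof -
  have "step_count \<pi> a n m \<le> card {a + 1..a + n}" unfolding step_count_def by (rule card_mono) auto
  then show ?thesis by simp
qed

lemma step_count_less: "0 < k \<Longrightarrow> n = k - 1 \<Longrightarrow> step_count \<pi> a n m < k"
  using step_count_le[of \<pi> a n m] by linarith

lemma step_count_full:
  assumes "\<And>i. a < i \<Longrightarrow> i \<le> a + n \<Longrightarrow> \<pi> i \<le> m"
  shows "step_count \<pi> a n m = n"
proof -
  have "{i \<in> {a + 1..a + n}. \<pi> i \<le> m} = {a + 1..a + n}" using assms by auto
  then show ?thesis by (simp add: step_count_def)
qed

lemma set_shuffle_vertices:
  assumes "xs \<noteq> []" "zs \<noteq> []"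
  shows "set (shuffle_vertices \<pi> xs zs) \<subseteq> set xs \<times> set zs"
  using assms by (auto simp: shuffle_vertices_def Let_def step_count_less)

lemma keys_shuffle_product:
  "Poly_Mapping.keys (shuffle_product xs zs)
    \<subseteq> {v. length v = length xs + length zs - 1 \<and> v \<noteq> [] \<and> set v \<subseteq> set xs \<times> set zs}"
proof (cases "xs = [] \<or> zs = []")
  case False
  let ?S = "{v. length v = length xs + length zs - 1 \<and> v \<noteq> [] \<and> set v \<subseteq> set xs \<times> set zs}"
  from False have ne: "xs \<noteq> []" "zs \<noteq> []" by auto
  have "shuffle_vertices \<pi> xs zs \<noteq> []" for \<pi> by (simp add: shuffle_vertices_def Let_def)
  then have "shuffle_vertices \<pi> xs zs \<in> ?S" for \<pi>
    using length_shuffle_vertices[OF ne, of \<pi>] set_shuffle_vertices[OF ne, of \<pi>] by simp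
  then have "Poly_Mapping.keys (frag_cmul (sign \<pi>) (frag_of (shuffle_vertices \<pi> xs zs))) \<subseteq> ?S" for \<pi>
    by (intro order.trans[OF keys_cmul]) (simp only: keys_frag_of insert_subset empty_subsetI simp_thms)
  then have "(\<Sum>\<pi>\<in>shuffle_perms (length xs - 1) (length zs - 1).
       frag_cmul (sign \<pi>) (frag_of (shuffle_vertices \<pi> xs zs))) \<in> carrier (free_Abelian_group ?S)"
    by (intro sum_closed_free_Abelian_group) (simp only: carrier_free_Abelian_group_iff)
  then show ?thesis using ne
    by (simp only: shuffle_product_def carrier_free_Abelian_group_iff if_False simp_thms)
qed auto

lemma shuffle_vertices_map:
  assumes "xs \<noteq> []" "zs \<noteq> []"
  shows "shuffle_vertices \<pi> (map f xs) (map g zs) = map (map_prod f g) (shuffle_vertices \<pi> xs zs)"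
  using assms by (simp add: shuffle_vertices_def Let_def step_count_less)

text \<open>Which positions a path visits depends only on the lengths of the lists. This naturality
  carries the group action through the Eilenberg-Zilber map.\<close>

lemma shuffle_product_map:
  "shuffle_product (map f xs) (map g zs) = frag_map (map (map_prod f g)) (shuffle_product xs zs)"
proof (cases "xs = [] \<or> zs = []")
  case False
  then show ?thesis
    by (simp add: shuffle_product_def shuffle_vertices_map frag_extend_sum[OF finite_shuffle_perms]
        frag_extend_cmul)
qed auto

section \<open>Splitting the shuffles by their last step\<close>

definition shift_cycle :: "nat \<Rightarrow> nat \<Rightarrow> nat \<Rightarrow> nat" where
  "shift_cycle p q i = (if i = p then p + q else if p < i \<and> i \<le> p + q then i - 1 else i)"

definition shift_cycle_inv :: "nat \<Rightarrow> nat \<Rightarrow> nat \<Rightarrow> nat" where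
  "shift_cycle_inv p q i = (if i = p + q then p else if p \<le> i \<and> i < p + q then i + 1 else i)"

lemma shift_cycle_inverse:
  "shift_cycle p q (shift_cycle_inv p q i) = i" "shift_cycle_inv p q (shift_cycle p q i) = i"
  by (auto simp: shift_cycle_def shift_cycle_inv_def)

lemma shift_cycle_permutes: "shift_cycle p q permutes {p..p + q}" "shift_cycle_inv p q permutes {p..p + q}"
proof -
  have image: "shift_cycle p q ` {p..p + q} \<subseteq> {p..p + q}" "shift_cycle_inv p q ` {p..p + q} \<subseteq> {p..p + q}"
    by (auto simp: shift_cycle_def shift_cycle_inv_def)
  have outside: "shift_cycle p q i = i" "shift_cycle_inv p q i = i" if "i \<notin> {p..p + q}" for i
    using that by (auto simp: shift_cycle_def shift_cycle_inv_def)
  show "shift_cycle p q permutes {p..p + q}"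
    by (rule bij_imp_permutes[OF bij_betw_byWitness[where f' = "shift_cycle_inv p q"]])
      (use image in \<open>simp_all add: shift_cycle_inverse outside\<close>)
  show "shift_cycle_inv p q permutes {p..p + q}"
    by (rule bij_imp_permutes[OF bij_betw_byWitness[where f' = "shift_cycle p q"]])
      (use image in \<open>simp_all add: shift_cycle_inverse outside\<close>)
qed

text \<open>The cycle is a product of \<open>q\<close> transpositions of neighbours, one for each
  step of the second factor that is passed.\<close>

lemma sign_shift_cycle: "sign (shift_cycle p q) = (-1) ^ q"
proof (induction q)
  case 0
  have "shift_cycle p 0 = id" by (auto simp: shift_cycle_def fun_eq_iff)
  then show ?case by (simp add: sign_id)
next
  case (Suc q)
  have "shift_cycle p (Suc q) = transpose (p + q) (p + Suc q) \<circ> shift_cycle p q"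
    by (auto simp: shift_cycle_def fun_eq_iff transpose_def)
  moreover have "permutation (shift_cycle p q)"
    using shift_cycle_permutes permutation_permutes by blast
  ultimately show ?case
    using Suc sign_compose[OF permutation_swap_id[of "p + q" "p + Suc q"], of "shift_cycle p q"]
    by (simp add: sign_swap_id del: comp_apply)
qed

lemma shuffle_perms_last_right:
  assumes "0 < q"
  shows "{\<pi> \<in> shuffle_perms p q. \<pi> (p + q) = p + q} = shuffle_perms p (q - 1)"
proof (intro equalityI subsetI)
  fix \<pi> assume "\<pi> \<in> {\<pi> \<in> shuffle_perms p q. \<pi> (p + q) = p + q}"
  then have \<pi>: "\<pi> \<in> shuffle_perms p q" "\<pi> (p + q) = p + q" by auto
  have "\<pi> permutes {1..p + (q - 1)}"
  proof (rule permutes_superset[OF shuffle_permsD(1)[OF \<pi>(1)]])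
    fix x assume "x \<in> {1..p + q} - {1..p + (q - 1)}"
    then have "x = p + q" using assms by auto
    then show "\<pi> x = x" using \<pi>(2) by simp
  qed
  then show "\<pi> \<in> shuffle_perms p (q - 1)"
    using shuffle_permsD(2,3)[OF \<pi>(1)] unfolding shuffle_perms_def by fastforce
next
  fix \<pi> assume \<pi>: "\<pi> \<in> shuffle_perms p (q - 1)"
  have fixed: "\<pi> (p + q) = p + q"
    using assms by (intro permutes_not_in[OF shuffle_permsD(1)[OF \<pi>]]) auto
  have less: "\<pi> i < p + q" if "1 \<le> i" "i < p + q" for i
  proof -
    have "i \<in> {1..p + (q - 1)}" using that assms by auto
    then have "\<pi> i \<in> {1..p + (q - 1)}" using permutes_in_image[OF shuffle_permsD(1)[OF \<pi>]] by blast
    then show ?thesis using assms by auto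
  qed
  have "\<pi> permutes {1..p + q}" by (rule permutes_subset[OF shuffle_permsD(1)[OF \<pi>]]) auto
  moreover have "\<pi> i < \<pi> j" if "p + 1 \<le> i" "i < j" "j \<le> p + q" for i j
  proof (cases "j = p + q")
    case True
    then show ?thesis using less[of i] that fixed by simp
  next
    case False
    then show ?thesis using shuffle_permsD(3)[OF \<pi>, of i j] that by simp
  qed
  ultimately show "\<pi> \<in> {\<pi> \<in> shuffle_perms p q. \<pi> (p + q) = p + q}"
    using shuffle_permsD(2)[OF \<pi>] fixed unfolding shuffle_perms_def by blast
qed

text \<open>Composition with the cycle inserts a new \<open>p\<close>-th step with the largest value
  \<open>p + q\<close> and moves the indices of the second block up by one. The value
  \<open>p + q\<close> is free because \<open>\<pi>\<close> fixes every point outside its own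
  range.\<close>

lemma shuffle_perms_comp_shift_cycle:
  assumes "0 < p" and \<pi>: "\<pi> \<in> shuffle_perms (p - 1) q"
  shows "\<pi> \<circ> shift_cycle p q \<in> shuffle_perms p q" and "\<pi> (p + q) = p + q"
proof -
  show fixed: "\<pi> (p + q) = p + q"
    using assms(1) by (intro permutes_not_in[OF shuffle_permsD(1)[OF \<pi>]]) auto
  have less: "\<pi> i < p + q" if "1 \<le> i" "i < p + q" for i
  proof -
    have "i \<in> {1..(p - 1) + q}" using that assms by auto
    then have "\<pi> i \<in> {1..(p - 1) + q}" using permutes_in_image[OF shuffle_permsD(1)[OF \<pi>]] by blast
    then show ?thesis using assms by auto
  qed
  have "\<pi> permutes {1..p + q}" by (rule permutes_subset[OF shuffle_permsD(1)[OF \<pi>]]) auto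
  moreover have "shift_cycle p q permutes {1..p + q}"
    by (rule permutes_subset[OF shift_cycle_permutes(1)]) (use assms in auto)
  ultimately have "\<pi> \<circ> shift_cycle p q permutes {1..p + q}" using permutes_compose by blast
  moreover have "(\<pi> \<circ> shift_cycle p q) i < (\<pi> \<circ> shift_cycle p q) j" if "1 \<le> i" "i < j" "j \<le> p" for i j
  proof (cases "j = p")
    case True
    then show ?thesis using that less[of i] fixed by (simp add: shift_cycle_def)
  next
    case False
    then show ?thesis using that shuffle_permsD(2)[OF \<pi>, of i j] by (simp add: shift_cycle_def)
  qed
  moreover have "(\<pi> \<circ> shift_cycle p q) i < (\<pi> \<circ> shift_cycle p q) j" if "p + 1 \<le> i" "i < j" "j \<le> p + q" for i j
    using that assms(1) shuffle_permsD(3)[OF \<pi>, of "i - 1" "j - 1"] by (simp add: shift_cycle_def)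
  ultimately show "\<pi> \<circ> shift_cycle p q \<in> shuffle_perms p q" unfolding shuffle_perms_def by blast
qed

lemma shuffle_perms_comp_shift_cycle_inv:
  assumes "0 < p" and \<pi>: "\<pi> \<in> shuffle_perms p q" and "\<pi> p = p + q"
  shows "\<pi> \<circ> shift_cycle_inv p q \<in> shuffle_perms (p - 1) q"
proof -
  have "shift_cycle_inv p q permutes {1..p + q}"
    by (rule permutes_subset[OF shift_cycle_permutes(2)]) (use assms in auto)
  then have "\<pi> \<circ> shift_cycle_inv p q permutes {1..p + q}"
    using permutes_compose shuffle_permsD(1)[OF \<pi>] by blast
  then have "\<pi> \<circ> shift_cycle_inv p q permutes {1..(p - 1) + q}"
  proof (rule permutes_superset)
    fix x assume "x \<in> {1..p + q} - {1..(p - 1) + q}"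
    then have "x = p + q" using assms by auto
    then show "(\<pi> \<circ> shift_cycle_inv p q) x = x" using assms(3) by (simp add: shift_cycle_inv_def)
  qed
  moreover have "(\<pi> \<circ> shift_cycle_inv p q) i < (\<pi> \<circ> shift_cycle_inv p q) j"
    if "1 \<le> i" "i < j" "j \<le> p - 1" for i j
    using that shuffle_permsD(2)[OF \<pi>, of i j] by (auto simp: shift_cycle_inv_def)
  moreover have "(\<pi> \<circ> shift_cycle_inv p q) i < (\<pi> \<circ> shift_cycle_inv p q) j"
    if "(p - 1) + 1 \<le> i" "i < j" "j \<le> (p - 1) + q" for i j
    using that assms(1) shuffle_permsD(3)[OF \<pi>, of "i + 1" "j + 1"] by (auto simp: shift_cycle_inv_def)
  ultimately show ?thesis unfolding shuffle_perms_def by blast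
qed

text \<open>A shuffle increases on each block, so the largest value is taken at the end of one of
  them.\<close>

lemma shuffle_perms_cases:
  assumes "\<pi> \<in> shuffle_perms p q" "0 < p + q"
  shows "(0 < p \<and> \<pi> p = p + q) \<or> (0 < q \<and> \<pi> (p + q) = p + q)"
proof -
  note perm = shuffle_permsD(1)[OF assms(1)]
  have "p + q \<in> \<pi> ` {1..p + q}" unfolding permutes_image[OF perm] using assms(2) by (simp add: Suc_le_eq)
  then obtain i where i: "i \<in> {1..p + q}" "\<pi> i = p + q" by auto
  have le: "\<pi> j \<le> p + q" if "j \<in> {1..p + q}" for j using permutes_in_image[OF perm] that by auto
  show ?thesis
  proof (cases "i \<le> p")
    case True
    then have "i = p" using shuffle_permsD(2)[OF assms(1), of i p] le[of p] i by fastforce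
    then show ?thesis using i by auto
  next
    case False
    then have "i = p + q" using shuffle_permsD(3)[OF assms(1), of i "p + q"] le[of "p + q"] i by fastforce
    then show ?thesis using i False by auto
  qed
qed

text \<open>The two sums are over the shuffles whose last step is taken in the first, respectively in the
  second, factor.\<close>

lemma sum_shuffle_perms:
  assumes "0 < p + q"
  shows "(\<Sum>\<pi>\<in>shuffle_perms p q. f \<pi>)
    = (if p = 0 then 0 else \<Sum>\<pi>\<in>shuffle_perms (p - 1) q. f (\<pi> \<circ> shift_cycle p q))
      + (if q = 0 then 0 else \<Sum>\<pi>\<in>shuffle_perms p (q - 1). f \<pi>)"
proof -
  let ?A = "{\<pi> \<in> shuffle_perms p q. 0 < p \<and> \<pi> p = p + q}"
  let ?B = "{\<pi> \<in> shuffle_perms p q. 0 < q \<and> \<pi> (p + q) = p + q}"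
  have "inj \<pi>" if "\<pi> \<in> shuffle_perms p q" for \<pi> using shuffle_permsD(1)[OF that] by (rule permutes_inj)
  then have "\<pi> p \<noteq> \<pi> (p + q)" if "\<pi> \<in> shuffle_perms p q" "0 < q" for \<pi>
    using that injD[of \<pi> p "p + q"] by auto
  then have "\<pi> \<notin> ?B" if "\<pi> \<in> ?A" for \<pi> using that by (metis (mono_tags, lifting) mem_Collect_eq)
  then have "?A \<inter> ?B = {}" by blast
  moreover have "shuffle_perms p q = ?A \<union> ?B" using shuffle_perms_cases[OF _ assms] by blast
  ultimately have "(\<Sum>\<pi>\<in>shuffle_perms p q. f \<pi>) = sum f ?A + sum f ?B"
    using sum.union_disjoint[of ?A ?B f] finite_shuffle_perms[of p q] by simp
  moreover have "sum f ?B = (if q = 0 then 0 else \<Sum>\<pi>\<in>shuffle_perms p (q - 1). f \<pi>)"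
    using shuffle_perms_last_right[of q p] by auto
  moreover have "sum f ?A = (\<Sum>\<pi>\<in>shuffle_perms (p - 1) q. f (\<pi> \<circ> shift_cycle p q))" if p: "0 < p"
  proof -
    have canc: "(\<pi> \<circ> shift_cycle_inv p q) \<circ> shift_cycle p q = \<pi>" "(\<pi> \<circ> shift_cycle p q) \<circ> shift_cycle_inv p q = \<pi>"
      for \<pi> :: "nat \<Rightarrow> nat" by (simp_all add: fun_eq_iff shift_cycle_inverse)
    have "(\<pi> \<circ> shift_cycle p q) p = \<pi> (p + q)" for \<pi> :: "nat \<Rightarrow> nat" by (simp add: shift_cycle_def)
    note val = this
    show ?thesis
    proof (rule sum.reindex_bij_witness[where j = "\<lambda>\<pi>. \<pi> \<circ> shift_cycle_inv p q" and i = "\<lambda>\<pi>. \<pi> \<circ> shift_cycle p q"])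
      fix \<pi> assume "\<pi> \<in> ?A"
      then show "\<pi> \<circ> shift_cycle_inv p q \<in> shuffle_perms (p - 1) q"
        using shuffle_perms_comp_shift_cycle_inv by blast
    next
      fix \<pi> assume "\<pi> \<in> shuffle_perms (p - 1) q"
      then show "\<pi> \<circ> shift_cycle p q \<in> ?A"
        using p shuffle_perms_comp_shift_cycle[OF p] val unfolding mem_Collect_eq by metis
    qed (simp_all only: canc)
  qed
  ultimately show ?thesis by auto
qed

text \<open>The common frame for both kinds of last step: at all earlier times the shortened path
  \<rho> visits the same vertices, and at the final time both coordinates have reached their
  ends.\<close>

lemma shuffle_vertices_snocI:
  assumes "length a + length b = Suc (length xs - 1 + (length zs - 1))"
    and "\<And>m. m < length a + length b \<Longrightarrow> (a @ [x]) ! step_count \<pi> 0 (length a) m = xs ! step_count \<rho> 0 (length xs - 1) m"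
    and "\<And>m. m < length a + length b \<Longrightarrow>
      (b @ [z]) ! step_count \<pi> (length a) (length b) m = zs ! step_count \<rho> (length xs - 1) (length zs - 1) m"
    and "\<pi> permutes {1..length a + length b}"
  shows "shuffle_vertices \<pi> (a @ [x]) (b @ [z]) = shuffle_vertices \<rho> xs zs @ [(x, z)]"
proof -
  let ?f = "\<lambda>m. ((a @ [x]) ! step_count \<pi> 0 (length a) m, (b @ [z]) ! step_count \<pi> (length a) (length b) m)"
  let ?N = "length a + length b"
  have le: "\<pi> i \<le> ?N" if "1 \<le> i" "i \<le> ?N" for i
    using permutes_in_image[OF assms(4), of i] that by auto
  have "step_count \<pi> 0 (length a) ?N = length a" "step_count \<pi> (length a) (length b) ?N = length b"
    by (rule step_count_full; use le in simp)+
  then have last: "?f ?N = (x, z)" by simp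
  have "shuffle_vertices \<pi> (a @ [x]) (b @ [z]) = map ?f [0..<Suc ?N]"
    by (simp add: shuffle_vertices_def Let_def)
  also have "\<dots> = map ?f [0..<?N] @ [(x, z)]" using last by simp
  also have "map ?f [0..<?N] = shuffle_vertices \<rho> xs zs"
    unfolding shuffle_vertices_def Let_def assms(1)[symmetric]
    by (rule map_cong) (simp_all add: assms(2,3))
  finally show ?thesis .
qed

text \<open>Before the final time the inserted step has not happened, so the count for the first
  block is the old one. The second block is the old one shifted by one index, which
  \<open>Suc\<close> makes a bijection.\<close>

lemma shuffle_vertices_snoc_left:
  assumes "a \<noteq> []" and \<pi>: "\<pi> \<in> shuffle_perms (length a - 1) (length b)"
  shows "shuffle_vertices (\<pi> \<circ> shift_cycle (length a) (length b)) (a @ [x]) (b @ [z])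
    = shuffle_vertices \<pi> a (b @ [z]) @ [(x, z)]"
proof (rule shuffle_vertices_snocI)
  let ?p = "length a" and ?q = "length b"
  let ?c = "shift_cycle ?p ?q"
  have p: "0 < ?p" using assms(1) by simp
  note \<pi>c = shuffle_perms_comp_shift_cycle[OF p \<pi>]
  show "length a + length b = Suc (length a - 1 + (length (b @ [z]) - 1))" using p by simp
  show "\<pi> \<circ> ?c permutes {1..?p + ?q}" by (rule shuffle_permsD(1)[OF \<pi>c(1)])
  fix m assume m: "m < ?p + ?q"
  have "{i \<in> {0 + 1..0 + ?p}. (\<pi> \<circ> ?c) i \<le> m} = {i \<in> {0 + 1..0 + (?p - 1)}. \<pi> i \<le> m}"
  proof (intro equalityI subsetI)
    fix i assume i: "i \<in> {i \<in> {0 + 1..0 + ?p}. (\<pi> \<circ> ?c) i \<le> m}"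
    then have "i \<noteq> ?p" using m \<pi>c(2) by (auto simp: shift_cycle_def)
    then show "i \<in> {i \<in> {0 + 1..0 + (?p - 1)}. \<pi> i \<le> m}" using i by (auto simp: shift_cycle_def)
  qed (use p in \<open>auto simp: shift_cycle_def\<close>)
  then have "step_count (\<pi> \<circ> ?c) 0 ?p m = step_count \<pi> 0 (?p - 1) m" by (simp only: step_count_def)
  then show "(a @ [x]) ! step_count (\<pi> \<circ> ?c) 0 ?p m = a ! step_count \<pi> 0 (?p - 1) m"
    using p by (simp add: nth_append step_count_less del: comp_apply)
  have "{j \<in> {?p + 1..?p + ?q}. (\<pi> \<circ> ?c) j \<le> m} = Suc ` {j \<in> {?p - 1 + 1..?p - 1 + ?q}. \<pi> j \<le> m}"
  proof (intro equalityI subsetI)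
    fix j assume "j \<in> {j \<in> {?p + 1..?p + ?q}. (\<pi> \<circ> ?c) j \<le> m}"
    then have "j = Suc (j - 1)" "j - 1 \<in> {j \<in> {?p - 1 + 1..?p - 1 + ?q}. \<pi> j \<le> m}"
      using p by (auto simp: shift_cycle_def)
    then show "j \<in> Suc ` {j \<in> {?p - 1 + 1..?p - 1 + ?q}. \<pi> j \<le> m}" by blast
  next
    fix j assume "j \<in> Suc ` {j \<in> {?p - 1 + 1..?p - 1 + ?q}. \<pi> j \<le> m}"
    then obtain i where i: "j = Suc i" "i \<in> {?p - 1 + 1..?p - 1 + ?q}" "\<pi> i \<le> m" by blast
    then have "?p \<le> i" "i < ?p + ?q" using p unfolding atLeastAtMost_iff by linarith+
    then show "j \<in> {j \<in> {?p + 1..?p + ?q}. (\<pi> \<circ> ?c) j \<le> m}" using i by (simp add: shift_cycle_def)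
  qed
  then have "step_count (\<pi> \<circ> ?c) ?p ?q m = step_count \<pi> (?p - 1) ?q m"
    unfolding step_count_def by (simp only: card_image[OF inj_Suc[THEN inj_on_subset[OF _ subset_UNIV]]])
  then show "(b @ [z]) ! step_count (\<pi> \<circ> ?c) ?p ?q m = (b @ [z]) ! step_count \<pi> (?p - 1) (length (b @ [z]) - 1) m"
    by simp
qed

lemma shuffle_vertices_snoc_right:
  assumes "b \<noteq> []" and \<pi>: "\<pi> \<in> shuffle_perms (length a) (length b - 1)"
  shows "shuffle_vertices \<pi> (a @ [x]) (b @ [z]) = shuffle_vertices \<pi> (a @ [x]) b @ [(x, z)]"
proof (rule shuffle_vertices_snocI)
  let ?p = "length a" and ?q = "length b"
  have q: "0 < ?q" using assms(1) by simp
  have \<pi>': "\<pi> \<in> shuffle_perms ?p ?q" "\<pi> (?p + ?q) = ?p + ?q"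
    using shuffle_perms_last_right[OF q, of ?p] \<pi> by auto
  show "length a + length b = Suc (length (a @ [x]) - 1 + (length b - 1))" using q by simp
  show "\<pi> permutes {1..?p + ?q}" by (rule shuffle_permsD(1)[OF \<pi>'(1)])
  fix m assume m: "m < ?p + ?q"
  show "(a @ [x]) ! step_count \<pi> 0 ?p m = (a @ [x]) ! step_count \<pi> 0 (length (a @ [x]) - 1) m" by simp
  have "j \<le> ?p + (?q - 1)" if "j \<le> ?p + ?q" "\<pi> j \<le> m" for j
    using that m \<pi>'(2) q by (cases "j = ?p + ?q") auto
  then have "{j \<in> {?p + 1..?p + ?q}. \<pi> j \<le> m} = {j \<in> {?p + 1..?p + (?q - 1)}. \<pi> j \<le> m}" by fastforce
  then have "step_count \<pi> ?p ?q m = step_count \<pi> ?p (?q - 1) m" by (simp only: step_count_def)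
  then show "(b @ [z]) ! step_count \<pi> ?p ?q m = b ! step_count \<pi> (length (a @ [x]) - 1) (?q - 1) m"
    using q by (simp add: nth_append step_count_less)
qed

text \<open>Every path enters its final corner by a step in the first or in the second factor. In
  the first case the sign records that this step is moved past all steps of the second factor. The
  case of two empty prefixes is excluded because its path has no step at all.\<close>

lemma shuffle_product_snoc:
  assumes "a \<noteq> [] \<or> b \<noteq> []"
  shows "shuffle_product (a @ [x]) (b @ [z]) = frag_extend (\<lambda>v. frag_of (v @ [(x, z)]))
    (frag_cmul ((-1) ^ length b) (shuffle_product a (b @ [z])) + shuffle_product (a @ [x]) b)"
proof -
  let ?p = "length a" and ?q = "length b"
  let ?S = "frag_extend (\<lambda>v. frag_of (v @ [(x, z)]))"
  let ?f = "\<lambda>\<pi>. frag_cmul (sign \<pi>) (frag_of (shuffle_vertices \<pi> (a @ [x]) (b @ [z])))"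
  have "(\<Sum>\<pi>\<in>shuffle_perms (?p - 1) ?q. ?f (\<pi> \<circ> shift_cycle ?p ?q))
    = frag_cmul ((-1) ^ ?q) (?S (shuffle_product a (b @ [z])))" if "a \<noteq> []"
  proof -
    have "sign (\<pi> \<circ> shift_cycle ?p ?q) = (-1) ^ ?q * sign \<pi>" if "\<pi> \<in> shuffle_perms (?p - 1) ?q" for \<pi>
    proof -
      have "permutation \<pi>" using shuffle_permsD(1)[OF that] permutation_permutes by blast
      moreover have "permutation (shift_cycle ?p ?q)" using shift_cycle_permutes(1) permutation_permutes by blast
      ultimately show ?thesis by (simp only: sign_compose sign_shift_cycle mult.commute)
    qed
    then have "(\<Sum>\<pi>\<in>shuffle_perms (?p - 1) ?q. ?f (\<pi> \<circ> shift_cycle ?p ?q))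
      = (\<Sum>\<pi>\<in>shuffle_perms (?p - 1) ?q. frag_cmul ((-1) ^ ?q) (frag_cmul (sign \<pi>) (?S (frag_of (shuffle_vertices \<pi> a (b @ [z]))))))"
      by (intro sum.cong) (simp_all add: shuffle_vertices_snoc_left[OF that])
    then show ?thesis using that
      by (simp add: shuffle_product_def frag_extend_sum[OF finite_shuffle_perms] frag_extend_cmul frag_cmul_sum comp_def)
  qed
  moreover have "(\<Sum>\<pi>\<in>shuffle_perms ?p (?q - 1). ?f \<pi>) = ?S (shuffle_product (a @ [x]) b)" if "b \<noteq> []"
  proof -
    have "(\<Sum>\<pi>\<in>shuffle_perms ?p (?q - 1). ?f \<pi>)
      = (\<Sum>\<pi>\<in>shuffle_perms ?p (?q - 1). frag_cmul (sign \<pi>) (?S (frag_of (shuffle_vertices \<pi> (a @ [x]) b))))"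
      by (intro sum.cong) (simp_all add: shuffle_vertices_snoc_right[OF that])
    then show ?thesis using that
      by (simp add: shuffle_product_def frag_extend_sum[OF finite_shuffle_perms] frag_extend_cmul comp_def)
  qed
  moreover have "shuffle_product (a @ [x]) (b @ [z]) = sum ?f (shuffle_perms ?p ?q)"
    by (simp add: shuffle_product_def)
  ultimately show ?thesis
    using assms by (cases "a = []"; cases "b = []") (simp_all add: sum_shuffle_perms frag_extend_add frag_extend_cmul)
qed

lemma simplex_bdry_snoc_chain:
  assumes "Poly_Mapping.keys c \<subseteq> {v. length v = n}"
  shows "frag_extend simplex_bdry (frag_extend (\<lambda>v. frag_of (v @ [w])) c)
    = frag_extend (\<lambda>v. frag_of (v @ [w])) (frag_extend simplex_bdry c) + frag_cmul ((-1) ^ n) c"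
  using assms
  by (induction c rule: frag_induction)
    (auto simp: frag_extend_diff simplex_bdry_snoc frag_cmul_diff_distrib2)

lemma shuffle_product_singleton: "shuffle_product [x] [z] = frag_of [(x, z)]"
proof -
  have "shuffle_perms 0 0 = {id}" by (auto simp: shuffle_perms_def)
  moreover have "step_count \<pi> a 0 m = 0" for \<pi> a m using step_count_le[of \<pi> a 0 m] by simp
  ultimately show ?thesis by (simp add: shuffle_product_def shuffle_vertices_def sign_id)
qed

text \<open>The Leibniz rule for the Eilenberg-Zilber product. The length condition excludes two
  single vertices: their product has the empty list as boundary, while both terms on the right are
  zero.\<close>

theorem shuffle_product_bdry:
  assumes "xs \<noteq> []" "zs \<noteq> []" "2 < length xs + length zs"
  shows "frag_extend simplex_bdry (shuffle_product xs zs)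
    = frag_extend (\<lambda>xs'. shuffle_product xs' zs) (simplex_bdry xs)
      + frag_cmul ((-1) ^ (length xs - 1)) (frag_extend (shuffle_product xs) (simplex_bdry zs))"
  using assms
proof (induction "length xs + length zs" arbitrary: xs zs rule: less_induct)
  case less
  obtain a x where xs: "xs = a @ [x]" using less.prems(1) by (metis append_butlast_last_id)
  obtain b z where zs: "zs = b @ [z]" using less.prems(2) by (metis append_butlast_last_id)
  let ?P = shuffle_product and ?d = "frag_extend simplex_bdry"
  let ?S = "frag_extend (\<lambda>v. frag_of (v @ [(x, z)]))"
  let ?p = "length a" and ?q = "length b"
  have pq: "a \<noteq> [] \<or> b \<noteq> []" using less.prems(3) xs zs by auto
  note P = shuffle_product_snoc[OF pq, of x z]
  \<comment> \<open>For an edge against a vertex, taking faces would lead the recursion to two empty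
    prefixes, where \<open>shuffle_product_snoc\<close> does not apply. These two cases are computed
    directly.\<close>
  consider "?p = 1" "?q = 0" | "?p = 0" "?q = 1" | "2 \<le> ?p + ?q" using pq by (cases a; cases b) (auto simp: Suc_le_eq)
  then show ?case
  proof cases
    case 1
    then obtain a0 where "a = [a0]" "b = []" by (auto simp: length_Suc_conv)
    then show ?thesis using P
      by (simp add: xs zs shuffle_product_singleton frag_extend_diff)
  next
    case 2
    then obtain b0 where "b = [b0]" "a = []" by (auto simp: length_Suc_conv)
    then show ?thesis using P
      by (simp add: xs zs shuffle_product_singleton frag_extend_diff)
  next
    case 3
    define s t where "s = (-1 :: int) ^ ?p" and "t = (-1 :: int) ^ ?q"
    let ?Sx = "frag_extend (\<lambda>v. frag_of (v @ [x]))" and ?Sz = "frag_extend (\<lambda>v. frag_of (v @ [z]))"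
    let ?A = "frag_extend (\<lambda>a'. ?P a' (b @ [z])) (simplex_bdry a)"
    let ?B = "frag_extend (?P a) (?Sz (simplex_bdry b))"
    let ?D = "frag_extend (\<lambda>a'. ?P a' b) (?Sx (simplex_bdry a))"
    let ?E = "frag_extend (?P (a @ [x])) (simplex_bdry b)"
    \<comment> \<open>The coefficient is \<open>- s\<close> because \<open>a\<close> spans a simplex
      of one dimension less than \<open>xs\<close>. If \<open>a\<close> is empty, both sides
      vanish.\<close>
    have IH1: "?d (?P a (b @ [z])) = ?A - frag_cmul s (?B + frag_cmul t (?P a b))"
    proof (cases "a = []")
      case True
      then show ?thesis by (simp add: frag_extend_eq_0)
    next
      case False
      then have "(-1) ^ (length a - 1) = - s" by (cases a) (simp_all add: s_def)
      then show ?thesis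
        using less.hyps[of a "b @ [z]"] 3 False xs zs
        by (simp add: simplex_bdry_snoc frag_extend_add frag_extend_cmul t_def flip: minus_frag_cmul)
    qed
    have IH2: "?d (?P (a @ [x]) b) = ?D + frag_cmul s (?P a b) + frag_cmul s ?E"
    proof (cases "b = []")
      case True
      then show ?thesis by (simp add: frag_extend_eq_0)
    next
      case False
      then show ?thesis
        using less.hyps[of "a @ [x]" b] 3 xs zs
        by (simp add: simplex_bdry_snoc frag_extend_add frag_extend_cmul s_def)
    qed
    have G1: "frag_extend (\<lambda>a'. ?P a' (b @ [z])) (?Sx (simplex_bdry a)) = ?S (frag_cmul t ?A + ?D)"
    proof -
      have "frag_extend (\<lambda>a'. ?P a' (b @ [z])) (?Sx c)
        = ?S (frag_cmul t (frag_extend (\<lambda>a'. ?P a' (b @ [z])) c) + frag_extend (\<lambda>a'. ?P a' b) (?Sx c))"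
        if "Poly_Mapping.keys c \<subseteq> {a'. a' \<noteq> [] \<or> b \<noteq> []}" for c
        using that
      proof (induction c rule: frag_induction)
        case (one a')
        then show ?case using shuffle_product_snoc[of a' b x z] by (simp add: t_def)
      next
        case (diff c d)
        then show ?case by (simp add: frag_extend_diff frag_extend_add frag_cmul_diff_distrib2)
      qed simp
      moreover have "Poly_Mapping.keys (simplex_bdry a) \<subseteq> {a'. a' \<noteq> [] \<or> b \<noteq> []}"
        using keys_simplex_bdry[of a] 3 by (cases b) auto
      ultimately show ?thesis by blast
    qed
    have G2: "frag_extend (?P (a @ [x])) (?Sz (simplex_bdry b)) = ?S (?E - frag_cmul t ?B)"
    proof -
      have "frag_extend (?P (a @ [x])) (?Sz c)
        = ?S (frag_extend (?P (a @ [x])) c - frag_cmul t (frag_extend (?P a) (?Sz c)))"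
        if "Poly_Mapping.keys c \<subseteq> {b'. (a \<noteq> [] \<or> b' \<noteq> []) \<and> Suc (length b') = ?q}" for c
        using that
      proof (induction c rule: frag_induction)
        case (one b')
        \<comment> \<open>A face of \<open>b\<close> has one vertex less, so the recursion sign
          changes from \<open>t\<close> to its negative.\<close>
        then have "(-1) ^ length b' = - t" unfolding t_def by (metis (mono_tags, lifting) mem_Collect_eq minus_minus mult_minus1 power_Suc)
        then show ?case using shuffle_product_snoc[of a b' x z] one by (simp flip: minus_frag_cmul)
      next
        case (diff c d)
        then show ?case by (simp add: frag_extend_diff frag_extend_add frag_cmul_diff_distrib2)
      qed simp
      moreover have "Poly_Mapping.keys (simplex_bdry b) \<subseteq> {b'. (a \<noteq> [] \<or> b' \<noteq> []) \<and> Suc (length b') = ?q}"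
        using keys_simplex_bdry[of b] 3 by (cases b; cases a) auto
      ultimately show ?thesis by blast
    qed
    have keys: "Poly_Mapping.keys (frag_cmul t (?P a (b @ [z])) + ?P (a @ [x]) b) \<subseteq> {v. length v = ?p + ?q}"
      using keys_shuffle_product[of a "b @ [z]"] keys_shuffle_product[of "a @ [x]" b]
        keys_add[of "frag_cmul t (?P a (b @ [z]))" "?P (a @ [x]) b"] keys_cmul[of t "?P a (b @ [z])"]
      by fastforce
    \<comment> \<open>Inside \<open>?S\<close> the term \<open>?P a b\<close> occurs with
      coefficient \<open>- s * t * t\<close> from paths ending with a second-factor step before a
      first-factor one, and with \<open>s\<close> from the other order. Since \<open>t\<close>
      squares to one, these cancel, and what is left agrees with \<open>R\<close> term by
      term.\<close>
    have L: "?d (?P xs zs) = ?S (frag_cmul t (?A - frag_cmul s (?B + frag_cmul t (?P a b)))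
        + (?D + frag_cmul s (?P a b) + frag_cmul s ?E))
      + frag_cmul (s * t) (frag_cmul t (?P a (b @ [z])) + ?P (a @ [x]) b)"
    proof -
      have "?d (frag_cmul t (?P a (b @ [z])) + ?P (a @ [x]) b)
        = frag_cmul t (?A - frag_cmul s (?B + frag_cmul t (?P a b))) + (?D + frag_cmul s (?P a b) + frag_cmul s ?E)"
        unfolding frag_extend_add frag_extend_cmul IH1 IH2 ..
      then show ?thesis
        unfolding xs zs P t_def[symmetric] simplex_bdry_snoc_chain[OF keys]
        by (simp only: power_add s_def t_def)
    qed
    have R: "frag_extend (\<lambda>xs'. ?P xs' zs) (simplex_bdry xs) + frag_cmul ((-1) ^ (length xs - 1)) (frag_extend (?P xs) (simplex_bdry zs))
      = ?S (frag_cmul t ?A + ?D) + frag_cmul s (?P a (b @ [z]))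
        + frag_cmul s (?S (?E - frag_cmul t ?B) + frag_cmul t (?P (a @ [x]) b))"
      unfolding xs zs simplex_bdry_snoc frag_extend_add frag_extend_cmul G1 G2
      by (simp add: s_def t_def)
    have "s = 1 \<or> s = -1" "t = 1 \<or> t = -1" unfolding s_def t_def by (metis neg_one_even_power neg_one_odd_power)+
    then show ?thesis unfolding L R
      by (elim disjE) (simp_all add: frag_extend_add frag_extend_diff frag_extend_minus)
  qed
qed

section \<open>The shuffle homomorphism in homogeneous coordinates\<close>

definition product_bar :: "('a, 'm) monoid_scheme \<Rightarrow> ('a \<times> 'a) list \<Rightarrow> 'a list" where
  "product_bar K v = bar_of_vertices K (map (\<lambda>(x, z). x \<otimes>\<^bsub>K\<^esub> z) v)"

text \<open>The permutation maps the indices counted in the two blocks bijectively onto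
  \<open>{1..m}\<close>.\<close>

lemma step_count_total:
  assumes \<pi>: "\<pi> \<in> shuffle_perms p q" and "m \<le> p + q"
  shows "step_count \<pi> 0 p m + step_count \<pi> p q m = m"
proof -
  note perm = shuffle_permsD(1)[OF \<pi>]
  let ?X = "{i \<in> {0 + 1..0 + p}. \<pi> i \<le> m}" and ?Y = "{i \<in> {p + 1..p + q}. \<pi> i \<le> m}"
  have "\<pi> ` (?X \<union> ?Y) = {1..m}"
  proof (intro equalityI subsetI)
    fix k assume "k \<in> \<pi> ` (?X \<union> ?Y)"
    then obtain i where "i \<in> ?X \<union> ?Y" "k = \<pi> i" by blast
    then have "i \<in> {1..p + q}" "k = \<pi> i" "\<pi> i \<le> m" by auto
    then show "k \<in> {1..m}" using permutes_in_image[OF perm, of i] by auto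
  next
    fix k assume k: "k \<in> {1..m}"
    then have "k \<in> \<pi> ` {1..p + q}" unfolding permutes_image[OF perm] using assms(2) by auto
    then show "k \<in> \<pi> ` (?X \<union> ?Y)" using k by fastforce
  qed
  then have "card (?X \<union> ?Y) = m"
    using card_image[OF inj_on_subset[OF permutes_inj[OF perm] subset_UNIV], of "?X \<union> ?Y"] by simp
  moreover have "card (?X \<union> ?Y) = card ?X + card ?Y" by (rule card_Un_disjoint) auto
  ultimately show ?thesis by (simp only: step_count_def)
qed

text \<open>Monotonicity makes the indices with small values an initial segment of the block, and
  the index \<open>k\<close> of the step taken at time \<open>m + 1\<close> marks its end.\<close>

lemma step_count_initial:
  assumes mono: "\<And>i j. a < i \<Longrightarrow> i < j \<Longrightarrow> j \<le> a + n \<Longrightarrow> \<pi> i < (\<pi> j :: nat)"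
    and k: "a < k" "k \<le> a + n" "\<pi> k = Suc m"
  shows "step_count \<pi> a n m = k - a - 1" "step_count \<pi> a n (Suc m) = k - a"
proof -
  have "\<pi> i \<le> m \<longleftrightarrow> i < k" "\<pi> i \<le> Suc m \<longleftrightarrow> i \<le> k" if "a < i" "i \<le> a + n" for i
    using mono[of i k] mono[of k i] that k by (cases i k rule: linorder_cases; force)+
  then have "{i \<in> {a + 1..a + n}. \<pi> i \<le> m} = {a + 1..<k}" "{i \<in> {a + 1..a + n}. \<pi> i \<le> Suc m} = {a + 1..k}"
    using k by auto
  then show "step_count \<pi> a n m = k - a - 1" "step_count \<pi> a n (Suc m) = k - a"
    by (simp_all add: step_count_def)
qed

lemma step_count_skip:
  assumes "\<And>i. a < i \<Longrightarrow> i \<le> a + n \<Longrightarrow> \<pi> i \<noteq> Suc m"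
  shows "step_count \<pi> a n (Suc m) = step_count \<pi> a n m"
proof -
  have "{i \<in> {a + 1..a + n}. \<pi> i \<le> Suc m} = {i \<in> {a + 1..a + n}. \<pi> i \<le> m}"
    using assms le_Suc_eq by auto
  then show ?thesis by (simp add: step_count_def)
qed

context group
begin

lemma foldr_mult_snoc:
  "set l \<subseteq> carrier G \<Longrightarrow> g \<in> carrier G \<Longrightarrow> foldr (\<otimes>) (l @ [g]) \<one> = foldr (\<otimes>) l \<one> \<otimes> g"
  by (induction l) (auto simp: m_assoc foldr_mult_closed)

text \<open>The product telescopes. It identifies the element u of the shuffle formula as a quotient
  of vertices; for \<open>r\<close> the last position the list is empty and the quotient is
  1.\<close>

lemma foldr_drop_bar_of_vertices:
  assumes "set xs \<subseteq> carrier G" "xs \<noteq> []" "r < length xs"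
  shows "foldr (\<otimes>) (drop r (butlast (bar_of_vertices G xs))) \<one> = xs ! r \<otimes> inv (last xs)"
proof -
  let ?l = "bar_of_vertices G xs"
  have ne: "?l \<noteq> []" using assms(2) by simp
  have closed: "set (drop r (butlast ?l)) \<subseteq> carrier G"
    using bar_of_vertices_closed[OF assms(1)] by (meson in_set_butlastD in_set_dropD subset_iff)
  have last: "last xs \<in> carrier G" using assms(1,2) last_in_set by blast
  have "drop r ?l = drop r (butlast ?l) @ [last xs]"
  proof -
    have "?l = butlast ?l @ [last xs]"
      using append_butlast_last_id[OF ne] last_bar_of_vertices[OF assms(2), of G] by simp
    then have "drop r ?l = drop r (butlast ?l @ [last xs])" by simp
    also have "\<dots> = drop r (butlast ?l) @ [last xs]" using assms(3) by simp
    finally show ?thesis .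
  qed
  moreover have "xs ! r = foldr (\<otimes>) (drop r ?l) \<one>"
    using nth_vertices_of_bar[of r ?l G] assms(3) vertices_of_bar_of_vertices[OF assms(1)] by simp
  ultimately have "xs ! r = foldr (\<otimes>) (drop r (butlast ?l)) \<one> \<otimes> last xs"
    using foldr_mult_snoc[OF closed last] by simp
  then show ?thesis using foldr_mult_closed[OF closed] last by (simp add: m_assoc)
qed

text \<open>The entry at each time is a quotient of consecutive products. A step from x to x' in the
  first factor gives (x z)(x' z)^-1 = x x'^-1, an entry of the first list. A step from z to z' in
  the second gives (x z)(x z')^-1 = x (z z'^-1) x^-1. Writing x = u g with g the last vertex of the
  first list turns this into the conjugate by u of g (z z'^-1) g^-1, as in the definition of \<tau>.
  The action by (g k)^-1 replaces the final entry 1 by g k, the product of the last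
  vertices.\<close>

lemma shuffle_gen_of_vertices:
  assumes xs: "set xs \<subseteq> carrier G" "length xs = Suc p" and zs: "set zs \<subseteq> carrier G" "length zs = Suc q"
    and \<pi>: "\<pi> \<in> shuffle_perms p q"
  shows "bar_act_gen G (inv (last xs \<otimes> last zs))
      (shuffle_gen G \<pi> (butlast (bar_of_vertices G xs))
        (map (\<lambda>y. last xs \<otimes> y \<otimes> inv (last xs)) (butlast (bar_of_vertices G zs))))
    = product_bar G (shuffle_vertices \<pi> xs zs)"
proof -
  note perm = shuffle_permsD(1)[OF \<pi>]
  let ?gs = "butlast (bar_of_vertices G xs)" and ?g = "last xs" and ?k = "last zs"
  let ?ks = "map (\<lambda>y. ?g \<otimes> y \<otimes> inv ?g) (butlast (bar_of_vertices G zs))"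
  let ?f = "\<lambda>m. shuffle_entry G \<pi> ?gs ?ks (inv_into UNIV \<pi> m)"
  let ?V = "map (\<lambda>(x, z). x \<otimes> z) (shuffle_vertices \<pi> xs zs)"
  have ne: "xs \<noteq> []" "zs \<noteq> []" using xs zs by auto
  have g: "?g \<in> carrier G" "?k \<in> carrier G" using ne xs zs last_in_set by blast+
  have xi: "xs ! i \<in> carrier G" if "i \<le> p" for i using that xs by (metis le_imp_less_Suc nth_mem subset_iff)
  have zi: "zs ! i \<in> carrier G" if "i \<le> q" for i using that zs by (metis le_imp_less_Suc nth_mem subset_iff)
  let ?X = "\<lambda>m. xs ! step_count \<pi> 0 p m" and ?Z = "\<lambda>m. zs ! step_count \<pi> p q m"
  have XZ: "?X m \<in> carrier G" "?Z m \<in> carrier G" for m by (simp_all add: xi zi step_count_le)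
  have V: "?V = map (\<lambda>m. ?X m \<otimes> ?Z m) [0..<Suc (p + q)]"
    using xs zs by (simp add: shuffle_vertices_def Let_def)
  have last_V: "?X (p + q) \<otimes> ?Z (p + q) = ?g \<otimes> ?k"
  proof -
    have "\<pi> i \<le> p + q" if "0 < i" "i \<le> p + q" for i
      using permutes_in_image[OF perm, of i] that by auto
    then have "step_count \<pi> 0 p (p + q) = p" "step_count \<pi> p q (p + q) = q"
      by (auto intro!: step_count_full)
    then show ?thesis using ne xs(2) zs(2) by (simp add: last_conv_nth)
  qed
  have entry: "?f (Suc m) = (?X m \<otimes> ?Z m) \<otimes> inv (?X (Suc m) \<otimes> ?Z (Suc m))" if m: "m < p + q" for m
  proof -
    define i where "i = inv_into UNIV \<pi> (Suc m)"
    have \<pi>i: "\<pi> i = Suc m" unfolding i_def by (rule surj_f_inv_f[OF permutes_surj[OF perm]])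
    have "\<pi> i \<in> {1..p + q}" using m \<pi>i by simp
    then have i: "1 \<le> i" "i \<le> p + q" using permutes_in_image[OF perm, of i] by auto
    have other: "\<pi> j \<noteq> Suc m" if "j \<noteq> i" for j using \<pi>i that injD[OF permutes_inj[OF perm], of i j] by auto
    show ?thesis
    proof (cases "i \<le> p")
      case True
      have "step_count \<pi> 0 p m = i - 1" "step_count \<pi> 0 p (Suc m) = i"
        using step_count_initial[of 0 p \<pi> i m] shuffle_permsD(2)[OF \<pi>] i True \<pi>i by auto
      moreover have "step_count \<pi> p q (Suc m) = step_count \<pi> p q m"
        by (rule step_count_skip) (use other True in auto)
      moreover have "?f (Suc m) = xs ! (i - 1) \<otimes> inv (xs ! i)"
        using True i xs(2) nth_bar_of_vertices[of "i - 1" xs G]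
        by (simp add: shuffle_entry_def Let_def i_def[symmetric] nth_butlast)
      moreover have "(x \<otimes> z) \<otimes> inv (y \<otimes> z) = x \<otimes> inv y"
        if "x \<in> carrier G" "y \<in> carrier G" "z \<in> carrier G" for x y z
      proof -
        have "z \<otimes> (inv z \<otimes> inv y) = inv y" using that by (simp add: m_assoc[symmetric])
        then show ?thesis using that by (simp add: inv_mult_group m_assoc)
      qed
      ultimately show ?thesis using XZ[of m] XZ[of "Suc m"] by simp
    next
      case False
      have c2: "step_count \<pi> p q m = i - p - 1" "step_count \<pi> p q (Suc m) = i - p"
        using step_count_initial[of p q \<pi> i m] shuffle_permsD(3)[OF \<pi>] i False \<pi>i by auto
      have c1: "step_count \<pi> 0 p (Suc m) = step_count \<pi> 0 p m"
        by (rule step_count_skip) (use other False in auto)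
      \<comment> \<open>Of the \<open>\<pi> i - 1\<close> steps already taken,
        \<open>i - p - 1\<close> lie in the second factor. The remaining number is the offset used
        in \<open>shuffle_entry\<close>, so u starts at the current vertex of the first
        factor.\<close>
      have r: "step_count \<pi> 0 p m = p + \<pi> i - i"
        using step_count_total[OF \<pi>, of m] m c2(1) \<pi>i False by simp
      have u: "foldr (\<otimes>) (drop (p + \<pi> i - i) ?gs) \<one> = ?X m \<otimes> inv ?g"
        using foldr_drop_bar_of_vertices[OF xs(1) ne(1), of "p + \<pi> i - i"] step_count_le[of \<pi> 0 p m] xs(2) r
        by simp
      have j: "i - p - 1 < q" "Suc (i - p - 1) = i - p" using False i by auto
      have ks: "?ks ! (i - p - 1) = ?g \<otimes> (?Z m \<otimes> inv (?Z (Suc m))) \<otimes> inv ?g"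
        using j zs(2) nth_bar_of_vertices[of "i - p - 1" zs G] by (simp add: nth_butlast c2)
      have "?f (Suc m) = (?X m \<otimes> inv ?g) \<otimes> (?g \<otimes> (?Z m \<otimes> inv (?Z (Suc m))) \<otimes> inv ?g) \<otimes> inv (?X m \<otimes> inv ?g)"
        using False xs(2) u ks by (simp add: shuffle_entry_def Let_def i_def[symmetric])
      also have "\<dots> = (?X m \<otimes> ?Z m) \<otimes> inv (?X m \<otimes> ?Z (Suc m))"
      proof -
        have canc: "inv ?g \<otimes> (?g \<otimes> y) = y" if "y \<in> carrier G" for y
          using that g by (simp add: m_assoc[symmetric])
        show ?thesis using XZ[of m] XZ[of "Suc m"] g by (simp add: inv_mult_group m_assoc canc)
      qed
      finally show ?thesis using c1 by simp
    qed
  qed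
  have len: "length ?gs = p" "length ?ks = q" using xs zs by simp_all
  have lhs: "bar_act_gen G (inv (?g \<otimes> ?k)) (shuffle_gen G \<pi> ?gs ?ks) = map ?f [1..<p + q + 1] @ [?g \<otimes> ?k]"
    using g xs(2) zs(2) by (simp add: bar_act_gen_def shuffle_gen_def del: upt_Suc)
  have lenV: "length ?V = Suc (p + q)" unfolding V by simp
  have nthV: "?V ! m = ?X m \<otimes> ?Z m" if "m < Suc (p + q)" for m
    unfolding V using that by (simp del: upt_Suc)
  show ?thesis unfolding lhs product_bar_def
  proof (rule nth_equalityI)
    show "length (map ?f [1..<p + q + 1] @ [?g \<otimes> ?k]) = length (bar_of_vertices G ?V)"
      using lenV by (simp del: upt_Suc)
    fix m assume "m < length (map ?f [1..<p + q + 1] @ [?g \<otimes> ?k])"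
    then have "m < p + q \<or> m = p + q" by (auto simp del: upt_Suc)
    then show "(map ?f [1..<p + q + 1] @ [?g \<otimes> ?k]) ! m = bar_of_vertices G ?V ! m"
    proof
      assume m: "m < p + q"
      then have "(map ?f [1..<p + q + 1] @ [?g \<otimes> ?k]) ! m = ?f (Suc m)"
        by (simp add: nth_append del: upt_Suc)
      moreover have "bar_of_vertices G ?V ! m = ?V ! m \<otimes> inv (?V ! Suc m)"
        by (rule nth_bar_of_vertices) (use m lenV in simp)
      ultimately show ?thesis using m by (simp only: nthV entry Suc_less_eq less_SucI)
    next
      assume m: "m = p + q"
      have ne': "?V \<noteq> []" using lenV by (metis length_0_conv nat.distinct(1))
      have "bar_of_vertices G ?V ! m = last (bar_of_vertices G ?V)"
        using ne' lenV m by (subst last_conv_nth) auto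
      also have "\<dots> = last ?V" by (rule last_bar_of_vertices[OF ne'])
      also have "\<dots> = ?V ! (p + q)" using ne' lenV by (subst last_conv_nth) auto
      also have "\<dots> = ?g \<otimes> ?k" using nthV[of "p + q"] last_V by simp
      finally show ?thesis
        using nth_append_length[of "map ?f [1..<p + q + 1]" "?g \<otimes> ?k" "[]"] unfolding m length_map length_upt by simp
    qed
  qed
qed

lemma shuffle_hom_gen_of_vertices:
  assumes xs: "set xs \<subseteq> carrier G" "xs \<noteq> []" and zs: "set zs \<subseteq> carrier G" "zs \<noteq> []"
  shows "shuffle_hom_gen G (bar_of_vertices G xs, bar_of_vertices G zs)
    = frag_map (product_bar G) (shuffle_product xs zs)"
proof -
  obtain p q where pq: "length xs = Suc p" "length zs = Suc q" using xs(2) zs(2) by (cases xs; cases zs) auto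
  show ?thesis
    unfolding shuffle_hom_gen_def split Let_def
    using pq xs zs
    by (simp add: shuffle_product_def frag_extend_sum[OF finite_shuffle_perms] frag_extend_cmul res_act_bar
        last_bar_of_vertices) (rule sum.cong, simp_all add: shuffle_gen_of_vertices)
qed

end

lemma shuffle_hom_frag_of [simp]: "shuffle_hom K (frag_of x) = shuffle_hom_gen K x"
  by (simp add: shuffle_hom_def)

section \<open>Boundary and action under the shuffle homomorphism\<close>

context group
begin

lemma keys_shuffle_product_closed:
  assumes "set xs \<subseteq> carrier G" "set zs \<subseteq> carrier G" "length xs + length zs = Suc (Suc n)"
  shows "Poly_Mapping.keys (shuffle_product xs zs) \<subseteq> {v. length v = Suc n \<and> set v \<subseteq> carrier G \<times> carrier G}"
  using keys_shuffle_product[of xs zs] assms by fastforce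

lemma product_bar_chain_eq:
  "frag_map (product_bar G) c
    = frag_map (bar_of_vertices G) (frag_map (map (\<lambda>(x, z). x \<otimes> z)) c)"
proof -
  have "product_bar G = bar_of_vertices G \<circ> map (\<lambda>(x, z). x \<otimes> z)"
    by (simp add: fun_eq_iff product_bar_def)
  then show ?thesis by (simp only: frag_extend_compose comp_assoc)
qed

lemma keys_product_chain:
  assumes "Poly_Mapping.keys c \<subseteq> {v. length v = n \<and> set v \<subseteq> carrier G \<times> carrier G}"
  shows "Poly_Mapping.keys (frag_map (map (\<lambda>(x, z). x \<otimes> z)) c)
    \<subseteq> {v. length v = n \<and> set v \<subseteq> carrier G}"
  using keys_frag_extend[of "frag_of \<circ> map (\<lambda>(x, z). x \<otimes> z)" c] assms by fastforce

text \<open>Multiplying coordinates is a map on vertices, hence commutes with deleting a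
  vertex.\<close>

lemma bar_bdry_product_chain:
  assumes "Poly_Mapping.keys c \<subseteq> {v. length v = Suc (Suc n) \<and> set v \<subseteq> carrier G \<times> carrier G}"
  shows "res_bdry Bar (frag_map (product_bar G) c)
    = frag_map (product_bar G) (frag_extend simplex_bdry c)"
proof -
  have "frag_extend simplex_bdry (frag_map (map (\<lambda>(x, z). x \<otimes> z)) c)
      = frag_map (map (\<lambda>(x, z). x \<otimes> z)) (frag_extend simplex_bdry c)"
    by (induction c rule: frag_induction[OF subset_UNIV]) (auto simp: frag_extend_diff simplex_bdry_map comp_def)
  then show ?thesis
    unfolding product_bar_chain_eq bar_bdry_chain_of_vertices[OF keys_product_chain[OF assms]] by simp
qed

lemma tot_basis_vertices:
  assumes "x \<in> res_basis Tot n"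
  obtains xs zs where "x = (bar_of_vertices G xs, bar_of_vertices G zs)" "xs \<noteq> []" "zs \<noteq> []"
    "length xs + length zs = Suc (Suc n)" "set xs \<subseteq> carrier G" "set zs \<subseteq> carrier G"
proof -
  obtain as bs p q where x: "x = (as, bs)" "n = p + q"
    and as: "as \<in> res_basis Bar p" and bs: "bs \<in> res_basis Bar q"
    using assms by (rule tot_basis_cases)
  obtain xs where xs: "as = bar_of_vertices G xs" "length xs = Suc p" "set xs \<subseteq> carrier G"
    using as by (rule bar_basis_cases)
  obtain zs where zs: "bs = bar_of_vertices G zs" "length zs = Suc q" "set zs \<subseteq> carrier G"
    using bs by (rule bar_basis_cases)
  have "xs \<noteq> []" "zs \<noteq> []" using xs zs by auto
  then show ?thesis using that[of xs zs] xs zs x by simp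
qed

text \<open>Bar and simplicial boundary correspond except at a single vertex. There the bar side is
  zero, and the simplicial side produces the empty list, which the shuffle product sends to zero, so
  the formulas hold without exception.\<close>

lemma shuffle_hom_tensor_bdry:
  assumes xs: "set xs \<subseteq> carrier G" "xs \<noteq> []" and zs: "set zs \<subseteq> carrier G" "zs \<noteq> []"
  shows "shuffle_hom G (frag_tensor (res_bdry Bar (frag_of (bar_of_vertices G xs))) (frag_of (bar_of_vertices G zs)))
      = frag_map (product_bar G) (frag_extend (\<lambda>xs'. shuffle_product xs' zs) (simplex_bdry xs))"
    and "shuffle_hom G (frag_tensor (frag_of (bar_of_vertices G xs)) (res_bdry Bar (frag_of (bar_of_vertices G zs))))
      = frag_map (product_bar G) (frag_extend (shuffle_product xs) (simplex_bdry zs))"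
proof -
  let ?D = "frag_map (bar_of_vertices G)" and ?\<Phi> = "frag_map (product_bar G)"
  have left: "shuffle_hom G (frag_tensor (?D c) (frag_of (bar_of_vertices G zs)))
      = ?\<Phi> (frag_extend (\<lambda>xs'. shuffle_product xs' zs) c)"
    if "Poly_Mapping.keys c \<subseteq> {ys. ys \<noteq> [] \<and> set ys \<subseteq> carrier G}" for c
    using that
    by (induction c rule: frag_induction)
      (auto simp: shuffle_hom_def frag_extend_diff frag_tensor_diff_left shuffle_hom_gen_of_vertices zs comp_def)
  have right: "shuffle_hom G (frag_tensor (frag_of (bar_of_vertices G xs)) (?D c))
      = ?\<Phi> (frag_extend (shuffle_product xs) c)"
    if "Poly_Mapping.keys c \<subseteq> {ys. ys \<noteq> [] \<and> set ys \<subseteq> carrier G}" for c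
    using that
    by (induction c rule: frag_induction)
      (auto simp: shuffle_hom_def frag_extend_diff frag_tensor_diff_right shuffle_hom_gen_of_vertices xs comp_def)
  have bdry: "(\<exists>y. ys = [y]) \<and> res_bdry Bar (frag_of (bar_of_vertices G ys)) = 0
      \<or> Poly_Mapping.keys (simplex_bdry ys) \<subseteq> {ys. ys \<noteq> [] \<and> set ys \<subseteq> carrier G}
        \<and> res_bdry Bar (frag_of (bar_of_vertices G ys)) = ?D (simplex_bdry ys)"
    if ys: "set ys \<subseteq> carrier G" "ys \<noteq> []" for ys
  proof (cases "length ys")
    case (Suc n)
    show ?thesis
    proof (cases n)
      case 0
      then show ?thesis using Suc by (auto simp: length_Suc_conv bar_bdry_vertex)
    next
      case (Suc m)
      then have "length ys = Suc (Suc m)" using \<open>length ys = Suc n\<close> by simp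
      then show ?thesis
        using bar_bdry_of_vertices[OF ys(1)] keys_simplex_bdry_closed[OF _ ys(1)] by fastforce
    qed
  qed (use ys in simp)
  show "shuffle_hom G (frag_tensor (res_bdry Bar (frag_of (bar_of_vertices G xs))) (frag_of (bar_of_vertices G zs)))
      = ?\<Phi> (frag_extend (\<lambda>xs'. shuffle_product xs' zs) (simplex_bdry xs))"
    using bdry[OF xs] by (elim disjE conjE exE) (simp_all only: left, simp add: shuffle_hom_def)
  show "shuffle_hom G (frag_tensor (frag_of (bar_of_vertices G xs)) (res_bdry Bar (frag_of (bar_of_vertices G zs))))
      = ?\<Phi> (frag_extend (shuffle_product xs) (simplex_bdry zs))"
    using bdry[OF zs] by (elim disjE conjE exE) (simp_all only: right, simp add: shuffle_hom_def)
qed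

lemma shuffle_hom_bdry_basis:
  assumes "x \<in> res_basis Tot n"
  shows "res_bdry Bar (shuffle_hom G (frag_of x))
    = shuffle_hom G (res_bdry Tot (frag_of x))"
proof -
  obtain xs zs where x: "x = (bar_of_vertices G xs, bar_of_vertices G zs)" and xs: "set xs \<subseteq> carrier G" "xs \<noteq> []"
    and zs: "set zs \<subseteq> carrier G" "zs \<noteq> []" and n: "length xs + length zs = Suc (Suc n)"
    using assms by (rule tot_basis_vertices)
  note tau = shuffle_hom_gen_of_vertices[OF xs zs]
  show ?thesis
  proof (cases n)
    case 0
    then have "length xs = 1" "length zs = 1" using n xs(2) zs(2) by (cases xs; cases zs; simp)+
    then obtain a b where "xs = [a]" "zs = [b]" by (auto simp: length_Suc_conv)
    then show ?thesis using tau
      by (simp add: x tot_bdry_basis bar_bdry_vertex shuffle_product_singleton product_bar_def)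
        (simp add: shuffle_hom_def)
  next
    case (Suc m)
    have "res_bdry Bar (shuffle_hom G (frag_of x))
      = frag_map (product_bar G) (frag_extend simplex_bdry (shuffle_product xs zs))"
      unfolding x shuffle_hom_frag_of tau
      using keys_shuffle_product_closed[OF xs(1) zs(1) n] Suc by (intro bar_bdry_product_chain) simp
    also have "\<dots> = shuffle_hom G (res_bdry Tot (frag_of x))"
      using Suc n
      by (simp add: x tot_bdry_basis shuffle_product_bdry[OF xs(2) zs(2)] frag_extend_add frag_extend_cmul
          shuffle_hom_tensor_bdry[OF xs zs, symmetric]) (simp add: shuffle_hom_def frag_extend_add frag_extend_cmul)
    finally show ?thesis .
  qed
qed

lemma shuffle_hom_closed_basis:
  assumes "x \<in> res_basis Tot n"
  shows "shuffle_hom G (frag_of x) \<in> chains Bar n"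
proof -
  obtain xs zs where x: "x = (bar_of_vertices G xs, bar_of_vertices G zs)" and xs: "set xs \<subseteq> carrier G" "xs \<noteq> []"
    and zs: "set zs \<subseteq> carrier G" "zs \<noteq> []" and n: "length xs + length zs = Suc (Suc n)"
    using assms by (rule tot_basis_vertices)
  show ?thesis
    unfolding x shuffle_hom_frag_of shuffle_hom_gen_of_vertices[OF xs zs] product_bar_chain_eq
    by (intro bar_chain_of_vertices_closed keys_product_chain keys_shuffle_product_closed[OF xs(1) zs(1) n])
qed

lemma shuffle_hom_act_basis:
  assumes x: "x \<in> res_basis Tot n" and k: "k \<in> carrier G" and g: "g \<in> carrier G"
  shows "shuffle_hom G (res_act Tot (k, g) (frag_of x))
    = res_act Bar (k \<otimes> g) (shuffle_hom G (frag_of x))"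
proof -
  obtain xs zs where x: "x = (bar_of_vertices G xs, bar_of_vertices G zs)" and xs: "set xs \<subseteq> carrier G" "xs \<noteq> []"
    and zs: "set zs \<subseteq> carrier G" "zs \<noteq> []" and n: "length xs + length zs = Suc (Suc n)"
    using assms(1) by (rule tot_basis_vertices)
  let ?f = "\<lambda>x. x \<otimes> inv g" and ?c = "\<lambda>y. g \<otimes> y \<otimes> inv g" and ?k = "\<lambda>y. y \<otimes> inv k"
  let ?h = "?k \<circ> ?c"
  have cl: "set (map ?f xs) \<subseteq> carrier G" "set (map ?c zs) \<subseteq> carrier G" "set (map ?h zs) \<subseteq> carrier G"
    using xs zs g k by auto
  \<comment> \<open>Conjugation is a homomorphism, so it may be applied to the vertices before
    forming quotients.\<close>
  have "map ?c (bar_of_vertices G zs) = bar_of_vertices G (map ?c zs)"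
    using bar_of_vertices_map_hom[OF is_group conj_hom[OF g] zs(1)] by simp
  moreover have "bar_act_gen G k (bar_of_vertices G (map ?c zs)) = bar_of_vertices G (map ?h zs)"
    using bar_act_gen_of_vertices[OF cl(2) _ k] zs(2) by simp
  ultimately have act: "tot_act_gen G (k, g) x = (bar_of_vertices G (map ?f xs), bar_of_vertices G (map ?h zs))"
    using xs zs g by (simp add: x tot_act_gen_eq bar_act_gen_of_vertices)
  have mult: "?f a \<otimes> ?h b = (a \<otimes> b) \<otimes> inv (k \<otimes> g)" if "a \<in> carrier G" "b \<in> carrier G" for a b
  proof -
    have "inv g \<otimes> (g \<otimes> y) = y" if "y \<in> carrier G" for y using that g by (simp add: m_assoc[symmetric])
    then show ?thesis using that g k by (simp add: inv_mult_group m_assoc)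
  qed
  have step: "product_bar G (map (map_prod ?f ?h) v) = bar_act_gen G (k \<otimes> g) (product_bar G v)"
    if v: "v \<noteq> []" "set v \<subseteq> carrier G \<times> carrier G" for v
  proof -
    have eq: "map (\<lambda>(x, z). x \<otimes> z) (map (map_prod ?f ?h) v) = map (\<lambda>y. y \<otimes> inv (k \<otimes> g)) (map (\<lambda>(x, z). x \<otimes> z) v)"
      using v mult by auto
    have "set (map (\<lambda>(x, z). x \<otimes> z) v) \<subseteq> carrier G" using v by auto
    then show ?thesis
      unfolding product_bar_def eq by (intro bar_act_gen_of_vertices[symmetric]) (use v(1) g k in auto)
  qed
  have "shuffle_hom G (res_act Tot (k, g) (frag_of x))
    = frag_map (product_bar G) (shuffle_product (map ?f xs) (map ?h zs))"
    using shuffle_hom_gen_of_vertices[OF cl(1) _ cl(3)] xs zs by (simp add: res_act_tot act)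
  also have "\<dots> = frag_map (product_bar G \<circ> map (map_prod ?f ?h)) (shuffle_product xs zs)"
    by (simp only: shuffle_product_map frag_extend_compose comp_assoc)
  also have "\<dots> = frag_map (bar_act_gen G (k \<otimes> g) \<circ> product_bar G) (shuffle_product xs zs)"
  proof (rule frag_extend_eq)
    fix v assume "v \<in> Poly_Mapping.keys (shuffle_product xs zs)"
    then have "v \<noteq> []" "set v \<subseteq> carrier G \<times> carrier G"
      using keys_shuffle_product_closed[OF xs(1) zs(1) n] by auto
    then show "(frag_of \<circ> (product_bar G \<circ> map (map_prod ?f ?h))) v = (frag_of \<circ> (bar_act_gen G (k \<otimes> g) \<circ> product_bar G)) v"
      unfolding comp_apply[of frag_of] comp_apply[of "product_bar G"] comp_apply[of "bar_act_gen G (k \<otimes> g)"]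
      by (rule arg_cong[OF step])
  qed
  also have "\<dots> = res_act Bar (k \<otimes> g) (frag_map (product_bar G) (shuffle_product xs zs))"
    by (simp only: res_act_bar frag_extend_compose comp_assoc)
  also have "\<dots> = res_act Bar (k \<otimes> g) (shuffle_hom G (frag_of x))"
    using shuffle_hom_gen_of_vertices[OF xs zs] by (simp add: x)
  finally show ?thesis .
qed

lemma shuffle_hom_vertex:
  assumes "a \<in> carrier G" "b \<in> carrier G"
  shows "shuffle_hom G (frag_of ([a], [b])) = frag_of [a \<otimes> b]"
  using shuffle_hom_gen_of_vertices[of "[a]" "[b]"] assms
  by (simp add: shuffle_product_singleton product_bar_def)

lemma resolution_pair_mu:
  "resolution_pair (conj_semidirect G) Tot G Bar (semidirect_mu G)"
  by (intro resolution_pair.intro resolution_pair_axioms.intro free_resolution_tot free_resolution_bar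
      semidirect_mu_hom is_group)

theorem shuffle_hom_equivariant_chain_map:
  "equivariant_chain_map (conj_semidirect G) Tot Bar (semidirect_mu G) (shuffle_hom G)"
  "c \<in> chains Tot 0 \<Longrightarrow> res_aug Bar (shuffle_hom G c) = res_aug Tot c"
proof -
  interpret resolution_pair "conj_semidirect G" Tot G Bar "semidirect_mu G"
    by (rule resolution_pair_mu)
  have [simp]: "shuffle_hom G 0 = 0" by (simp add: shuffle_hom_def)
  have diff: "shuffle_hom G (c - d) = shuffle_hom G c - shuffle_hom G d"
    and add: "shuffle_hom G (c + d) = shuffle_hom G c + shuffle_hom G d" for c d
    by (simp_all add: shuffle_hom_def frag_extend_diff frag_extend_add)
  have closed: "shuffle_hom G c \<in> chains Bar n" if "c \<in> chains Tot n" for c n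
    using that
    by (induction c rule: chains_induct)
      (simp_all add: diff S.chains_diff shuffle_hom_closed_basis del: shuffle_hom_frag_of)
  have act: "shuffle_hom G (res_act Tot u c) = res_act Bar (semidirect_mu G u) (shuffle_hom G c)"
    if "c \<in> chains Tot n" "u \<in> carrier (conj_semidirect G)" for c n u
    using that
  proof (induction c rule: chains_induct)
    case (one x)
    then show ?case using shuffle_hom_act_basis[of x n "fst u" "snd u"]
      by (cases u) (simp add: conj_semidirect_def semidirect_mu_def del: shuffle_hom_frag_of)
  qed (auto simp: diff R.act_diff S.act_diff)
  have bdry: "res_bdry Bar (shuffle_hom G c) = shuffle_hom G (res_bdry Tot c)"
    if "c \<in> chains Tot n" for c n
    using that
    by (induction c rule: chains_induct)
      (simp_all add: diff R.bdry_diff S.bdry_diff shuffle_hom_bdry_basis del: shuffle_hom_frag_of)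
  show "equivariant_chain_map (conj_semidirect G) Tot Bar (semidirect_mu G) (shuffle_hom G)"
    using closed act bdry by (simp add: equivariant_chain_map_def equivariant_def add)
  show "res_aug Bar (shuffle_hom G c) = res_aug Tot c"
    if "c \<in> chains Tot 0"
    using that
  proof (induction c rule: chains_induct)
    case (one x)
    obtain xs ys where x: "x = (xs, ys)" by (cases x)
    then have "length xs = 1" "length ys = 1" using one by (cases xs; cases ys; simp)+
    then obtain a b where "xs = [a]" "ys = [b]" by (auto simp: length_Suc_conv)
    then show ?case using one x shuffle_hom_vertex[of a b] by (simp del: shuffle_hom_frag_of)
  qed (simp_all add: diff R.aug_diff S.aug_diff)
qed

end

text \<open>The pushforward is computed with bar resolutions and \<tau> starts from the total
  complex, so the two maps are related through comparison maps \<phi>. The existence clause keeps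
  the last clause from being vacuous, the isomorphism clause makes each \<phi> an identification,
  and quantifying over all \<phi> makes the equality independent of a choice.\<close>

theorem theorem2p2:
  fixes K :: "('a, 'm) monoid_scheme"
  assumes "group K"
  shows "is_chain_map (tot_resolution K) (bar_resolution K) (shuffle_hom K)
    \<and> (\<forall>a\<in>carrier K. \<forall>h\<in>carrier K. \<forall>g\<in>carrier K. \<forall>k\<in>carrier K. \<forall>gs ks.
         set gs \<subseteq> carrier K \<and> set ks \<subseteq> carrier K \<longrightarrow>
         shuffle_hom K (res_act (tot_resolution K) (inv\<^bsub>K\<^esub> a, inv\<^bsub>K\<^esub> h) (frag_of (gs @ [g], ks @ [k])))
           = res_act (bar_resolution K) (inv\<^bsub>K\<^esub> (h \<otimes>\<^bsub>K\<^esub> a)) (shuffle_hom K (frag_of (gs @ [g], ks @ [k]))))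
    \<and> (\<forall>k\<in>carrier K. \<forall>g\<in>carrier K.
         res_aug (tot_resolution K) (frag_of ([k], [g])) = res_aug (bar_resolution K) (frag_of [k \<otimes>\<^bsub>K\<^esub> g])
         \<and> shuffle_hom K (frag_of ([k], [g])) = frag_of [k \<otimes>\<^bsub>K\<^esub> g])
    \<and> (\<forall>n. homology_map K (bar_resolution K) n (shuffle_hom K)
         \<in> hom (homology (conj_semidirect K) (tot_resolution K) n) (homology K (bar_resolution K) n))
    \<and> (\<exists>\<phi>. is_comparison_map (conj_semidirect K) (bar_resolution (conj_semidirect K)) (tot_resolution K) \<phi>)
    \<and> (\<forall>\<phi>. is_comparison_map (conj_semidirect K) (bar_resolution (conj_semidirect K)) (tot_resolution K) \<phi> \<longrightarrow>
         (\<forall>n. homology_map (conj_semidirect K) (tot_resolution K) n \<phi>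
               \<in> iso (homology (conj_semidirect K) (bar_resolution (conj_semidirect K)) n)
                     (homology (conj_semidirect K) (tot_resolution K) n)
            \<and> (\<forall>x\<in>carrier (homology (conj_semidirect K) (bar_resolution (conj_semidirect K)) n).
                 homology_map K (bar_resolution K) n (shuffle_hom K)
                     (homology_map (conj_semidirect K) (tot_resolution K) n \<phi> x)
                   = pushforward K n (semidirect_mu K) x)))"
proof -
  interpret K: group K by fact
  interpret L: group "conj_semidirect K" by (rule group_conj_semidirect[OF assms])
  let ?L = "conj_semidirect K" and ?B = "bar_resolution K" and ?T = "tot_resolution K"
  let ?BL = "bar_resolution (conj_semidirect K)" and ?\<mu> = "semidirect_mu K" and ?\<tau> = "shuffle_hom K"
  interpret BL: free_resolution ?L ?BL by (rule L.free_resolution_bar)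
  interpret TB: resolution_pair ?L ?T K ?B ?\<mu> by (rule K.resolution_pair_mu)
  interpret BT: resolution_pair ?L ?BL ?L ?T "\<lambda>x. x" by unfold_locales (simp add: hom_def)
  interpret BB: resolution_pair ?L ?BL K ?B ?\<mu> by unfold_locales (rule semidirect_mu_hom[OF assms])
  note \<tau> = K.shuffle_hom_equivariant_chain_map
  note \<mu> = bar_map_equivariant_chain_map[OF L.is_group assms semidirect_mu_hom[OF assms]]
  have 1: "is_chain_map ?T ?B ?\<tau>"
    using \<tau>(1) by (auto simp: is_chain_map_def is_graded_hom_def equivariant_chain_map_def equivariant_def hom_def)
  have 2: "?\<tau> (res_act ?T (inv\<^bsub>K\<^esub> a, inv\<^bsub>K\<^esub> h) (frag_of (gs @ [g], ks @ [k])))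
      = res_act ?B (inv\<^bsub>K\<^esub> (h \<otimes>\<^bsub>K\<^esub> a)) (?\<tau> (frag_of (gs @ [g], ks @ [k])))"
    if "a \<in> carrier K" "h \<in> carrier K" "g \<in> carrier K" "k \<in> carrier K" "set gs \<subseteq> carrier K" "set ks \<subseteq> carrier K"
    for a h g k gs ks
    using that K.shuffle_hom_act_basis[of "(gs @ [g], ks @ [k])" "length gs + length ks" "inv\<^bsub>K\<^esub> a" "inv\<^bsub>K\<^esub> h"]
    by (simp add: K.inv_mult_group del: shuffle_hom_frag_of)
  have 3: "\<exists>\<phi>. is_comparison_map ?L ?BL ?T \<phi>"
    using BT.exists_equivariant_chain_map
      comparison_map_iff[OF BL.free_resolution_axioms TB.R.free_resolution_axioms] by blast
  have 4: "homology_map K ?B n ?\<tau> (homology_map ?L ?T n \<phi> x) = pushforward K n ?\<mu> x"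
    if "is_comparison_map ?L ?BL ?T \<phi>" and x: "x \<in> carrier (homology ?L ?BL n)" for \<phi> n x
  proof -
    have \<phi>: "equivariant_chain_map ?L ?BL ?T (\<lambda>x. x) \<phi>" "\<And>c. c \<in> chains ?BL 0 \<Longrightarrow> res_aug ?T (\<phi> c) = res_aug ?BL c"
      using that(1) comparison_map_iff[OF BL.free_resolution_axioms TB.R.free_resolution_axioms] by auto
    have \<tau>\<phi>: "equivariant_chain_map ?L ?BL ?B ?\<mu> (\<lambda>c. ?\<tau> (\<phi> c))"
      using equivariant_chain_map_comp[OF BT.resolution_pair_axioms \<phi>(1) \<tau>(1)] by (simp add: comp_def)
    have "res_aug ?B (?\<tau> (\<phi> c)) = res_aug ?BL c" if "c \<in> chains ?BL 0" for c
      using \<tau>(2)[OF equivariant_closed[OF equivariant_chain_mapD(1)[OF \<phi>(1)] that]] \<phi>(2)[OF that] by simp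
    then obtain h where h: "equivariant_homotopy ?L ?BL ?B ?\<mu> h (\<lambda>c. ?\<tau> (\<phi> c)) (bar_map ?\<mu>)"
      using BB.exists_equivariant_homotopy[OF \<tau>\<phi> _ \<mu>(1)] \<mu>(2) by blast
    show ?thesis
      unfolding pushforward_def
      using homology_map_comp[OF BT.resolution_pair_axioms TB.resolution_pair_axioms \<phi>(1) \<tau>(1) x]
        BB.homology_map_homotopic[OF \<tau>\<phi> \<mu>(1) h x] by simp
  qed
  show ?thesis
    using 1 2 3 4 K.shuffle_hom_vertex TB.homology_map_hom[OF \<tau>(1)]
      comparison_map_iso[OF BT.resolution_pair_axioms]
    by (simp del: shuffle_hom_frag_of)
qed

end
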